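(* There exists a universal constant $C>0$ such that, for every integer $N\ge1$ and every $\alpha\in\mathbb D$, with $\Theta=b_\alpha^N$ where $b_\alpha(z)=\frac{\alpha-z}{1-\bar\alpha z}$, any truncated Toeplitz operator $A_\phi^\Theta$ on $K_\Theta$ ($\phi\in L^2$) has a symbol $\phi_0\in L^\infty$ such that $\|\phi_0\|_\infty\le C\,\rho(A_\phi^\Theta)$.
   Context: $\mathbb D$ is the open unit disc, $\mathbb T$ the unit circle with normalized Lebesgue measure $m$, $L^p=L^p(\mathbb T,m)$, and $H^p$ is the Hardy space, regarded as a subspace of $L^p$ via boundary values. For an inner function $\Theta$ (nonconstant $\Theta\in H^\infty$ with $|\Theta|=1$ a.e. on $\mathbb T$), $K_\Theta=H^2\ominus\Theta H^2$ and $P_\Theta$ is the orthogonal projection of $L^2$ onto $K_\Theta$. For $\phi\in L^2$, the truncated Toeplitz operator $A_\phi^\Theta$ is the densely defined operator in $K_\Theta$ with domain $K_\Theta\cap H^\infty$, $A_\phi^\Theta f=P_\Theta(\phi f)$. A symbol of a truncated Toeplitz operator $A$ is any $\phi\in L^2$ with $A=A_\phi^\Theta$; it is not unique. For $\lambda\in\mathbb D$ put $$h_\lambda^\Theta(z)=\sqrt{\frac{1-|\lambda|^2}{1-|\Theta(\lambda)|^2}}\,\frac{1-\overline{\Theta(\lambda)}\Theta(z)}{1-\bar\lambda z},\qquad \tilde h_\lambda^\Theta(z)=\sqrt{\frac{1-|\lambda|^2}{1-|\Theta(\lambda)|^2}}\,\frac{\Theta(z)-\Theta(\lambda)}{z-\lambda}$$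 (normalized reproducing kernel and normalized difference quotient, both in $K_\Theta\cap H^\infty$). For a linear operator $T$ whose domain contains $K_\Theta\cap H^\infty$, $\rho_r(T)=\sup_{\lambda\in\mathbb D}\|Th_\lambda^\Theta\|_2$, $\rho_d(T)=\sup_{\lambda\in\mathbb D}\|T\tilde h_\lambda^\Theta\|_2$, and $\rho(T)=\max\{\rho_r(T),\rho_d(T)\}$. *)

theory Defs
  imports "HOL-Probability.Probability" "HOL-Complex_Analysis.Complex_Analysis"
begin

text \<open>
  Normalized Lebesgue measure on the unit circle. Elements of the spaces below are represented by
  functions on the plane. The space of the measure is the circle itself, so that neither
  measurability nor integrals depend on values off the circle; in particular a function that is
  holomorphic in the disc and arbitrary elsewhere is measurable on each smaller circle.
\<close>

definition circle_measure :: "complex measure" where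
  "circle_measure =
     distr (uniform_measure lborel {0..2 * pi}) (restrict_space borel (sphere 0 1)) cis"

definition L2 :: "(complex \<Rightarrow> complex) set" where
  "L2 = {f \<in> borel_measurable circle_measure. integrable circle_measure (\<lambda>z. (norm (f z))\<^sup>2)}"

definition L2_inner :: "(complex \<Rightarrow> complex) \<Rightarrow> (complex \<Rightarrow> complex) \<Rightarrow> complex" where
  "L2_inner f g = (LINT z|circle_measure. f z * cnj (g z))"

text \<open>Meaningful only on \<^const>\<open>L2\<close>: otherwise the Bochner integral takes a default value.\<close>

definition L2_norm :: "(complex \<Rightarrow> complex) \<Rightarrow> real" where
  "L2_norm f = sqrt (LINT z|circle_measure. (norm (f z))\<^sup>2)"

definition Linf_norm :: "(complex \<Rightarrow> complex) \<Rightarrow> ennreal" where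
  "Linf_norm f = esssup circle_measure (\<lambda>z. ennreal (norm (f z)))"

definition Linf :: "(complex \<Rightarrow> complex) set" where
  "Linf = {f \<in> borel_measurable circle_measure. Linf_norm f < \<infinity>}"

definition has_boundary_values :: "(complex \<Rightarrow> complex) \<Rightarrow> (complex \<Rightarrow> complex) \<Rightarrow> bool" where
  "has_boundary_values F f \<longleftrightarrow>
     (AE z in circle_measure. ((\<lambda>r::real. F (of_real r * z)) \<longlongrightarrow> f z) (at_left 1))"

definition H2 :: "(complex \<Rightarrow> complex) set" where
  "H2 = {f \<in> L2. \<exists>F. F holomorphic_on ball 0 1 \<and>
          (\<exists>B. \<forall>r\<in>{0..<1::real}. (LINT z|circle_measure. (norm (F (of_real r * z)))\<^sup>2) \<le> B) \<and>
          has_boundary_values F f}"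

definition Hinf :: "(complex \<Rightarrow> complex) set" where
  "Hinf = {f \<in> Linf. \<exists>F. F holomorphic_on ball 0 1 \<and> bounded (F ` ball 0 1) \<and>
            has_boundary_values F f}"

text \<open>
  In what follows, an inner function is a function \<open>\<Theta>\<close> on the closed unit disc, holomorphic inside,
  whose values on the circle are its boundary values.
\<close>

definition model_space :: "(complex \<Rightarrow> complex) \<Rightarrow> (complex \<Rightarrow> complex) set" where
  "model_space \<Theta> = {f \<in> H2. \<forall>g\<in>H2. L2_inner f (\<lambda>z. \<Theta> z * g z) = 0}"

text \<open>The projection of a class in \<^const>\<open>L2\<close> is determined only almost everywhere; one
  representative is chosen.\<close>

definition model_proj :: "(complex \<Rightarrow> complex) \<Rightarrow> (complex \<Rightarrow> complex) \<Rightarrow> (complex \<Rightarrow> complex)" where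
  "model_proj \<Theta> u =
     (SOME v. v \<in> model_space \<Theta> \<and> (\<forall>g\<in>model_space \<Theta>. L2_inner (\<lambda>z. u z - v z) g = 0))"

definition tto :: "(complex \<Rightarrow> complex) \<Rightarrow> (complex \<Rightarrow> complex) \<Rightarrow> (complex \<Rightarrow> complex) \<Rightarrow> (complex \<Rightarrow> complex)"
  where "tto \<Theta> \<phi> f = model_proj \<Theta> (\<lambda>z. \<phi> z * f z)"

text \<open>Operators are total functions here, so equality of two operators with domain
  \<open>model_space \<Theta> \<inter> Hinf\<close> is equality of their values on that domain, in \<^const>\<open>L2\<close>.\<close>

definition is_symbol ::
  "(complex \<Rightarrow> complex) \<Rightarrow> (complex \<Rightarrow> complex) \<Rightarrow> ((complex \<Rightarrow> complex) \<Rightarrow> (complex \<Rightarrow> complex)) \<Rightarrow> bool"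
  where
  "is_symbol \<Theta> \<phi> A \<longleftrightarrow> \<phi> \<in> L2 \<and>
     (\<forall>f\<in>model_space \<Theta> \<inter> Hinf. AE z in circle_measure. A f z = tto \<Theta> \<phi> f z)"

definition norm_kernel :: "(complex \<Rightarrow> complex) \<Rightarrow> complex \<Rightarrow> complex \<Rightarrow> complex" where
  "norm_kernel \<Theta> w z =
     of_real (sqrt ((1 - (norm w)\<^sup>2) / (1 - (norm (\<Theta> w))\<^sup>2))) *
     ((1 - cnj (\<Theta> w) * \<Theta> z) / (1 - cnj w * z))"

definition norm_diff_quot :: "(complex \<Rightarrow> complex) \<Rightarrow> complex \<Rightarrow> complex \<Rightarrow> complex" where
  "norm_diff_quot \<Theta> w z =
     of_real (sqrt ((1 - (norm w)\<^sup>2) / (1 - (norm (\<Theta> w))\<^sup>2))) *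
     ((\<Theta> z - \<Theta> w) / (z - w))"

definition rho_r ::
  "(complex \<Rightarrow> complex) \<Rightarrow> ((complex \<Rightarrow> complex) \<Rightarrow> (complex \<Rightarrow> complex)) \<Rightarrow> ennreal" where
  "rho_r \<Theta> T = (SUP w\<in>ball 0 1. ennreal (L2_norm (T (norm_kernel \<Theta> w))))"

definition rho_d ::
  "(complex \<Rightarrow> complex) \<Rightarrow> ((complex \<Rightarrow> complex) \<Rightarrow> (complex \<Rightarrow> complex)) \<Rightarrow> ennreal" where
  "rho_d \<Theta> T = (SUP w\<in>ball 0 1. ennreal (L2_norm (T (norm_diff_quot \<Theta> w))))"

definition rho ::
  "(complex \<Rightarrow> complex) \<Rightarrow> ((complex \<Rightarrow> complex) \<Rightarrow> (complex \<Rightarrow> complex)) \<Rightarrow> ennreal" where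
  "rho \<Theta> T = max (rho_r \<Theta> T) (rho_d \<Theta> T)"

definition blaschke :: "complex \<Rightarrow> complex \<Rightarrow> complex" where
  "blaschke \<alpha> z = (\<alpha> - z) / (1 - cnj \<alpha> * z)"

end

theory Submission
  imports Defs
begin

text \<open>
  The functions \<open>tm_basis \<alpha> j\<close>, \<open>j < N\<close>, form an orthonormal basis of the model space of
  \<open>\<Theta> = (blaschke \<alpha>) ^ N\<close>, and in this basis a truncated Toeplitz operator is the \<open>N \<times> N\<close> Toeplitz
  matrix of the numbers \<open>t (i - j)\<close>, where \<open>t k\<close> is the integral of \<open>\<phi> b\<^sup>-\<^sup>k\<close> against the image of arc
  length under \<open>b = blaschke \<alpha>\<close>. The operator depends on \<open>\<phi>\<close> only through \<open>t k\<close>, \<open>\<bar>k\<bar> < N\<close>, so the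
  task is to find a bounded function \<open>\<psi>\<close> with these Fourier coefficients and to take \<open>\<psi> \<circ> b\<close> as
  symbol. In the basis the test functions become the vectors \<open>(x ^ j)\<close> and \<open>(x ^ (N - 1 - j))\<close> with
  \<open>\<bar>x\<bar> < 1\<close>, normalized, so \<open>\<alpha>\<close> drops out of the problem.

  For \<open>\<bar>k\<bar> < N\<close> the three tents of width \<open>N\<close> centred at \<open>0\<close>, \<open>N\<close> and \<open>-N\<close> add up to \<open>1\<close>, and they
  split \<open>t\<close> into three pieces. The central piece gives the Fejer mean of \<open>t\<close>; its value at \<open>z\<close> is the
  quadratic form of the matrix at a unit vector, a limit of test vectors, so it is bounded by \<open>\<rho>\<close>.
  The two outer pieces are triangular and become Hankel matrices when the rows, respectively the
  columns, are reversed. Since the Fejer kernel is positive and the family of test vectors is invariant under rotation, cutting with a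
  tent preserves the bound on test vectors (\<open>hankel_fejer_multiplier\<close>).

  It remains to treat a Hankel matrix with symbol \<open>g\<close>, a polynomial vanishing at \<open>0\<close>. The bound on
  the test vectors \<open>(x ^ j)\<close> says that \<open>H - \<bar>g\<bar>\<^sup>2 \<le> \<rho>\<^sup>2\<close> in the disc, where \<open>H\<close> is the harmonic extension
  of \<open>\<bar>g\<bar>\<^sup>2\<close>: this is the Garsia form of the BMO norm. Fefferman's inequality
  \<open>Re \<langle>f, g\<rangle> \<le> 4 \<rho> \<parallel>f\<parallel>\<^sub>1\<close> follows by exhibiting one function, built from \<open>f\<close>, \<open>g\<close> and \<open>H\<close>, which is
  subharmonic and whose sub-mean value property at \<open>0\<close> is the inequality (\<open>H1_BMO_pairing_bound\<close>; there
  \<open>\<bar>f\<bar>\<close> is smoothed to \<open>sqrt (\<bar>f\<bar>\<^sup>2 + 1)\<close>). The dual object, a bounded function whose Fourier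
  coefficients of index \<open>0, \<dots>, 2 * N - 1\<close> agree with those of \<open>g\<close>, is read off from the minimizer
  of a coercive convex functional on polynomials (\<open>bounded_symbol_by_duality\<close>). Fejer means turn it into a trigonometric polynomial, for which
  the change of variables \<open>b\<close> reduces to a computation with monomials.
\<close>

section \<open>Normalized arc length on the circle\<close>

lemma space_circle_measure: "space circle_measure = sphere 0 1"
  by (simp add: circle_measure_def space_restrict_space)

lemma sets_circle_measure: "sets circle_measure = sets (restrict_space borel (sphere 0 1))"
  by (simp add: circle_measure_def)

lemma cis_measurable: "cis \<in> uniform_measure lborel {0..2 * pi} \<rightarrow>\<^sub>M restrict_space borel (sphere 0 1)"
proof (rule measurable_restrict_space2)
  have "cis \<in> borel_measurable borel"
    by (intro borel_measurable_continuous_onI continuous_intros)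
  then show "cis \<in> borel_measurable (uniform_measure lborel {0..2 * pi})"
    by (simp add: uniform_measure_def)
qed auto

lemma prob_space_circle_measure: "prob_space circle_measure"
  unfolding circle_measure_def
  by (intro prob_space.prob_space_distr prob_space_uniform_measure cis_measurable) auto

interpretation circle: prob_space circle_measure
  by (rule prob_space_circle_measure)

lemma borel_measurable_circle_continuous:
  fixes f :: "complex \<Rightarrow> 'a::topological_space"
  assumes "continuous_on (sphere 0 1) f"
  shows "f \<in> borel_measurable circle_measure"
  using borel_measurable_continuous_on_restrict[OF assms]
  by (simp cong: measurable_cong_sets add: sets_circle_measure)

lemma integrable_circle_continuous:
  fixes f :: "complex \<Rightarrow> 'a::{banach, second_countable_topology}"
  assumes "continuous_on (sphere 0 1) f"
  shows "integrable circle_measure f"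
proof -
  have "bounded (f ` sphere 0 1)"
    by (intro compact_imp_bounded compact_continuous_image assms) auto
  then obtain B where "\<And>z. z \<in> sphere 0 1 \<Longrightarrow> norm (f z) \<le> B"
    unfolding bounded_iff by blast
  then show ?thesis
    by (intro circle.integrable_const_bound[where B=B] borel_measurable_circle_continuous assms AE_I2)
      (auto simp: space_circle_measure)
qed

lemma integral_circle_eq_integral_cis:
  fixes f :: "complex \<Rightarrow> 'a::euclidean_space"
  assumes f: "continuous_on (sphere 0 1) f"
  shows "(LINT z|circle_measure. f z) = (1 / (2 * pi)) *\<^sub>R integral {0..2 * pi} (\<lambda>t. f (cis t))"
proof -
  have c: "continuous_on {0..2*pi} (\<lambda>t. f (cis t))"
    by (rule continuous_on_compose2[OF f]) (auto intro!: continuous_intros)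
  have *: "uniform_measure lborel {0..2 * pi} =
      density lborel (\<lambda>t. ennreal (indicator {0..2*pi} t / (2 * pi)))"
    unfolding uniform_measure_def
    by (intro density_cong) (auto simp: indicator_def divide_ennreal ennreal_1[symmetric] simp del: ennreal_1 intro!: AE_I2)
  have m: "f \<in> borel_measurable (restrict_space borel (sphere 0 1))"
    by (rule borel_measurable_continuous_on_restrict[OF f])
  have i: "set_integrable lborel {0..2 * pi} (\<lambda>t. f (cis t))"
    by (rule borel_integrable_atLeastAtMost') (rule c)
  have m2: "(\<lambda>t. f (cis t)) \<in> borel_measurable lborel"
  proof -
    have "continuous_on UNIV (\<lambda>t. f (cis t))"
      by (rule continuous_on_compose2[OF f]) (auto intro!: continuous_intros)
    then show ?thesis by (simp add: borel_measurable_continuous_onI)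
  qed
  have "(LINT z|circle_measure. f z) = (LINT t|uniform_measure lborel {0..2 * pi}. f (cis t))"
    unfolding circle_measure_def by (rule integral_distr[OF cis_measurable m])
  also have "\<dots> = (LINT t|lborel. (indicator {0..2*pi} t / (2 * pi)) *\<^sub>R f (cis t))"
    unfolding * by (rule integral_density) (use m2 in \<open>auto simp: indicator_def\<close>)
  also have "\<dots> = (LINT t|lborel. (1 / (2 * pi)) *\<^sub>R (indicator {0..2*pi} t *\<^sub>R f (cis t)))"
    by (simp add: scaleR_scaleR mult.commute)
  also have "\<dots> = (1 / (2 * pi)) *\<^sub>R (LINT t|lborel. indicator {0..2*pi} t *\<^sub>R f (cis t))"
    by (rule integral_scaleR_right)
  also have "(LINT t|lborel. indicator {0..2*pi} t *\<^sub>R f (cis t)) = integral {0..2 * pi} (\<lambda>t. f (cis t))"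
    using set_borel_integral_eq_integral(2)[OF i] by (simp add: set_lebesgue_integral_def)
  finally show ?thesis .
qed

text \<open>
  On the circle \<open>z / (z - w)\<close> is the conjugate of the Szego kernel \<open>1 / (1 - cnj w * z)\<close>, so this is both
  the Cauchy formula and the reproducing property of that kernel; \<open>w = 0\<close> is the mean value property.
\<close>

lemma integral_circle_Cauchy:
  assumes c: "continuous_on (cball 0 1) F" and h: "F holomorphic_on ball 0 1" and w: "norm w < 1"
  shows "(LINT z|circle_measure. F z * (z / (z - w))) = F w"
proof -
  have c1: "continuous_on (sphere 0 1) (\<lambda>z. F z * (z / (z - w)))"
    by (intro continuous_intros continuous_on_subset[OF c]) (use w in auto)
  have "((\<lambda>u. F u/(u-w)) has_contour_integral (2 * of_real pi * \<i> * F w)) (circlepath 0 1)"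
    by (rule Cauchy_integral_circlepath) (use assms in auto)
  then have 1: "((\<lambda>x. F (cis x) / (cis x - w) * (\<i> * cis x))
      has_integral (2 * of_real pi * \<i> * F w)) {0..2*pi}"
    unfolding circlepath_def
    by (simp add: has_contour_integral_part_circlepath_iff mult_ac)
  from has_integral_mult_right[OF this, of "-\<i>"]
  have "((\<lambda>x. F (cis x) * (cis x / (cis x - w)))
      has_integral (2 * of_real pi * F w)) {0..2*pi}"
    by (simp add: algebra_simps)
  then have "integral {0..2*pi} (\<lambda>x. F (cis x) * (cis x / (cis x - w))) = 2 * of_real pi * F w"
    by (rule integral_unique)
  then show ?thesis
    unfolding integral_circle_eq_integral_cis[OF c1] by (simp add: scaleR_conv_of_real)
qed

lemma integral_circle_mean_value:
  assumes "continuous_on (cball 0 1) F" and "F holomorphic_on ball 0 1"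
  shows "(LINT z|circle_measure. F z) = F 0"
proof -
  have "(LINT z|circle_measure. F z) = (LINT z|circle_measure. F z * (z / (z - 0)))"
    by (intro Bochner_Integration.integral_cong) (auto simp: space_circle_measure)
  then show ?thesis using integral_circle_Cauchy[OF assms, of 0] by simp
qed

lemma cnj_eq_inverse_on_circle: "norm z = 1 \<Longrightarrow> cnj z = inverse z"
  using complex_norm_square[of z] by (intro inverse_unique[symmetric]) simp

lemma cnj_power_int_on_circle: "norm z = 1 \<Longrightarrow> cnj (z powi k) = z powi (- k)"
  by (simp add: power_int_minus cnj_eq_inverse_on_circle power_int_inverse)

lemma power_mult_cnj_power_on_circle:
  assumes "norm z = 1"
  shows "z ^ i * cnj (z ^ j) = z powi (int i - int j)"
proof -
  have "z \<noteq> 0" using assms by auto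
  then show ?thesis
    using assms by (simp add: power_int_diff cnj_eq_inverse_on_circle divide_inverse power_inverse)
qed

lemma integral_circle_power_int:
  "(LINT z|circle_measure. z powi k) = (if k = 0 then 1 else 0)"
proof -
  have nat: "(LINT z|circle_measure. z ^ n) = (if n = 0 then 1 else 0)" for n :: nat
    by (subst integral_circle_mean_value) (auto intro!: continuous_intros holomorphic_intros)
  show ?thesis
  proof (cases "k \<ge> 0")
    case True
    then show ?thesis using nat[of "nat k"] by (auto simp: power_int_def)
  next
    case False
    have "(LINT z|circle_measure. z powi k) = (LINT z|circle_measure. cnj (z ^ nat (-k)))"
      using False by (intro Bochner_Integration.integral_cong)
        (auto simp: space_circle_measure power_int_def cnj_eq_inverse_on_circle)
    also have "\<dots> = cnj (if nat (-k) = 0 then 1 else 0)"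
      by (simp only: Bochner_Integration.integral_cnj nat)
    finally show ?thesis using False by auto
  qed
qed

section \<open>Laplacians in logarithmic coordinates\<close>

text \<open>
  Derivatives along the real line (\<open>d = 1\<close>) and along the imaginary line (\<open>d = \<i>\<close>) are all that a
  Laplacian requires. Continuity of the derivative is part of the notion, so that one may
  differentiate under an integral over a segment.
\<close>

definition has_dir_deriv :: "complex \<Rightarrow> (complex \<Rightarrow> real) \<Rightarrow> (complex \<Rightarrow> real) \<Rightarrow> bool" where
  "has_dir_deriv d w w' \<longleftrightarrow> continuous_on UNIV w' \<and>
     (\<forall>z. ((\<lambda>s::real. w (z + of_real s * d)) has_real_derivative w' z) (at 0))"

text \<open>
  The arguments are a function, its two first partial derivatives and its Laplacian. First derivatives
  are recorded because the rules for products and compositions involve gradients; of the second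
  derivatives only the sum matters.
\<close>

definition has_lap ::
  "(complex \<Rightarrow> real) \<Rightarrow> (complex \<Rightarrow> real) \<Rightarrow> (complex \<Rightarrow> real) \<Rightarrow> (complex \<Rightarrow> real) \<Rightarrow> bool" where
  "has_lap w wx wy L \<longleftrightarrow> continuous_on UNIV w \<and> has_dir_deriv 1 w wx \<and> has_dir_deriv \<i> w wy \<and>
     (\<exists>wxx wyy. has_dir_deriv 1 wx wxx \<and> has_dir_deriv \<i> wy wyy \<and> L = (\<lambda>z. wxx z + wyy z))"

lemma has_dir_deriv_add:
  assumes "has_dir_deriv d w w'" "has_dir_deriv d v v'"
  shows "has_dir_deriv d (\<lambda>z. w z + v z) (\<lambda>z. w' z + v' z)"
  using assms unfolding has_dir_deriv_def by (auto intro!: continuous_intros derivative_eq_intros)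

lemma has_dir_deriv_mult:
  assumes "has_dir_deriv d w w'" "has_dir_deriv d v v'" "continuous_on UNIV w" "continuous_on UNIV v"
  shows "has_dir_deriv d (\<lambda>z. w z * v z) (\<lambda>z. w' z * v z + w z * v' z)"
  using assms unfolding has_dir_deriv_def by (auto intro!: continuous_intros derivative_eq_intros)

lemma has_dir_deriv_compose:
  assumes "has_dir_deriv d w w'" "\<And>z. (f has_real_derivative f' z) (at (w z))" "continuous_on UNIV f'"
  shows "has_dir_deriv d (\<lambda>z. f (w z)) (\<lambda>z. f' z * w' z)"
  unfolding has_dir_deriv_def
proof safe
  show "continuous_on UNIV (\<lambda>z. f' z * w' z)"
    using assms unfolding has_dir_deriv_def by (auto intro!: continuous_intros)
  show "((\<lambda>s. f (w (z + complex_of_real s * d))) has_real_derivative f' z * w' z) (at 0)" for z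
    using assms(1,2) unfolding has_dir_deriv_def
    by (intro DERIV_chain2[where g="\<lambda>s. w (z + complex_of_real s * d)"]) auto
qed

lemma has_lap_add:
  assumes "has_lap w wx wy L" "has_lap v vx vy K"
  shows "has_lap (\<lambda>z. w z + v z) (\<lambda>z. wx z + vx z) (\<lambda>z. wy z + vy z) (\<lambda>z. L z + K z)"
proof -
  obtain wxx wyy where w: "has_dir_deriv 1 wx wxx" "has_dir_deriv \<i> wy wyy" "L = (\<lambda>z. wxx z + wyy z)"
    using assms(1) unfolding has_lap_def by blast
  obtain vxx vyy where v: "has_dir_deriv 1 vx vxx" "has_dir_deriv \<i> vy vyy" "K = (\<lambda>z. vxx z + vyy z)"
    using assms(2) unfolding has_lap_def by blast
  show ?thesis
    using assms w v unfolding has_lap_def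
    by (intro conjI exI[of _ "\<lambda>z. wxx z + vxx z"] exI[of _ "\<lambda>z. wyy z + vyy z"])
      (auto intro!: has_dir_deriv_add continuous_intros)
qed

lemma has_lap_mult:
  assumes "has_lap w wx wy L" "has_lap v vx vy K"
  shows "has_lap (\<lambda>z. w z * v z) (\<lambda>z. wx z * v z + w z * vx z) (\<lambda>z. wy z * v z + w z * vy z)
    (\<lambda>z. L z * v z + 2 * (wx z * vx z + wy z * vy z) + w z * K z)"
proof -
  obtain wxx wyy where w: "has_dir_deriv 1 wx wxx" "has_dir_deriv \<i> wy wyy" "L = (\<lambda>z. wxx z + wyy z)"
    using assms(1) unfolding has_lap_def by blast
  obtain vxx vyy where v: "has_dir_deriv 1 vx vxx" "has_dir_deriv \<i> vy vyy" "K = (\<lambda>z. vxx z + vyy z)"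
    using assms(2) unfolding has_lap_def by blast
  have c: "continuous_on UNIV w" "continuous_on UNIV v" "continuous_on UNIV wx" "continuous_on UNIV wy"
    "continuous_on UNIV vx" "continuous_on UNIV vy"
    using assms unfolding has_lap_def has_dir_deriv_def by auto
  show ?thesis
    unfolding has_lap_def
    by (intro conjI exI[of _ "\<lambda>z. (wxx z * v z + wx z * vx z) + (wx z * vx z + w z * vxx z)"]
        exI[of _ "\<lambda>z. (wyy z * v z + wy z * vy z) + (wy z * vy z + w z * vyy z)"]
        has_dir_deriv_add has_dir_deriv_mult)
      (use assms w v c in \<open>auto intro!: continuous_intros simp: algebra_simps has_lap_def\<close>)
qed

lemma has_lap_compose:
  assumes "has_lap w wx wy L"
    and f: "\<And>z. (f has_real_derivative f' (w z)) (at (w z))"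
    and f': "\<And>z. (f' has_real_derivative f'' (w z)) (at (w z))"
    and c2: "continuous_on UNIV (\<lambda>z. f'' (w z))"
  shows "has_lap (\<lambda>z. f (w z)) (\<lambda>z. f' (w z) * wx z) (\<lambda>z. f' (w z) * wy z)
    (\<lambda>z. f'' (w z) * ((wx z)\<^sup>2 + (wy z)\<^sup>2) + f' (w z) * L z)"
proof -
  obtain wxx wyy where w: "has_dir_deriv 1 wx wxx" "has_dir_deriv \<i> wy wyy" "L = (\<lambda>z. wxx z + wyy z)"
    using assms(1) unfolding has_lap_def by blast
  have w1: "has_dir_deriv 1 w wx" "has_dir_deriv \<i> w wy" and c: "continuous_on UNIV w"
    "continuous_on UNIV wx" "continuous_on UNIV wy"
    using assms(1) unfolding has_lap_def has_dir_deriv_def by auto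
  have comp: "continuous_on UNIV (\<lambda>z. g (w z))" if "\<And>z. (g has_real_derivative g' z) (at (w z))" for g g'
    unfolding continuous_on_eq_continuous_at[OF open_UNIV]
  proof
    fix z :: complex
    show "isCont (\<lambda>z. g (w z)) z"
      by (rule continuous_at_compose[where f=w and g=g, unfolded o_def])
        (use c that[of z] in \<open>auto simp: continuous_on_eq_continuous_at DERIV_isCont\<close>)
  qed
  note cf = comp[OF f] and cf' = comp[OF f']
  show ?thesis
    unfolding has_lap_def
    by (intro conjI exI[of _ "\<lambda>z. (f'' (w z) * wx z) * wx z + f' (w z) * wxx z"]
        exI[of _ "\<lambda>z. (f'' (w z) * wy z) * wy z + f' (w z) * wyy z"] has_dir_deriv_mult
         has_dir_deriv_compose[OF w1(1) f cf'] has_dir_deriv_compose[OF w1(2) f cf']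
         has_dir_deriv_compose[OF w1(1) f' c2] has_dir_deriv_compose[OF w1(2) f' c2])
      (use w c cf cf' in \<open>auto simp: algebra_simps power2_eq_square\<close>)
qed

text \<open>Composition with \<open>exp\<close> turns the derivative into the operator \<open>z d/dz\<close> on polynomials.\<close>

definition euler :: "complex poly \<Rightarrow> complex poly" where
  "euler p = pCons 0 (pderiv p)"

lemma has_dir_deriv_poly_exp:
  "has_dir_deriv d (\<lambda>z. Re (c * poly p (exp z))) (\<lambda>z. Re (c * d * poly (euler p) (exp z)))"
  unfolding has_dir_deriv_def
proof safe
  fix z
  have "((\<lambda>s. c * poly p (exp (z + s * d))) has_field_derivative (c * d * poly (euler p) (exp z)))
      (at (of_real 0))"
    by (auto intro!: derivative_eq_intros simp: euler_def)
  from has_vector_derivative_real_field[OF this]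
  show "((\<lambda>s. Re (c * poly p (exp (z + complex_of_real s * d)))) has_real_derivative
       Re (c * d * poly (euler p) (exp z))) (at 0)"
    by (rule has_field_derivative_Re)
qed (intro continuous_intros)

text \<open>
  Real and imaginary parts of \<open>poly p \<circ> exp\<close> are harmonic. The test function of the pairing inequality is built
  from them, and its Laplacian comes from the rules for sums, products and compositions.
\<close>

lemma has_lap_Re_poly_exp:
  "has_lap (\<lambda>z. Re (poly p (exp z))) (\<lambda>z. Re (poly (euler p) (exp z))) (\<lambda>z. - Im (poly (euler p) (exp z)))
     (\<lambda>_. 0)"
  unfolding has_lap_def
  using has_dir_deriv_poly_exp[of 1 1 p] has_dir_deriv_poly_exp[of \<i> 1 p]
    has_dir_deriv_poly_exp[of 1 1 "euler p"] has_dir_deriv_poly_exp[of \<i> \<i> "euler p"]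
  by (intro conjI exI[of _ "\<lambda>z. Re (poly (euler (euler p)) (exp z))"]
        exI[of _ "\<lambda>z. - Re (poly (euler (euler p)) (exp z))"]) (auto intro!: continuous_intros)

lemma has_lap_Im_poly_exp:
  "has_lap (\<lambda>z. Im (poly p (exp z))) (\<lambda>z. Im (poly (euler p) (exp z))) (\<lambda>z. Re (poly (euler p) (exp z)))
     (\<lambda>_. 0)"
  unfolding has_lap_def
  using has_dir_deriv_poly_exp[of 1 "-\<i>" p] has_dir_deriv_poly_exp[of \<i> "-\<i>" p]
    has_dir_deriv_poly_exp[of 1 "-\<i>" "euler p"] has_dir_deriv_poly_exp[of \<i> 1 "euler p"]
  by (intro conjI exI[of _ "\<lambda>z. Im (poly (euler (euler p)) (exp z))"]
        exI[of _ "\<lambda>z. - Im (poly (euler (euler p)) (exp z))"]) (auto intro!: continuous_intros)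

lemma has_lap_const: "has_lap (\<lambda>_. c) (\<lambda>_. 0) (\<lambda>_. 0) (\<lambda>_. 0)"
  unfolding has_lap_def has_dir_deriv_def by (auto intro!: exI[of _ "\<lambda>_. 0"])

lemma has_lap_cong:
  assumes "has_lap w wx wy L" "\<And>z. w z = w' z" "\<And>z. wx z = wx' z" "\<And>z. wy z = wy' z" "\<And>z. L z = L' z"
  shows "has_lap w' wx' wy' L'"
proof -
  have "w = w'" "wx = wx'" "wy = wy'" "L = L'" using assms by auto
  then show ?thesis using assms(1) by simp
qed

lemma has_lap_cmult: "has_lap w wx wy L \<Longrightarrow>
    has_lap (\<lambda>z. c * w z) (\<lambda>z. c * wx z) (\<lambda>z. c * wy z) (\<lambda>z. c * L z)"
  by (rule has_lap_cong[OF has_lap_mult[OF has_lap_const[of c]]]) auto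

text \<open>
  In the coordinate \<open>exp (s + \<i> * t)\<close> the circle of radius \<open>exp s\<close> is a vertical segment, traversed
  periodically. Let \<open>M s\<close> be the integral of \<open>W\<close> over it with respect to \<open>t\<close>. By periodicity the
  second derivative in \<open>t\<close> integrates to \<open>0\<close>, so \<open>M''\<close> is the integral of the Laplacian and \<open>M\<close> is
  convex for \<open>s \<le> 0\<close>. It is also bounded there, since \<open>W\<close> is bounded on the disc, and a bounded convex
  function on \<open>s \<le> 0\<close> is increasing. As \<open>s\<close> tends to minus infinity the circles shrink to \<open>0\<close>, which
  compares \<open>M 0\<close> with \<open>2 * pi * W 0\<close>.
\<close>

lemma sub_mean_value_exp:
  assumes lap: "has_lap (\<lambda>z. W (exp z)) wx wy L" and pos: "\<And>z. Re z \<le> 0 \<Longrightarrow> L z \<ge> 0"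
    and cont: "continuous_on UNIV W"
  shows "2 * pi * W 0 \<le> integral {0..2*pi} (\<lambda>t. W (cis t))"
proof -
  let ?w = "\<lambda>z. W (exp z)"
  obtain wxx wyy where w: "has_dir_deriv 1 wx wxx" "has_dir_deriv \<i> wy wyy" "L = (\<lambda>z. wxx z + wyy z)"
    using lap unfolding has_lap_def by blast
  have w1: "has_dir_deriv 1 ?w wx" "has_dir_deriv \<i> ?w wy" and cw: "continuous_on UNIV ?w"
    using lap unfolding has_lap_def by auto
  have c: "continuous_on UNIV wx" "continuous_on UNIV wy" "continuous_on UNIV wxx" "continuous_on UNIV wyy"
    using w w1 unfolding has_dir_deriv_def by auto
  have x: "((\<lambda>x. v (Complex x t)) has_real_derivative v' (Complex s t)) (at s)"
    if "has_dir_deriv 1 v v'" for v v' s t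
  proof -
    have "((\<lambda>r. v (Complex s t + of_real r * 1)) has_real_derivative v' (Complex s t)) (at (s - s))"
      using that unfolding has_dir_deriv_def by auto
    then have "((\<lambda>x. v (Complex s t + of_real (x - s) * 1)) has_real_derivative v' (Complex s t) * 1) (at s)"
      by (rule DERIV_chain2) (auto intro!: derivative_eq_intros)
    moreover have "Complex s t + of_real (x - s) * 1 = Complex x t" for x
      by (simp add: complex_eq_iff)
    ultimately show ?thesis by simp
  qed
  have y: "((\<lambda>y. v (Complex s y)) has_real_derivative v' (Complex s t)) (at t)"
    if "has_dir_deriv \<i> v v'" for v v' s t
  proof -
    have "((\<lambda>r. v (Complex s t + of_real r * \<i>)) has_real_derivative v' (Complex s t)) (at (t - t))"
      using that unfolding has_dir_deriv_def by auto
    then have "((\<lambda>x. v (Complex s t + of_real (x - t) * \<i>)) has_real_derivative v' (Complex s t) * 1) (at t)"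
      by (rule DERIV_chain2) (auto intro!: derivative_eq_intros)
    moreover have "Complex s t + of_real (x - t) * \<i> = Complex s x" for x
      by (simp add: complex_eq_iff)
    ultimately show ?thesis by simp
  qed
  have cc: "continuous_on X (\<lambda>t. v (Complex s t))" if "continuous_on UNIV v" for v :: "complex \<Rightarrow> real" and s X
    by (rule continuous_on_compose2[OF that]) (auto intro!: continuous_intros simp: Complex_eq)
  have cc2: "continuous_on X (\<lambda>(s, t). v (Complex s t))" if "continuous_on UNIV v" for v :: "complex \<Rightarrow> real" and X
    unfolding split_beta
    by (rule continuous_on_compose2[OF that]) (auto intro!: continuous_intros simp: Complex_eq)
  define M where "M s = integral (cbox 0 (2*pi)) (\<lambda>t. ?w (Complex s t))" for s
  define M1 where "M1 s = integral (cbox 0 (2*pi)) (\<lambda>t. wx (Complex s t))" for s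
  have M: "(M has_real_derivative M1 s) (at s)" for s
    unfolding M_def[abs_def] M1_def
    using leibniz_rule_field_derivative[where U=UNIV and f="\<lambda>s t. ?w (Complex s t)" and a=0 and b="2*pi"
        and ?fx="\<lambda>s t. wx (Complex s t)" and ?x0.0=s, OF x[OF w1(1)]]
    by (simp add: cc2 c integrable_continuous_real[OF cc[OF cw]])
  have M1: "(M1 has_real_derivative integral (cbox 0 (2*pi)) (\<lambda>t. wxx (Complex s t))) (at s)" for s
    unfolding M1_def[abs_def]
    using leibniz_rule_field_derivative[where U=UNIV and f="\<lambda>s t. wx (Complex s t)" and a=0 and b="2*pi"
        and ?fx="\<lambda>s t. wxx (Complex s t)" and ?x0.0=s, OF x[OF w(1)]]
    by (simp add: cc cc2 c cw integrable_continuous_real)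
  have per: "wy (Complex s (2*pi)) = wy (Complex s 0)" for s
  proof -
    have e: "exp (Complex s (2*pi) + of_real r * \<i>) = exp (Complex s 0 + of_real r * \<i>)" for r
    proof -
      have "Complex s (2*pi) + of_real r * \<i> = (Complex s 0 + of_real r * \<i>) + of_real (2*pi) * \<i>"
        by (simp add: complex_eq_iff)
      then show ?thesis by (simp add: exp_add exp_two_pi_i)
    qed
    have "((\<lambda>r. ?w (Complex s (2*pi) + of_real r * \<i>)) has_real_derivative wy (Complex s (2*pi))) (at 0)"
      "((\<lambda>r. ?w (Complex s 0 + of_real r * \<i>)) has_real_derivative wy (Complex s 0)) (at 0)"
      using w1 unfolding has_dir_deriv_def by blast+
    then show ?thesis unfolding e by (rule DERIV_unique)
  qed
  \<comment> \<open>By periodicity the \<open>t\<close>-derivatives contribute nothing.\<close>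
  have yy: "integral (cbox 0 (2*pi)) (\<lambda>t. wyy (Complex s t)) = 0" for s
  proof -
    have "((\<lambda>t. wyy (Complex s t)) has_integral wy (Complex s (2*pi)) - wy (Complex s 0)) {0..2*pi}"
      by (rule fundamental_theorem_of_calculus)
        (use y[OF w(2)] in \<open>auto simp: has_real_derivative_iff_has_vector_derivative[symmetric]
            intro: DERIV_subset\<close>)
    then show ?thesis by (simp add: per integral_unique)
  qed
  have xx: "integral (cbox 0 (2*pi)) (\<lambda>t. wxx (Complex s t)) \<ge> 0" if "s \<le> 0" for s
  proof -
    have "0 \<le> integral (cbox 0 (2*pi)) (\<lambda>t. wxx (Complex s t) + wyy (Complex s t))"
      using pos that w(3) by (intro integral_nonneg integrable_continuous_real continuous_intros cc c) 
         (auto simp: fun_eq_iff intro!: integrable_continuous_real continuous_intros cc c)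
    also have "\<dots> = integral (cbox 0 (2*pi)) (\<lambda>t. wxx (Complex s t)) + integral (cbox 0 (2*pi)) (\<lambda>t. wyy (Complex s t))"
      by (intro Henstock_Kurzweil_Integration.integral_add) (auto intro!: integrable_continuous_real cc c)
    finally show ?thesis using yy[of s] by simp
  qed
  have M1_mono: "M1 s \<le> M1 s'" if "s \<le> s'" "s' \<le> 0" for s s'
    by (rule DERIV_nonneg_imp_nondecreasing[OF that(1)]) (use M1 xx that in \<open>meson order_trans\<close>)
  have "bounded (W ` cball 0 1)"
    by (intro compact_imp_bounded compact_continuous_image continuous_on_subset[OF cont]) auto
  then obtain B where "\<And>z. norm z \<le> 1 \<Longrightarrow> \<bar>W z\<bar> \<le> B"
    unfolding bounded_iff by (metis imageI mem_cball_0 real_norm_def)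
  then have B: "W z \<le> B" if "norm z \<le> 1" for z using that by (smt (verit))
  have M_le: "M s \<le> 2 * pi * B" if "s \<le> 0" for s
  proof -
    have "M s \<le> integral (cbox 0 (2*pi)) (\<lambda>t. B)"
      unfolding M_def using B that
      by (intro integral_le) (auto intro!: integrable_continuous_real cc cw)
    then show ?thesis by simp
  qed
  have M1_nonneg: "M1 s0 \<ge> 0" if "s0 \<le> 0" for s0
  proof (rule ccontr)
    assume neg: "\<not> M1 s0 \<ge> 0"
    \<comment> \<open>A negative slope at \<open>s0\<close> would force linear growth of \<open>M\<close> at minus infinity.\<close>
    define d where "d = - M1 s0"
    have d: "d > 0" using neg by (simp add: d_def)
    have "M s0 + d * (s0 - s) \<le> M s" if "s \<le> s0" for s
    proof -
      have "M s0 + d * s0 \<le> M s + d * s"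
      proof (rule DERIV_nonpos_imp_nonincreasing[OF that])
        fix x assume "s \<le> x" "x \<le> s0"
        have "((\<lambda>s. M s + d * s) has_real_derivative M1 x + d) (at x)"
          by (auto intro!: derivative_eq_intros M)
        moreover have "M1 x + d \<le> 0" using M1_mono[OF \<open>x \<le> s0\<close> \<open>s0 \<le> 0\<close>] by (simp add: d_def)
        ultimately show "\<exists>y. ((\<lambda>s. M s + d * s) has_real_derivative y) (at x) \<and> y \<le> 0" by blast
      qed
      then show ?thesis by (simp add: algebra_simps)
    qed
    note lower = this
    define s where "s = s0 - (\<bar>2 * pi * B - M s0\<bar> + 1) / d"
    have "d * (s0 - s) = \<bar>2 * pi * B - M s0\<bar> + 1" using d by (simp add: s_def)
    moreover have "s \<le> s0" using d by (simp add: s_def)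
    moreover have "M s \<le> 2 * pi * B" using \<open>s \<le> s0\<close> \<open>s0 \<le> 0\<close> by (intro M_le) simp
    ultimately show False using lower[of s] by linarith
  qed
  have M_mono: "M s \<le> M 0" if "s \<le> 0" for s
    by (rule DERIV_nonneg_imp_nondecreasing[OF that]) (use M M1_nonneg in blast)
  have "2 * pi * W 0 \<le> M 0 + e" if "e > 0" for e
  proof -
    have "isCont W 0" using cont by (simp add: continuous_on_eq_continuous_at)
    moreover have "e / (2 * pi) > 0" using that by simp
    ultimately obtain \<delta> where "\<delta> > 0" "\<forall>z. dist z 0 < \<delta> \<longrightarrow> dist (W z) (W 0) < e / (2 * pi)"
      unfolding continuous_at_eps_delta by blast
    then have \<delta>: "\<delta> > 0" "\<And>z. norm z < \<delta> \<Longrightarrow> \<bar>W z - W 0\<bar> < e / (2 * pi)"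
      by (simp_all add: dist_norm)
    define s where "s = min 0 (ln (\<delta> / 2))"
    have "exp s \<le> \<delta> / 2" using \<delta>(1) by (metis exp_le_cancel_iff exp_ln half_gt_zero min.cobounded2 s_def)
    then have es: "exp s < \<delta>" using \<delta>(1) by linarith
    have "2 * pi * (W 0 - e / (2 * pi)) = integral (cbox 0 (2*pi)) (\<lambda>t. W 0 - e / (2 * pi))" by simp
    also have "\<dots> \<le> M s"
      unfolding M_def
    proof (intro integral_le)
      fix t
      have "norm (exp (Complex s t)) < \<delta>" using es by simp
      from \<delta>(2)[OF this] show "W 0 - e / (2 * pi) \<le> ?w (Complex s t)" by linarith
    qed (auto intro!: integrable_continuous_real cc cw)
    also have "\<dots> \<le> M 0" by (rule M_mono) (simp add: s_def)
    finally show ?thesis by (simp add: right_diff_distrib)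
  qed
  then have "2 * pi * W 0 \<le> M 0" by (rule field_le_epsilon)
  also have "M 0 = integral {0..2*pi} (\<lambda>t. W (cis t))"
    unfolding M_def by (simp add: exp_eq_polar)
  finally show ?thesis .
qed

section \<open>The pairing of polynomials with functions of bounded mean oscillation\<close>

lemma has_lap_norm_poly_exp:
  "has_lap (\<lambda>z. (norm (poly p (exp z)))\<^sup>2)
     (\<lambda>z. 2 * Re (cnj (poly p (exp z)) * poly (euler p) (exp z)))
     (\<lambda>z. - 2 * Im (cnj (poly p (exp z)) * poly (euler p) (exp z)))
     (\<lambda>z. 4 * (norm (poly (euler p) (exp z)))\<^sup>2)"
  by (rule has_lap_cong[OF has_lap_add[OF has_lap_mult[OF has_lap_Re_poly_exp[of p] has_lap_Re_poly_exp[of p]]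
     has_lap_mult[OF has_lap_Im_poly_exp[of p] has_lap_Im_poly_exp[of p]]]])
    (auto simp: cmod_power2 algebra_simps simp flip: power2_eq_square)

lemma has_lap_Re_mult_cnj_poly_exp:
  "has_lap (\<lambda>z. Re (poly p (exp z) * cnj (poly q (exp z))))
     (\<lambda>z. Re (poly (euler p) (exp z) * cnj (poly q (exp z)) + poly p (exp z) * cnj (poly (euler q) (exp z))))
     (\<lambda>z. - Im (poly (euler p) (exp z) * cnj (poly q (exp z)) - poly p (exp z) * cnj (poly (euler q) (exp z))))
     (\<lambda>z. 4 * Re (poly (euler p) (exp z) * cnj (poly (euler q) (exp z))))"
  by (rule has_lap_cong[OF has_lap_add[OF has_lap_mult[OF has_lap_Re_poly_exp[of p] has_lap_Re_poly_exp[of q]]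
     has_lap_mult[OF has_lap_Im_poly_exp[of p] has_lap_Im_poly_exp[of q]]]])
    (auto simp: algebra_simps)

lemma has_lap_sqrt:
  assumes u: "has_lap u ux uy Lu" and pos: "\<And>z. u z > 0"
  shows "has_lap (\<lambda>z. sqrt (u z)) (\<lambda>z. ux z / (2 * sqrt (u z))) (\<lambda>z. uy z / (2 * sqrt (u z)))
    (\<lambda>z. (Lu z / 2 - ((ux z / (2 * sqrt (u z)))\<^sup>2 + (uy z / (2 * sqrt (u z)))\<^sup>2)) / sqrt (u z))"
proof -
  have c: "continuous_on UNIV u" using u by (simp add: has_lap_def)
  have nz: "u z \<noteq> 0" for z using pos[of z] by simp
  have "has_lap (\<lambda>z. sqrt (u z)) (\<lambda>z. (1 / (2 * sqrt (u z))) * ux z) (\<lambda>z. (1 / (2 * sqrt (u z))) * uy z)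
    (\<lambda>z. (- 1 / (4 * sqrt (u z) * (sqrt (u z))\<^sup>2)) * ((ux z)\<^sup>2 + (uy z)\<^sup>2) + (1 / (2 * sqrt (u z))) * Lu z)"
  proof (rule has_lap_compose[OF u, where f=sqrt and f'="\<lambda>x. 1 / (2 * sqrt x)" and f''="\<lambda>x. - 1 / (4 * sqrt x * (sqrt x)\<^sup>2)"])
    show "(sqrt has_real_derivative 1 / (2 * sqrt (u z))) (at (u z))" for z
      using pos[of z] by (auto intro!: derivative_eq_intros simp: field_simps)
    show "((\<lambda>x. 1 / (2 * sqrt x)) has_real_derivative - 1 / (4 * sqrt (u z) * (sqrt (u z))\<^sup>2)) (at (u z))" for z
      using pos[of z] by (auto intro!: derivative_eq_intros simp: field_simps power2_eq_square)
    show "continuous_on UNIV (\<lambda>z. - 1 / (4 * sqrt (u z) * (sqrt (u z))\<^sup>2))"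
      by (intro continuous_intros c) (use nz in auto)
  qed
  then show ?thesis
  proof (rule has_lap_cong)
    fix z
    have "- 1 / (4 * s * s\<^sup>2) * (a\<^sup>2 + b\<^sup>2) + 1 / (2 * s) * l
       = (l / 2 - ((a / (2 * s))\<^sup>2 + (b / (2 * s))\<^sup>2)) / s" if "s > 0" for s a b l :: real
      using that by (simp add: field_simps power2_eq_square)
    from this[of "sqrt (u z)"] pos
    show "(- 1 / (4 * sqrt (u z) * (sqrt (u z))\<^sup>2)) * ((ux z)\<^sup>2 + (uy z)\<^sup>2) + (1 / (2 * sqrt (u z))) * Lu z
       = (Lu z / 2 - ((ux z / (2 * sqrt (u z)))\<^sup>2 + (uy z / (2 * sqrt (u z)))\<^sup>2)) / sqrt (u z)"
      by simp
  qed auto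
qed

lemma has_lap_sqrt_norm_poly_exp:
  fixes p :: "complex poly"
  defines "S \<equiv> \<lambda>z. sqrt ((norm (poly p (exp z)))\<^sup>2 + 1)" and "D \<equiv> \<lambda>z. cnj (poly p (exp z)) * poly (euler p) (exp z)"
  shows "has_lap S (\<lambda>z. Re (D z) / S z) (\<lambda>z. - Im (D z) / S z)
     (\<lambda>z. (2 * (norm (poly (euler p) (exp z)))\<^sup>2 - ((Re (D z) / S z)\<^sup>2 + (- Im (D z) / S z)\<^sup>2)) / S z)"
proof -
  have pos: "(norm (poly p (exp z)))\<^sup>2 + 1 > 0" for z by (simp add: add_nonneg_pos)
  note * = has_lap_sqrt[OF has_lap_add[OF has_lap_norm_poly_exp[of p] has_lap_const[of 1]] pos, folded S_def D_def]
  have div: "(2 * a + 0) / (2 * b) = a / b" "(- 2 * a + 0) / (2 * b) = - a / b" for a b :: real by simp_all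
  show ?thesis
    by (rule has_lap_cong[OF *[unfolded div]]) (auto simp: S_def D_def)
qed

lemma has_lap_exp:
  assumes v: "has_lap v vx vy Lv"
  shows "has_lap (\<lambda>z. exp (v z)) (\<lambda>z. exp (v z) * vx z) (\<lambda>z. exp (v z) * vy z)
    (\<lambda>z. exp (v z) * ((vx z)\<^sup>2 + (vy z)\<^sup>2) + exp (v z) * Lv z)"
proof (rule has_lap_compose[OF v])
  show "continuous_on UNIV (\<lambda>z. exp (v z))"
    using v by (auto simp: has_lap_def intro!: continuous_intros)
qed auto

text \<open>
  The pointwise inequality behind the test function of \<open>H1_BMO_pairing_bound\<close>. There \<open>S\<close> stands for
  \<open>sqrt (\<bar>f\<bar>\<^sup>2 + 1)\<close> with gradient \<open>(Sx, Sy)\<close> and Laplacian \<open>LS\<close>, \<open>A\<close> and \<open>B\<close> for the absolute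
  values of the derivatives of \<open>f\<close> and \<open>g\<close>, \<open>(px, py)\<close> for the gradient of the exponent and \<open>E\<close> for
  its exponential. Completing a square removes the gradient of the exponent; what is left is
  \<open>\<rho> A\<^sup>2 / S + 4 S B\<^sup>2 / \<rho> - 4 A B\<close>, a square up to a positive factor. The factor \<open>3\<close> compensates
  \<open>E \<ge> exp (-1) \<ge> 1/3\<close>.
\<close>

lemma test_function_laplacian_nonneg:
  fixes S Sx Sy LS px py E A B \<rho> X :: real
  assumes S: "S > 0" and \<rho>: "\<rho> > 0" and E: "3 * E \<ge> 1"
    and LS: "S * LS = 2 * A\<^sup>2 - (Sx\<^sup>2 + Sy\<^sup>2)" and grad: "Sx\<^sup>2 + Sy\<^sup>2 \<le> A\<^sup>2" and X: "X \<le> A * B"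
  shows "0 \<le> \<rho> * LS + 3 * \<rho> * (LS * E + 2 * (Sx * (E * px) + Sy * (E * py)) +
      S * (E * (px\<^sup>2 + py\<^sup>2) + E * (4 * B\<^sup>2 / \<rho>\<^sup>2))) - 4 * X"
proof -
  have 1: "A\<^sup>2 / S \<le> LS" using LS grad S by (simp add: field_simps)
  have "0 \<le> (Sx + S * px)\<^sup>2 + (Sy + S * py)\<^sup>2" by simp
  also have "\<dots> \<le> S * (LS + 2 * (Sx * px + Sy * py) + S * (px\<^sup>2 + py\<^sup>2))"
    using LS grad by (simp add: power2_eq_square algebra_simps)
  finally have 2: "0 \<le> LS + 2 * (Sx * px + Sy * py) + S * (px\<^sup>2 + py\<^sup>2)"
    using S by (simp add: zero_le_mult_iff)
  have "0 \<le> (\<rho> * A - 2 * S * B)\<^sup>2 / (\<rho> * S)" using S \<rho> by simp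
  also have "\<dots> = \<rho> * (A\<^sup>2 / S) + 1 * (4 * S * B\<^sup>2 / \<rho>) - 4 * (A * B)"
    using S \<rho> by (simp add: field_simps power2_eq_square)
  also have "\<dots> \<le> \<rho> * LS + (3 * E) * (4 * S * B\<^sup>2 / \<rho>) - 4 * X"
    by (intro add_mono diff_mono mult_left_mono mult_right_mono) (use 1 X S \<rho> E in auto)
  also have "\<dots> \<le> \<rho> * LS + (3 * E) * (4 * S * B\<^sup>2 / \<rho>) - 4 * X
     + 3 * \<rho> * E * (LS + 2 * (Sx * px + Sy * py) + S * (px\<^sup>2 + py\<^sup>2))"
    using 2 \<rho> E by simp
  also have "\<dots> = \<rho> * LS + 3 * \<rho> * (LS * E + 2 * (Sx * (E * px) + Sy * (E * py)) +
      S * (E * (px\<^sup>2 + py\<^sup>2) + E * (4 * B\<^sup>2 / \<rho>\<^sup>2))) - 4 * X"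
    using \<rho> by (simp add: field_simps power2_eq_square)
  finally show ?thesis .
qed

lemma exp_minus_one_ge_third: "3 * exp (x::real) \<ge> 1" if "x \<ge> -1"
proof -
  have "exp (1::real) \<le> 3" using e_less_272 by simp
  then have "1 \<le> 3 * exp (-1::real)" by (simp add: exp_minus field_simps)
  also have "\<dots> \<le> 3 * exp x" using that by simp
  finally show ?thesis .
qed

text \<open>
  With \<open>S = sqrt (\<bar>f\<bar>\<^sup>2 + 1)\<close> and \<open>\<phi> = (\<bar>g\<bar>\<^sup>2 - Re q) / \<rho>\<^sup>2\<close> consider
  \<open>W = \<rho> S + 3 \<rho> S exp \<phi> - Re (f cnj g)\<close>. The real part of \<open>q\<close> is the harmonic extension of \<open>\<bar>g\<bar>\<^sup>2\<close>
  from the circle, so \<open>\<phi>\<close> vanishes on the circle, is at least \<open>-1\<close> in the disc, and has Laplacian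
  \<open>4 \<bar>g'\<bar>\<^sup>2 / \<rho>\<^sup>2\<close>. Therefore the Laplacian of \<open>S\<close> controls \<open>\<bar>f'\<bar>\<^sup>2\<close>, that of \<open>S exp \<phi>\<close> controls
  \<open>S \<bar>g'\<bar>\<^sup>2\<close>, and together they dominate the Laplacian of \<open>Re (f cnj g)\<close>, which is at most
  \<open>4 \<bar>f'\<bar> \<bar>g'\<bar>\<close>. Hence \<open>W\<close> is subharmonic. Since \<open>W 0 \<ge> 0\<close>, and since on the circle
  \<open>W = 4 \<rho> S - Re (f cnj g)\<close>, the sub-mean value property at \<open>0\<close> is the claim. Adding \<open>1\<close> to \<open>\<bar>f\<bar>\<^sup>2\<close>
  keeps \<open>S\<close> smooth at the zeros of \<open>f\<close>.
\<close>

lemma H1_BMO_pairing_bound: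
  assumes \<rho>: "\<rho> > 0" and g0: "poly g 0 = 0"
    and bmo: "\<And>z. norm z \<le> 1 \<Longrightarrow> Re (poly q z) - (norm (poly g z))\<^sup>2 \<le> \<rho>\<^sup>2"
    and bd: "\<And>z. norm z = 1 \<Longrightarrow> Re (poly q z) = (norm (poly g z))\<^sup>2"
  shows "Re (LINT z|circle_measure. poly f z * cnj (poly g z)) \<le>
     4 * \<rho> * (LINT z|circle_measure. sqrt ((norm (poly f z))\<^sup>2 + 1))"
proof -
  define S where "S z = sqrt ((norm (poly f z))\<^sup>2 + 1)" for z
  define \<phi> where "\<phi> z = (1 / \<rho>\<^sup>2) * ((norm (poly g z))\<^sup>2 + (-1) * Re (poly q z))" for z
  define W where "W z = \<rho> * S z + (3 * \<rho>) * (S z * exp (\<phi> z)) + (-1) * Re (poly f z * cnj (poly g z))" for z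
  have pos: "(norm (poly f z))\<^sup>2 + 1 > 0" for z by (simp add: add_nonneg_pos)
  define D where "D z = cnj (poly f z) * poly (euler f) z" for z
  define A where "A z = norm (poly (euler f) z)" for z
  define B where "B z = norm (poly (euler g) z)" for z
  have lS: "has_lap (\<lambda>z. S (exp z)) (\<lambda>z. Re (D (exp z)) / S (exp z)) (\<lambda>z. - Im (D (exp z)) / S (exp z))
     (\<lambda>z. (2 * (A (exp z))\<^sup>2 - ((Re (D (exp z)) / S (exp z))\<^sup>2 + (- Im (D (exp z)) / S (exp z))\<^sup>2)) / S (exp z))"
    unfolding S_def D_def A_def by (rule has_lap_sqrt_norm_poly_exp)
  obtain px py where l\<phi>: "has_lap (\<lambda>z. \<phi> (exp z)) px py (\<lambda>z. 4 * (B (exp z))\<^sup>2 / \<rho>\<^sup>2)"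
    using has_lap_cong[OF has_lap_cmult[OF has_lap_add[OF has_lap_norm_poly_exp[of g]
        has_lap_cmult[OF has_lap_Re_poly_exp[of q], of "-1"]], of "1 / \<rho>\<^sup>2"] _ refl refl,
        of "\<lambda>z. \<phi> (exp z)" "\<lambda>z. 4 * (B (exp z))\<^sup>2 / \<rho>\<^sup>2"]
    by (simp add: \<phi>_def B_def)
  note lW = has_lap_add[OF has_lap_add[OF has_lap_cmult[OF lS, of \<rho>] has_lap_cmult[OF has_lap_mult[OF lS has_lap_exp[OF l\<phi>]], of "3 * \<rho>"]]
     has_lap_cmult[OF has_lap_Re_mult_cnj_poly_exp[of f g], of "-1"], folded W_def]
  have cS: "continuous_on X S" for X unfolding S_def[abs_def] by (intro continuous_intros)
  have c\<phi>: "continuous_on X \<phi>" for X unfolding \<phi>_def[abs_def] by (intro continuous_intros)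
  have cW: "continuous_on X W" for X unfolding W_def[abs_def] by (intro continuous_intros cS c\<phi>)
  have "2 * pi * W 0 \<le> integral {0..2*pi} (\<lambda>t. W (cis t))"
  proof (rule sub_mean_value_exp[OF lW _ cW])
    fix z :: complex assume "Re z \<le> 0"
    then have z: "norm (exp z) \<le> 1" by simp
    let ?z = "exp z"
    have S: "S ?z > 0" "(S ?z)\<^sup>2 = (norm (poly f ?z))\<^sup>2 + 1" using pos by (auto simp: S_def)
    have "(Re (D ?z) / S ?z)\<^sup>2 + (- Im (D ?z) / S ?z)\<^sup>2 = (norm (D ?z))\<^sup>2 / (S ?z)\<^sup>2"
      by (simp add: cmod_power2 power_divide add_divide_distrib[symmetric])
    also have "\<dots> \<le> (A ?z)\<^sup>2"
      unfolding S(2) D_def A_def norm_mult using pos[of ?z]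
      by (auto simp: divide_le_eq algebra_simps power_mult_distrib)
    finally have g: "(Re (D ?z) / S ?z)\<^sup>2 + (- Im (D ?z) / S ?z)\<^sup>2 \<le> (A ?z)\<^sup>2" .
    have X: "Re (poly (euler f) ?z * cnj (poly (euler g) ?z)) \<le> A ?z * B ?z"
      using complex_Re_le_cmod[of "poly (euler f) ?z * cnj (poly (euler g) ?z)"]
      by (simp add: norm_mult A_def B_def)
    have "\<phi> ?z \<ge> -1" using bmo[OF z] \<rho> by (simp add: \<phi>_def field_simps)
    from exp_minus_one_ge_third[OF this]
    have E: "1 \<le> 3 * exp (\<phi> ?z)" .
    have LS: "S ?z * ((2 * (A ?z)\<^sup>2 - ((Re (D ?z) / S ?z)\<^sup>2 + (- Im (D ?z) / S ?z)\<^sup>2)) / S ?z)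
        = 2 * (A ?z)\<^sup>2 - ((Re (D ?z) / S ?z)\<^sup>2 + (- Im (D ?z) / S ?z)\<^sup>2)"
      using S(1) by simp
    from test_function_laplacian_nonneg[OF S(1) \<rho> E LS g X, of "px z" "py z"]
    show "0 \<le> \<rho> * ((2 * (A ?z)\<^sup>2 - ((Re (D ?z) / S ?z)\<^sup>2 + (- Im (D ?z) / S ?z)\<^sup>2)) / S ?z) +
         3 * \<rho> * ((2 * (A ?z)\<^sup>2 - ((Re (D ?z) / S ?z)\<^sup>2 + (- Im (D ?z) / S ?z)\<^sup>2)) / S ?z * exp (\<phi> ?z) +
           2 * (Re (D ?z) / S ?z * (exp (\<phi> ?z) * px z) + - Im (D ?z) / S ?z * (exp (\<phi> ?z) * py z)) +
           S ?z * (exp (\<phi> ?z) * ((px z)\<^sup>2 + (py z)\<^sup>2) + exp (\<phi> ?z) * (4 * (B ?z)\<^sup>2 / \<rho>\<^sup>2))) +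
         - 1 * (4 * Re (poly (euler f) ?z * cnj (poly (euler g) ?z)))"
      by linarith
  qed
  then have "W 0 \<le> (LINT z|circle_measure. W z)"
    by (simp add: integral_circle_eq_integral_cis[OF cW] field_simps)
  moreover have "W 0 \<ge> 0" using \<rho> g0 by (simp add: W_def S_def)
  moreover have "(LINT z|circle_measure. W z) =
     (LINT z|circle_measure. 4 * \<rho> * S z - Re (poly f z * cnj (poly g z)))"
    by (intro Bochner_Integration.integral_cong) (auto simp: W_def \<phi>_def bd space_circle_measure)
  moreover have "\<dots> = 4 * \<rho> * (LINT z|circle_measure. S z) - (LINT z|circle_measure. Re (poly f z * cnj (poly g z)))"
    by (subst Bochner_Integration.integral_diff)
      (auto intro!: integrable_circle_continuous continuous_intros cS)
  moreover have "(LINT z|circle_measure. Re (poly f z * cnj (poly g z))) = Re (LINT z|circle_measure. poly f z * cnj (poly g z))"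
    by (intro integral_Re integrable_circle_continuous continuous_intros)
  ultimately show ?thesis by (simp add: S_def[abs_def])
qed

section \<open>Bounded functions with prescribed Fourier coefficients\<close>

lemma sqrt_add_le_tangent:
  assumes "x > 0" "x + h \<ge> (0::real)"
  shows "sqrt (x + h) \<le> sqrt x + h / (2 * sqrt x)"
proof (rule real_le_lsqrt)
  have "sqrt x + h / (2 * sqrt x) = (x + (x + h)) / (2 * sqrt x)"
    using assms by (simp add: field_simps)
  then show "0 \<le> sqrt x + h / (2 * sqrt x)" using assms by simp
  have "(sqrt x + h / (2 * sqrt x))\<^sup>2 = x + h + (h / (2 * sqrt x))\<^sup>2"
    using assms by (simp add: power2_sum)
  then show "x + h \<le> (sqrt x + h / (2 * sqrt x))\<^sup>2" by simp
qed

lemma linear_coefficient_eq_zero: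
  fixes D E :: real
  assumes "\<And>t. 0 \<le> t * D + t\<^sup>2 * E"
  shows "D = 0"
proof (rule ccontr)
  assume D: "D \<noteq> 0"
  \<comment> \<open>At \<open>t = - D / F\<close> the linear term outweighs the quadratic one.\<close>
  define F where "F = \<bar>E\<bar> + 1"
  have F: "F > 0" "E < F" by (auto simp: F_def)
  have "0 \<le> (- D / F) * D + (- D / F)\<^sup>2 * E" by (rule assms)
  also have "\<dots> < (- D / F) * D + (- D / F)\<^sup>2 * F"
    using D F by (intro add_strict_left_mono mult_strict_left_mono) auto
  also have "\<dots> = 0" using F by (simp add: field_simps power2_eq_square)
  finally show False by simp
qed

lemma integral_circle_sum_powers_mult_cnj_power:
  "(LINT z|circle_measure. (\<Sum>j<M. c j * z ^ j) * cnj (z ^ i)) = (if i < M then c i else 0)"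
proof -
  have "(LINT z|circle_measure. (\<Sum>j<M. c j * z ^ j) * cnj (z ^ i)) =
      (LINT z|circle_measure. (\<Sum>j<M. c j * z powi (int j - int i)))"
    by (intro Bochner_Integration.integral_cong)
      (auto simp: sum_distrib_right space_circle_measure mult.assoc power_mult_cnj_power_on_circle
          simp del: complex_cnj_power)
  also have "\<dots> = (\<Sum>j<M. c j * (if j = i then 1 else 0))"
    by (subst Bochner_Integration.integral_sum)
      (auto intro!: integrable_circle_continuous continuous_intros sum.cong simp: integral_circle_power_int)
  also have "\<dots> = (if i < M then c i else 0)" by (simp add: if_distrib cong: if_cong)
  finally show ?thesis .
qed

text \<open>
  A bound for the functional with coefficients \<open>a\<close> on polynomials gives a bounded representing
  function. Minimize \<open>J c = K' * N c - l c\<close>, where \<open>N c\<close> is the integral of \<open>sqrt (\<bar>p\<bar>\<^sup>2 + 1)\<close> for the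
  polynomial \<open>p\<close> with coefficients \<open>c\<close>, and \<open>l c\<close> is the functional. Because of \<open>K < K'\<close> the functional
  \<open>J\<close> is coercive, so a minimizer exists, and the vanishing of the first variation at the minimizer \<open>p\<close>
  says exactly that \<open>u = K' p / sqrt (\<bar>p\<bar>\<^sup>2 + 1)\<close> has the coefficients \<open>a\<close>.
\<close>

lemma bounded_symbol_by_duality:
  fixes a :: "nat \<Rightarrow> complex"
  assumes K: "0 \<le> K" "K < K'"
    and bound: "\<And>c. Re (\<Sum>j<M. c j * cnj (a j)) \<le>
      K * (LINT z|circle_measure. sqrt ((norm (\<Sum>j<M. c j * z ^ j))\<^sup>2 + 1))"
  shows "\<exists>u. continuous_on (sphere 0 1) u \<and> (\<forall>z\<in>sphere 0 1. norm (u z) \<le> K') \<and>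
     (\<forall>j<M. (LINT z|circle_measure. u z * cnj (z ^ j)) = a j)"
proof -
  define P where "P c z = (\<Sum>j<M. c j * z ^ j)" for c :: "nat \<Rightarrow> complex" and z :: complex
  define S where "S c z = sqrt ((norm (P c z))\<^sup>2 + 1)" for c z
  define N where "N c = (LINT z|circle_measure. S c z)" for c
  define l where "l c = Re (\<Sum>j<M. c j * cnj (a j))" for c
  define J where "J c = K' * N c - l c" for c
  \<comment> \<open>Read as a norm on pairs, \<open>S\<close> is 1-Lipschitz in the polynomial.\<close>
  have S_norm: "S c z = norm (P c z, 1::real)" for c z by (simp add: S_def norm_Pair)
  have S_pos: "S c z > 0" for c z by (simp add: S_def add_nonneg_pos)
  have S_ge: "norm (P c z) \<le> S c z" for c z by (simp add: S_def real_le_rsqrt)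
  have cP: "continuous_on X (P c)" for X c unfolding P_def[abs_def] by (intro continuous_intros)
  have cS: "continuous_on X (S c)" for X c unfolding S_def[abs_def] by (intro continuous_intros cP)
  note int = integrable_circle_continuous
  have coeff: "(LINT z|circle_measure. P c z * cnj (z ^ j)) = c j" if "j < M" for c j
    unfolding P_def integral_circle_sum_powers_mult_cnj_power using that by simp
  have N_coeff: "norm (c j) \<le> N c" if "j < M" for c j
  proof -
    have "norm (c j) \<le> (LINT z|circle_measure. norm (P c z * cnj (z ^ j)))"
      unfolding coeff[OF that, of c, symmetric] by (rule integral_norm_bound)
    also have "\<dots> \<le> N c" unfolding N_def
      by (intro integral_mono_AE AE_I2 int continuous_intros cP cS)
        (use S_ge in \<open>auto simp: norm_mult norm_power space_circle_measure\<close>)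
    finally show ?thesis .
  qed
  have N_lipschitz: "\<bar>N c - N d\<bar> \<le> (\<Sum>j<M. norm (c j - d j))" for c d
  proof -
    have "\<bar>N c - N d\<bar> = \<bar>LINT z|circle_measure. S c z - S d z\<bar>"
      unfolding N_def by (subst Bochner_Integration.integral_diff) (auto intro!: int cS)
    also have "\<dots> \<le> (LINT z|circle_measure. \<bar>S c z - S d z\<bar>)"
      using integral_norm_bound[of circle_measure "\<lambda>z. S c z - S d z"] by simp
    also have "\<dots> \<le> (LINT z|circle_measure. (\<Sum>j<M. norm (c j - d j)))"
    proof (intro integral_mono_AE AE_I2 int continuous_intros cS)
      fix z assume "z \<in> space circle_measure"
      then have z: "norm z = 1" by (simp add: space_circle_measure)
      have "\<bar>S c z - S d z\<bar> \<le> norm ((P c z, 1::real) - (P d z, 1))"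
        unfolding S_norm by (rule norm_triangle_ineq3)
      also have "\<dots> = norm (\<Sum>j<M. (c j - d j) * z ^ j)"
        by (simp add: P_def norm_Pair sum_subtractf left_diff_distrib)
      also have "\<dots> \<le> (\<Sum>j<M. norm (c j - d j))"
        by (rule order_trans[OF norm_sum]) (simp add: norm_mult norm_power z)
      finally show "\<bar>S c z - S d z\<bar> \<le> (\<Sum>j<M. norm (c j - d j))" .
    qed
    finally show ?thesis by (simp add: circle.prob_space)
  qed
  have cN: "continuous_on UNIV N"
    unfolding continuous_on_def
  proof
    fix c :: "nat \<Rightarrow> complex"
    have "continuous_on UNIV (\<lambda>d :: nat \<Rightarrow> complex. d j)" for j
      by (rule continuous_on_product_coordinates)
    then have "((\<lambda>d. d j) \<longlongrightarrow> c j) (at c)" for j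
      by (simp add: continuous_on_def)
    then have "((\<lambda>d. \<Sum>j<M. norm (d j - c j)) \<longlongrightarrow> (\<Sum>j<M. norm (c j - c j))) (at c)"
      by (intro tendsto_intros)
    then have "((\<lambda>d. \<Sum>j<M. norm (d j - c j)) \<longlongrightarrow> 0) (at c)" by simp
    then have "((\<lambda>d. N d - N c) \<longlongrightarrow> 0) (at c)"
      by (rule Lim_null_comparison[rotated]) (use N_lipschitz in auto)
    then show "(N \<longlongrightarrow> N c) (at c within UNIV)" by (simp add: LIM_zero_iff)
  qed
  have cJ: "continuous_on UNIV J"
    unfolding J_def[abs_def] l_def by (intro continuous_intros cN continuous_on_product_coordinates)
  have N0: "N (\<lambda>_. 0) = 1" by (simp add: N_def S_def P_def circle.prob_space)
  have J0: "J (\<lambda>_. 0) = K'" by (simp add: J_def N0 l_def)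
  \<comment> \<open>Outside the polydisc of radius \<open>R\<close> the value of \<open>J\<close> exceeds \<open>J 0 = K'\<close>.\<close>
  define R where "R = K' / (K' - K)"
  have "R > 0" using K by (simp add: R_def)
  define B where "B = (\<Pi>\<^sub>E j\<in>UNIV. if j < M then cball (0::complex) R else {0})"
  have "compact B"
    using compactin_PiE[of "\<lambda>_. euclidean :: complex topology" "UNIV :: nat set" "\<lambda>j. if j < M then cball (0::complex) R else {0}"]
    by (simp add: B_def euclidean_product_topology)
  moreover have B0: "(\<lambda>_. 0) \<in> B" using \<open>R > 0\<close> by (auto simp: B_def)
  ultimately obtain c0 where c0: "c0 \<in> B" "\<And>c. c \<in> B \<Longrightarrow> J c0 \<le> J c"
    using continuous_attains_inf[of B J] continuous_on_subset[OF cJ] by (metis empty_iff subset_UNIV)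
  have J_min: "J c0 \<le> J c" for c
  proof (cases "\<forall>j<M. norm (c j) \<le> R")
    case True
    define c' where "c' j = (if j < M then c j else 0)" for j
    have "P c' = P c" by (auto simp: P_def c'_def)
    then have "J c' = J c" by (auto simp: J_def N_def S_def l_def c'_def)
    moreover have "c' \<in> B" using True by (auto simp: B_def c'_def)
    ultimately show ?thesis using c0(2)[of c'] by simp
  next
    case False
    then obtain j where j: "j < M" "norm (c j) > R" by auto
    have "J c0 \<le> (K' - K) * R" using c0(2)[OF B0] K by (simp add: J0 R_def)
    also have "\<dots> \<le> (K' - K) * N c" using N_coeff[OF j(1), of c] j K by (intro mult_left_mono) auto
    also have "\<dots> \<le> J c" using bound[of c] by (simp add: J_def l_def N_def S_def P_def algebra_simps)
    finally show ?thesis .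
  qed
  define u where "u z = of_real K' * P c0 z / of_real (S c0 z)" for z
  have cu: "continuous_on X u" for X
    unfolding u_def[abs_def] using S_pos[of c0]
    by (intro continuous_intros cP cS) (auto simp: order_less_le)
  have u_le: "norm (u z) \<le> K'" for z
    using S_ge[of c0 z] S_pos[of c0 z] K by (simp add: u_def norm_mult norm_divide divide_le_eq mult_left_mono)
  have stat: "Re (LINT z|circle_measure. cnj (u z) * P d z) = l d" for d
  proof -
    define h where "h t z = 2 * t * Re (cnj (P c0 z) * P d z) + t\<^sup>2 * (norm (P d z))\<^sup>2" for t z
    define E where "E = K' * (LINT z|circle_measure. (norm (P d z))\<^sup>2 / (2 * S c0 z))"
    define D where "D = (LINT z|circle_measure. Re (cnj (u z) * P d z)) - l d"
    have "0 \<le> t * D + t\<^sup>2 * E" for t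
    proof -
      have lin: "P (\<lambda>j. c0 j + of_real t * d j) z = P c0 z + of_real t * P d z" for z
        by (simp add: P_def sum.distrib sum_distrib_left algebra_simps)
      have S_le: "S (\<lambda>j. c0 j + of_real t * d j) z \<le> S c0 z + h t z / (2 * S c0 z)" for z
      proof -
        have eq: "(norm (P (\<lambda>j. c0 j + of_real t * d j) z))\<^sup>2 + 1 = ((norm (P c0 z))\<^sup>2 + 1) + h t z"
          unfolding lin h_def cmod_power2 by (simp add: power2_eq_square algebra_simps)
        have "((norm (P c0 z))\<^sup>2 + 1) + h t z \<ge> 0" unfolding eq[symmetric] by simp
        then show ?thesis
          unfolding S_def eq by (intro sqrt_add_le_tangent) (auto simp: add_nonneg_pos)
      qed
      have nz: "S c0 z \<noteq> 0" for z using S_pos[of c0 z] by simp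
      define I1 where "I1 = (LINT z|circle_measure. Re (cnj (P c0 z) * P d z) / S c0 z)"
      define I2 where "I2 = (LINT z|circle_measure. (norm (P d z))\<^sup>2 / (2 * S c0 z))"
      have "N (\<lambda>j. c0 j + of_real t * d j) \<le> (LINT z|circle_measure. S c0 z + h t z / (2 * S c0 z))"
        unfolding N_def using S_le
        by (intro integral_mono_AE AE_I2 int continuous_intros cP cS) (auto simp: h_def[abs_def] nz intro!: continuous_intros cP cS)
      also have "\<dots> = (LINT z|circle_measure. S c0 z + (t * (Re (cnj (P c0 z) * P d z) / S c0 z) +
          t\<^sup>2 * ((norm (P d z))\<^sup>2 / (2 * S c0 z))))"
        using nz by (intro Bochner_Integration.integral_cong) (auto simp: h_def field_simps)
      also have "\<dots> = N c0 + (t * I1 +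
          t\<^sup>2 * I2)"
      proof -
        have "integrable circle_measure (\<lambda>z. S c0 z)"
          "integrable circle_measure (\<lambda>z. t * (Re (cnj (P c0 z) * P d z) / S c0 z))"
          "integrable circle_measure (\<lambda>z. t\<^sup>2 * ((norm (P d z))\<^sup>2 / (2 * S c0 z)))"
          using nz by (intro int continuous_intros cP cS; simp)+
        then show ?thesis unfolding N_def I1_def I2_def
          by (simp only: Bochner_Integration.integral_add Bochner_Integration.integrable_add integral_mult_right_zero)
      qed
      finally have "K' * N (\<lambda>j. c0 j + of_real t * d j) \<le> K' * (N c0 + (t * I1 +
          t\<^sup>2 * I2))"
        using K by (intro mult_left_mono) auto
      moreover have "K' * I1 = D + l d"
        unfolding D_def I1_def by (subst integral_mult_right_zero[symmetric]) (auto simp: u_def mult.assoc)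
      then have "D + l d = K' * I1" by simp
      then have "K' * (N c0 + (t * I1 + t\<^sup>2 * I2)) = K' * N c0 + (t * (D + l d) + t\<^sup>2 * E)"
        by (simp only: E_def I2_def[symmetric]) (simp add: algebra_simps)
      moreover have "l (\<lambda>j. c0 j + of_real t * d j) = l c0 + t * l d"
        by (simp add: l_def sum.distrib sum_distrib_left algebra_simps)
      moreover have "J c0 \<le> J (\<lambda>j. c0 j + of_real t * d j)" by (rule J_min)
      ultimately show ?thesis by (simp add: J_def algebra_simps)
    qed
    then have "D = 0" by (rule linear_coefficient_eq_zero)
    moreover have "(LINT z|circle_measure. Re (cnj (u z) * P d z)) = Re (LINT z|circle_measure. cnj (u z) * P d z)"
      by (intro integral_Re int continuous_intros cP cu)
    ultimately show ?thesis by (simp add: D_def)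
  qed
  have "(LINT z|circle_measure. u z * cnj (z ^ j)) = a j" if j: "j < M" for j
  proof -
    define I where "I = (LINT z|circle_measure. cnj (u z) * z ^ j)"
    have "Re (\<omega> * I) = Re (\<omega> * cnj (a j))" for \<omega>
    proof -
      have "P (\<lambda>i. if i = j then \<omega> else 0) z = \<omega> * z ^ j" for z
        using j by (simp add: P_def if_distrib[of "\<lambda>x. x * _"] cong: if_cong)
      moreover have "l (\<lambda>i. if i = j then \<omega> else 0) = Re (\<omega> * cnj (a j))"
        using j by (simp add: l_def if_distrib[of "\<lambda>x. x * _"] cong: if_cong)
      ultimately have "Re (LINT z|circle_measure. \<omega> * (cnj (u z) * z ^ j)) = Re (\<omega> * cnj (a j))"
        using stat[of "\<lambda>i. if i = j then \<omega> else 0"] by (simp add: mult.left_commute)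
      then show ?thesis by (simp add: I_def)
    qed
    from this[of 1] this[of \<i>] have "I = cnj (a j)" by (simp add: complex_eq_iff)
    then have "cnj I = a j" by simp
    then show ?thesis by (simp add: I_def Bochner_Integration.integral_cnj[symmetric] del: Bochner_Integration.integral_cnj)
  qed
  then show ?thesis using cu u_le by blast
qed

section \<open>Trigonometric polynomials and Fejer multipliers\<close>

text \<open>
  Only the values on the circle count, and the last rule makes the notion insensitive to all others.
  This is needed because \<open>cnj z = z powi (-1)\<close> and \<open>z powi (m + k) = z powi m * z powi k\<close> hold there but
  not everywhere.
\<close>

inductive trig :: "(complex \<Rightarrow> complex) \<Rightarrow> bool" where
  trig_monom: "trig (\<lambda>z. c * z powi k)"
| trig_add: "trig f \<Longrightarrow> trig g \<Longrightarrow> trig (\<lambda>z. f z + g z)"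
| trig_cong: "trig f \<Longrightarrow> (\<And>z. norm z = 1 \<Longrightarrow> g z = f z) \<Longrightarrow> trig g"

definition fourier :: "(complex \<Rightarrow> complex) \<Rightarrow> int \<Rightarrow> complex" where
  "fourier f k = (LINT z|circle_measure. f z * z powi (- k))"

lemma trig_continuous: "trig f \<Longrightarrow> continuous_on (sphere 0 1) f"
proof (induction rule: trig.induct)
  case (trig_cong f g)
  then show ?case using continuous_on_cong[of "sphere 0 1" "sphere 0 1" g f] by auto
qed (auto intro!: continuous_intros)

lemma trig_0: "trig (\<lambda>_. 0)"
  using trig_monom[of 0] by simp

lemma trig_sum: "(\<And>i. i \<in> A \<Longrightarrow> trig (f i)) \<Longrightarrow> trig (\<lambda>z. \<Sum>i\<in>A. f i z)"
  by (induction A rule: infinite_finite_induct) (auto intro: trig_0 trig_add)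

lemma trig_shift: "trig f \<Longrightarrow> trig (\<lambda>z. z powi m * f z)"
proof (induction rule: trig.induct)
  case (trig_monom c k)
  have "z powi m * (c * z powi k) = c * z powi (m + k)" if "norm z = 1" for z
  proof -
    have "z \<noteq> 0" using that by auto
    then show ?thesis by (simp add: power_int_add)
  qed
  with trig.trig_monom[of c "m + k"] show ?case by (rule trig.trig_cong)
next
  case (trig_add f g)
  then show ?case by (auto simp: distrib_left intro: trig.trig_add)
next
  case (trig_cong f g)
  show ?case by (rule trig.trig_cong[OF trig_cong.IH]) (simp add: trig_cong)
qed

lemma inverse_power_int: "inverse z powi k = z powi (- k)" for z :: complex
  by (simp only: power_int_inverse power_int_minus)

lemma trig_reflect: "trig f \<Longrightarrow> trig (\<lambda>z. f (inverse z))"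
proof (induction rule: trig.induct)
  case (trig_monom c k)
  show ?case unfolding inverse_power_int by (rule trig.trig_monom)
next
  case (trig_add f g)
  then show ?case by (intro trig.trig_add)
next
  case (trig_cong f g)
  show ?case by (rule trig.trig_cong[OF trig_cong.IH]) (simp add: trig_cong norm_inverse)
qed

lemma fourier_cong: "(\<And>z. norm z = 1 \<Longrightarrow> f z = g z) \<Longrightarrow> fourier f k = fourier g k"
  unfolding fourier_def by (intro Bochner_Integration.integral_cong) (auto simp: space_circle_measure)

lemma continuous_on_circle_power_int [continuous_intros]: "continuous_on (sphere 0 1) (\<lambda>z::complex. z powi k)"
  by (intro continuous_intros) auto

lemma fourier_add:
  assumes "continuous_on (sphere 0 1) f" "continuous_on (sphere 0 1) g"
  shows "fourier (\<lambda>z. f z + g z) k = fourier f k + fourier g k"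
  unfolding fourier_def distrib_right
  by (intro Bochner_Integration.integral_add integrable_circle_continuous continuous_intros assms)

lemma fourier_monom: "fourier (\<lambda>z. c * z powi j) k = (if j = k then c else 0)"
proof -
  have "fourier (\<lambda>z. c * z powi j) k = (LINT z|circle_measure. c * z powi (j - k))"
    unfolding fourier_def
  proof (intro Bochner_Integration.integral_cong)
    fix z assume "z \<in> space circle_measure"
    then have "z \<noteq> 0" by (auto simp: space_circle_measure)
    then show "c * z powi j * z powi - k = c * z powi (j - k)"
      using power_int_add[of z j "-k"] by (simp add: mult.assoc)
  qed simp
  then show ?thesis by (simp add: integral_circle_power_int)
qed

lemma fourier_sum:
  assumes "\<And>i. i \<in> A \<Longrightarrow> continuous_on (sphere 0 1) (f i)"
  shows "fourier (\<lambda>z. \<Sum>i\<in>A. f i z) k = (\<Sum>i\<in>A. fourier (f i) k)"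
  unfolding fourier_def sum_distrib_right
  by (intro Bochner_Integration.integral_sum integrable_circle_continuous continuous_intros assms)

lemma fourier_shift: "fourier (\<lambda>z. z powi m * f z) k = fourier f (k - m)"
  unfolding fourier_def
proof (intro Bochner_Integration.integral_cong)
  fix z assume "z \<in> space circle_measure"
  then have "z \<noteq> 0" by (auto simp: space_circle_measure)
  then show "z powi m * f z * z powi - k = f z * z powi - (k - m)"
    using power_int_add[of z m "-k"] by simp
qed simp

lemma fourier_trig_reflect: "trig f \<Longrightarrow> fourier (\<lambda>z. f (inverse z)) k = fourier f (- k)"
proof (induction rule: trig.induct)
  case (trig_monom c j)
  show ?case unfolding inverse_power_int by (auto simp: fourier_monom)
next
  case (trig_add f g)
  then show ?case
    by (simp add: fourier_add trig_continuous trig_reflect)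
next
  case (trig_cong f g)
  have "fourier (\<lambda>z. g (inverse z)) k = fourier (\<lambda>z. f (inverse z)) k"
    by (rule fourier_cong) (simp add: trig_cong norm_inverse)
  with trig_cong show ?case using fourier_cong[of g f "-k"] by simp
qed

definition tent :: "nat \<Rightarrow> int \<Rightarrow> real" where
  "tent n k = max 0 (1 - \<bar>of_int k\<bar> / of_nat n)"

lemma sum_of_bool_diff_eq_tent:
  assumes "n \<ge> 1"
  shows "(\<Sum>a<n. \<Sum>b<n. if int a - int b = k then 1 else 0) = real n * tent n k"
proof -
  have "(\<Sum>a<n. \<Sum>b<n. if int a - int b = k then 1 else 0 :: real) =
     (\<Sum>b<n. if 0 \<le> int b + k \<and> int b + k < int n then 1 else 0)"
  proof (subst sum.swap, rule sum.cong[OF refl])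
    fix b assume "b \<in> {..<n}"
    have "int a - int b = k \<longleftrightarrow> 0 \<le> int b + k \<and> a = nat (int b + k)" for a by auto
    then have "(\<Sum>a<n. if int a - int b = k then 1 else 0 :: real) =
        (\<Sum>a<n. if a = nat (int b + k) then (if 0 \<le> int b + k then 1 else 0) else 0)"
      by (intro sum.cong) auto
    also have "\<dots> = (if 0 \<le> int b + k \<and> int b + k < int n then 1 else 0)"
      by (simp add: sum.delta) linarith?
    finally show "(\<Sum>a<n. if int a - int b = k then 1 else 0 :: real) = (if 0 \<le> int b + k \<and> int b + k < int n then 1 else 0)" .
  qed
  also have "\<dots> = real (card {b \<in> {..<n}. 0 \<le> int b + k \<and> int b + k < int n})"
    by (simp add: sum.If_cases Int_def)
  also have "{b \<in> {..<n}. 0 \<le> int b + k \<and> int b + k < int n} = {nat (- k)..<nat (min (int n) (int n - k))}"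
    by auto
  also have "real (card \<dots>) = real n * tent n k"
    using assms by (auto simp: tent_def max_def field_simps min_def of_nat_diff abs_if)
  finally show ?thesis .
qed

text \<open>
  This is the Cesaro mean of the formal series \<open>\<Sum>k. t k * z powi k\<close>. The double sum is kept
  because it is the quadratic form of the Toeplitz matrix of \<open>t\<close> at the vector \<open>(cnj z ^ j)\<close>,
  divided by \<open>n\<close>.
\<close>

definition fejer_mean :: "nat \<Rightarrow> (int \<Rightarrow> complex) \<Rightarrow> complex \<Rightarrow> complex" where
  "fejer_mean n t z = (\<Sum>a<n. \<Sum>b<n. t (int a - int b) / of_nat n * z powi (int a - int b))"

lemma trig_fejer_mean: "trig (fejer_mean n t)"
  unfolding fejer_mean_def[abs_def] by (intro trig_sum trig_monom)

lemma fourier_fejer_mean: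
  fixes t :: "int \<Rightarrow> complex"
  assumes "n \<ge> 1"
  shows "fourier (fejer_mean n t) k = of_real (tent n k) * t k"
proof -
  have "fourier (fejer_mean n t) k = (\<Sum>a<n. \<Sum>b<n. fourier (\<lambda>z. t (int a - int b) / of_nat n * z powi (int a - int b)) k)"
    unfolding fejer_mean_def[abs_def]
    by (subst fourier_sum fourier_sum; (intro sum.cong refl fourier_sum)?; intro continuous_intros)
  also have "\<dots> = (\<Sum>a<n. \<Sum>b<n. t k / of_nat n * of_real (if int a - int b = k then 1 else 0))"
    by (intro sum.cong refl, subst fourier_monom) auto
  also have "\<dots> = t k / of_nat n * of_real (\<Sum>a<n. \<Sum>b<n. if int a - int b = k then 1 else 0)"
    by (simp add: sum_distrib_left)
  also have "\<dots> = of_real (tent n k) * t k"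
    unfolding sum_of_bool_diff_eq_tent[OF assms] using assms by simp
  finally show ?thesis .
qed

lemma norm_sum_powers_sq:
  fixes z :: complex
  assumes "norm z = 1"
  shows "of_real ((norm (\<Sum>l<n. z ^ l))\<^sup>2) = (\<Sum>a<n. \<Sum>b<n. z powi (int a - int b))"
  unfolding complex_norm_square cnj_sum sum_product
  by (intro sum.cong refl power_mult_cnj_power_on_circle assms)

definition fejer :: "nat \<Rightarrow> complex \<Rightarrow> real" where
  "fejer n z = (norm (\<Sum>l<n. z ^ l))\<^sup>2 / of_nat n"

lemma fejer_nonneg: "fejer n z \<ge> 0"
  by (simp add: fejer_def)

lemma fejer_eq_fejer_mean: "norm z = 1 \<Longrightarrow> of_real (fejer n z) = fejer_mean n (\<lambda>_. 1) z"
  using norm_sum_powers_sq[of z n] by (simp add: fejer_def fejer_mean_def sum_divide_distrib)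

lemma continuous_on_fejer [continuous_intros]:
  "continuous_on X f \<Longrightarrow> continuous_on X (\<lambda>x. fejer n (f x))"
  unfolding fejer_def divide_inverse by (intro continuous_intros)

lemma fourier_fejer: "n \<ge> 1 \<Longrightarrow> fourier (\<lambda>z. of_real (fejer n z)) k = of_real (tent n k)"
  using fourier_fejer_mean[of n "\<lambda>_. 1" k] fourier_cong[of "\<lambda>z. of_real (fejer n z)" "fejer_mean n (\<lambda>_. 1)" k, OF fejer_eq_fejer_mean] by simp

text \<open>
  The Fejer mean of \<open>u\<close> is the convolution with the Fejer kernel, which is nonnegative and has
  integral \<open>1\<close>.
\<close>

lemma norm_fejer_mean_le:
  assumes u: "continuous_on (sphere 0 1) u" and B: "\<And>z. norm z = 1 \<Longrightarrow> norm (u z) \<le> B"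
    and n: "n \<ge> 1" and z: "norm z = 1"
  shows "norm (fejer_mean n (fourier u) z) \<le> B"
proof -
  have "fejer_mean n (fourier u) z = (LINT w|circle_measure. of_real (fejer n (z * cnj w)) * u w)"
  proof -
    have "fejer_mean n (fourier u) z = (\<Sum>a<n. \<Sum>b<n. LINT w|circle_measure.
        (u w * w powi (- (int a - int b))) * (z powi (int a - int b) / of_nat n))"
      unfolding fejer_mean_def fourier_def integral_mult_left_zero by simp
    also have "\<dots> = (LINT w|circle_measure. (\<Sum>a<n. \<Sum>b<n.
        (u w * w powi (- (int a - int b))) * (z powi (int a - int b) / of_nat n)))"
      by (subst Bochner_Integration.integral_sum, intro integrable_circle_continuous continuous_intros u,
          intro sum.cong refl, subst Bochner_Integration.integral_sum, 
          intro integrable_circle_continuous continuous_intros u, rule refl)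
    also have "\<dots> = (LINT w|circle_measure. of_real (fejer n (z * cnj w)) * u w)"
    proof (intro Bochner_Integration.integral_cong refl)
      fix w assume "w \<in> space circle_measure"
      then have w: "norm w = 1" by (simp add: space_circle_measure)
      have "of_real (fejer n (z * cnj w)) * u w = (\<Sum>a<n. \<Sum>b<n. (z * cnj w) powi (int a - int b)) / of_nat n * u w"
        using norm_sum_powers_sq[of "z * cnj w" n] z w by (simp add: fejer_def norm_mult)
      also have "\<dots> = (\<Sum>a<n. \<Sum>b<n. (u w * w powi (- (int a - int b))) * (z powi (int a - int b) / of_nat n))"
        using cnj_power_int_on_circle[OF w]
        by (simp add: sum_divide_distrib sum_distrib_right sum_distrib_left power_int_mult_distrib mult_ac flip: cnj_power_int_on_circle)
      finally show "(\<Sum>a<n. \<Sum>b<n. (u w * w powi (- (int a - int b))) * (z powi (int a - int b) / of_nat n)) =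
          of_real (fejer n (z * cnj w)) * u w" by simp
    qed
    finally show ?thesis .
  qed
  also have "norm \<dots> \<le> (LINT w|circle_measure. norm (of_real (fejer n (z * cnj w)) * u w))"
    by (rule integral_norm_bound)
  also have "\<dots> \<le> (LINT w|circle_measure. fejer n (z * cnj w) * B)"
    by (intro integral_mono_AE AE_I2 integrable_circle_continuous continuous_intros u)
      (auto simp: norm_mult fejer_nonneg space_circle_measure intro!: mult_left_mono B)
  also have "\<dots> = B * Re (LINT w|circle_measure. of_real (fejer n (z * cnj w)))"
    by (simp add: mult.commute)
  also have "(LINT w|circle_measure. complex_of_real (fejer n (z * cnj w))) = 1"
  proof -
    have "(LINT w|circle_measure. complex_of_real (fejer n (z * cnj w))) =
      (LINT w|circle_measure. fejer_mean n (\<lambda>k. z powi (- k)) w)"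
    proof (intro Bochner_Integration.integral_cong refl)
      fix w assume "w \<in> space circle_measure"
      then have w: "norm w = 1" by (simp add: space_circle_measure)
      have e: "norm (\<Sum>l<n. (z * cnj w) ^ l) = norm (\<Sum>l<n. (cnj z * w) ^ l)"
        by (subst complex_mod_cnj[symmetric]) (simp add: cnj_sum)
      have "of_real (fejer n (z * cnj w)) = (\<Sum>a<n. \<Sum>b<n. (cnj z * w) powi (int a - int b)) / of_nat n"
        using norm_sum_powers_sq[of "cnj z * w" n] z w by (simp add: fejer_def norm_mult e)
      then show "of_real (fejer n (z * cnj w)) = fejer_mean n (\<lambda>k. z powi (- k)) w"
        using cnj_power_int_on_circle[OF z]
        by (simp add: fejer_mean_def sum_divide_distrib power_int_mult_distrib flip: cnj_power_int_on_circle)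
    qed
    also have "\<dots> = fourier (fejer_mean n (\<lambda>k. z powi (- k))) 0" by (simp add: fourier_def)
    also have "\<dots> = 1" using fourier_fejer_mean[OF n] by (simp add: tent_def)
    finally show ?thesis .
  qed
  finally show ?thesis by simp
qed

text \<open>
  Multiplying the antidiagonals by values of \<open>tent n\<close> averages, with respect to the Fejer kernel, the
  matrices obtained by multiplying rows and columns by rotations \<open>w ^ j\<close>. A rotation merely replaces the test
  vector at \<open>x\<close> by the one at \<open>w * x\<close>, so the average satisfies the same bound. The shift by \<open>1\<close> fits the
  convention that the entry \<open>(i, j)\<close> of a Hankel matrix is the coefficient of index \<open>i + j + 1\<close>.
\<close>

lemma hankel_fejer_multiplier:
  fixes s :: "nat \<Rightarrow> complex" and x :: complex
  assumes n: "n \<ge> 1" and \<sigma>: "\<sigma> \<ge> 0"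
    and hyp: "\<And>w. norm w = 1 \<Longrightarrow> (\<Sum>i<N. (norm (\<Sum>j<N. s (i + j) * (w * x) ^ j))\<^sup>2) \<le> \<sigma>\<^sup>2"
  shows "(\<Sum>i<N. (norm (\<Sum>j<N. of_real (tent n (int (i + j + 1))) * s (i + j) * x ^ j))\<^sup>2) \<le> \<sigma>\<^sup>2"
proof -
  define q where "q i = (\<Sum>j<N. of_real (tent n (int (i + j + 1))) * s (i + j) * x ^ j)" for i
  define r where "r w i = (\<Sum>j<N. s (i + j) * (w * x) ^ j)" for w i
  have tent: "(LINT w|circle_measure. of_real (fejer n w) * w ^ m) = of_real (tent n (int m))" for m
    using fourier_fejer[OF n, of "- int m"] by (simp add: fourier_def tent_def)
  have cr: "continuous_on X (\<lambda>w. r w i)" for X i unfolding r_def by (intro continuous_intros)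
  have q: "q i = (LINT w|circle_measure. of_real (fejer n w) * w ^ (i + 1) * r w i)" for i
  proof -
    have "q i = (\<Sum>j<N. (LINT w|circle_measure. (of_real (fejer n w) * w ^ (i + j + 1)) * (s (i + j) * x ^ j)))"
      unfolding q_def tent[symmetric]
      by (simp only: integral_mult_left_zero) (simp only: mult.assoc add.assoc)
    also have "\<dots> = (LINT w|circle_measure. (\<Sum>j<N. (of_real (fejer n w) * w ^ (i + j + 1)) * (s (i + j) * x ^ j)))"
      by (intro Bochner_Integration.integral_sum[symmetric] integrable_circle_continuous continuous_intros)
    also have "\<dots> = (LINT w|circle_measure. of_real (fejer n w) * w ^ (i + 1) * r w i)"
      by (intro Bochner_Integration.integral_cong refl)
        (simp add: r_def sum_distrib_left power_add power_mult_distrib mult_ac)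
    finally show ?thesis .
  qed
  define Q where "Q = L2_set (\<lambda>i. norm (q i)) {..<N}"
  have "Q\<^sup>2 = (\<Sum>i<N. (norm (q i))\<^sup>2)" by (simp add: Q_def L2_set_def sum_nonneg)
  also have "\<dots> = Re (\<Sum>i<N. q i * cnj (q i))" by (simp add: complex_norm_square[symmetric])
  also have "(\<Sum>i<N. q i * cnj (q i)) =
      (LINT w|circle_measure. (\<Sum>i<N. of_real (fejer n w) * w ^ (i + 1) * r w i * cnj (q i)))"
    by (subst Bochner_Integration.integral_sum) 
      (auto intro!: integrable_circle_continuous continuous_intros cr simp: q)
  also have "Re \<dots> \<le> norm \<dots>" by (rule complex_Re_le_cmod)
  also have "\<dots> \<le> (LINT w|circle_measure. norm (\<Sum>i<N. of_real (fejer n w) * w ^ (i + 1) * r w i * cnj (q i)))"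
    by (rule integral_norm_bound)
  also have "\<dots> \<le> (LINT w|circle_measure. fejer n w * (\<sigma> * Q))"
  proof (intro integral_mono_AE AE_I2 integrable_circle_continuous continuous_intros cr)
    fix w assume "w \<in> space circle_measure"
    then have w: "norm w = 1" by (simp add: space_circle_measure)
    have "norm (\<Sum>i<N. of_real (fejer n w) * w ^ (i + 1) * r w i * cnj (q i)) \<le>
        (\<Sum>i<N. fejer n w * (norm (r w i) * norm (q i)))"
      by (rule order_trans[OF norm_sum]) (simp add: norm_mult norm_power w fejer_nonneg mult.assoc)
    also have "\<dots> = fejer n w * (\<Sum>i<N. \<bar>norm (r w i)\<bar> * \<bar>norm (q i)\<bar>)" by (simp add: sum_distrib_left)
    also have "\<dots> \<le> fejer n w * (L2_set (\<lambda>i. norm (r w i)) {..<N} * Q)"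
      unfolding Q_def by (intro mult_left_mono L2_set_mult_ineq fejer_nonneg)
    also have "\<dots> \<le> fejer n w * (\<sigma> * Q)"
    proof (intro mult_left_mono mult_right_mono fejer_nonneg)
      show "L2_set (\<lambda>i. norm (r w i)) {..<N} \<le> \<sigma>"
        unfolding L2_set_def r_def using hyp[OF w] \<sigma> by (intro real_le_lsqrt sum_nonneg) auto
      show "Q \<ge> 0" by (simp add: Q_def)
    qed
    finally show "norm (\<Sum>i<N. of_real (fejer n w) * w ^ (i + 1) * r w i * cnj (q i)) \<le> fejer n w * (\<sigma> * Q)" .
  qed
  also have "\<dots> = (\<sigma> * Q) * Re (LINT w|circle_measure. of_real (fejer n w) * w ^ 0)"
    by (simp add: mult.commute)
  also have "\<dots> = \<sigma> * Q" unfolding tent by (simp add: tent_def)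
  finally have "Q\<^sup>2 \<le> \<sigma> * Q" .
  then have "Q \<le> \<sigma>" using \<sigma> by (cases "Q > 0") (auto simp: power2_eq_square)
  moreover have "Q \<ge> 0" by (simp add: Q_def)
  ultimately have "Q\<^sup>2 \<le> \<sigma>\<^sup>2" by (intro power_mono)
  then show ?thesis by (simp add: Q_def L2_set_def sum_nonneg q_def)
qed

section \<open>Bounded symbols for Hankel and Toeplitz matrices\<close>

text \<open>
  Let \<open>g\<close> be the polynomial with coefficients \<open>a (Suc m) = tent N (Suc m) * s m\<close> and \<open>a 0 = 0\<close>, and let
  \<open>G i\<close> be its backward shifts, so that \<open>G i = a i + z * G (Suc i)\<close> and \<open>G 0 = g\<close>. Taking squared
  absolute values and summing over \<open>i\<close> shows that \<open>\<bar>g\<bar>\<^sup>2 + (1 - \<bar>z\<bar>\<^sup>2) * (\<Sum>i. \<bar>G (Suc i)\<bar>\<^sup>2)\<close> is the real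
  part of a polynomial \<open>q\<close>. It is thus the harmonic extension of \<open>\<bar>g\<bar>\<^sup>2\<close>, and the bound on test vectors,
  which passes to \<open>a\<close> by \<open>hankel_fejer_multiplier\<close>, is the oscillation condition of
  \<open>H1_BMO_pairing_bound\<close>. Duality yields a function bounded by \<open>5 * \<rho>\<close>. Two Fejer means of order
  \<open>2 * N\<close>, one of them shifted by \<open>2 * N\<close>, turn it into a trigonometric polynomial with the same
  coefficients of index \<open>0, \<dots>, 2 * N - 1\<close>, at the cost of a factor \<open>2\<close>.
\<close>

lemma hankel_bounded_symbol:
  fixes s :: "nat \<Rightarrow> complex"
  assumes N: "N \<ge> 1" and \<rho>: "\<rho> > 0"
    and hyp: "\<And>x. norm x < 1 \<Longrightarrow> (1 - (norm x)\<^sup>2) * (\<Sum>i<N. (norm (\<Sum>j<N. s (i + j) * x ^ j))\<^sup>2) \<le> \<rho>\<^sup>2"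
  shows "\<exists>\<psi>. trig \<psi> \<and> (\<forall>z. norm z = 1 \<longrightarrow> norm (\<psi> z) \<le> 10 * \<rho>) \<and>
    (\<forall>n. n < 2 * N - 1 \<longrightarrow> fourier \<psi> (int (Suc n)) = of_real (tent N (int (Suc n))) * s n)"
proof -
  define a where "a n = (case n of 0 \<Rightarrow> 0 | Suc m \<Rightarrow> of_real (tent N (int n)) * s m)" for n
  have a0: "a 0 = 0" by (simp add: a_def)
  have aSuc: "a (Suc n) = of_real (tent N (int (Suc n))) * s n" for n by (simp add: a_def)
  have a_big: "a n = 0" if "n \<ge> N" for n
    using that N by (cases n) (auto simp: a_def tent_def max_def field_simps)
  define Gp where "Gp i = (\<Sum>j<N. monom (a (i + j)) j)" for i
  define G where "G i z = (\<Sum>j<N. a (i + j) * z ^ j)" for i and z :: complex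
  have G: "poly (Gp i) z = G i z" for i z by (simp add: Gp_def G_def poly_sum poly_monom)
  have G_step: "G i z = a i + z * G (Suc i) z" for i z
  proof -
    have "G i z = (\<Sum>j<Suc N. a (i + j) * z ^ j)" by (simp add: G_def a_big)
    also have "\<dots> = a i + z * G (Suc i) z"
      by (subst sum.lessThan_Suc_shift) (simp add: G_def sum_distrib_left mult_ac)
    finally show ?thesis .
  qed
  have GN: "G N z = 0" for z by (simp add: G_def a_big)
  \<comment> \<open>The polynomial whose real part is the harmonic extension of \<open>\<bar>g\<bar>\<^sup>2\<close>, where \<open>g\<close> is \<open>Gp 0\<close>.\<close>
  define q where "q = (\<Sum>i<N. smult (2 * cnj (a i)) (Gp i)) - [:of_real (\<Sum>i<N. (norm (a i))\<^sup>2):]"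
  have q: "Re (poly q z) = (\<Sum>i<N. 2 * Re (cnj (a i) * G i z) - (norm (a i))\<^sup>2)" for z
    by (simp add: q_def poly_sum G sum_subtractf algebra_simps sum_distrib_left)
  have defect: "Re (poly q z) - (norm (poly (Gp 0) z))\<^sup>2 =
     (1 - (norm z)\<^sup>2) * (\<Sum>i<N. (norm (G (Suc i) z))\<^sup>2)" for z
  proof -
    have "(norm z)\<^sup>2 * (norm (G (Suc i) z))\<^sup>2 = (norm (G i z))\<^sup>2 - (2 * Re (cnj (a i) * G i z) - (norm (a i))\<^sup>2)" for i
    proof -
      have "(norm z)\<^sup>2 * (norm (G (Suc i) z))\<^sup>2 = (norm (G i z - a i))\<^sup>2"
        using G_step[of i z] by (simp add: norm_mult power_mult_distrib)
      also have "\<dots> = (norm (G i z))\<^sup>2 - (2 * Re (cnj (a i) * G i z) - (norm (a i))\<^sup>2)"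
        unfolding cmod_power2 by (simp add: power2_eq_square algebra_simps)
      finally show ?thesis .
    qed
    then have "(norm z)\<^sup>2 * (\<Sum>i<N. (norm (G (Suc i) z))\<^sup>2) = (\<Sum>i<N. (norm (G i z))\<^sup>2) - Re (poly q z)"
      by (simp add: sum_distrib_left q sum_subtractf)
    moreover have "(\<Sum>i<N. (norm (G (Suc i) z))\<^sup>2) - (\<Sum>i<N. (norm (G i z))\<^sup>2) = (norm (G N z))\<^sup>2 - (norm (G 0 z))\<^sup>2"
      unfolding sum_subtractf[symmetric] by (rule sum_lessThan_telescope)
    ultimately show ?thesis by (simp add: G GN algebra_simps)
  qed
  have bmo: "Re (poly q z) - (norm (poly (Gp 0) z))\<^sup>2 \<le> \<rho>\<^sup>2" if z: "norm z \<le> 1" for z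
  proof (cases "norm z = 1")
    case True
    then show ?thesis unfolding defect by simp
  next
    case False
    then have pos: "1 - (norm z)\<^sup>2 > 0" using z by (simp add: power_less_one_iff abs_square_less_1)
    define \<sigma> where "\<sigma> = \<rho> / sqrt (1 - (norm z)\<^sup>2)"
    have \<sigma>2: "\<sigma>\<^sup>2 = \<rho>\<^sup>2 / (1 - (norm z)\<^sup>2)" using pos by (simp add: \<sigma>_def power_divide)
    have "(\<Sum>i<N. (norm (\<Sum>j<N. of_real (tent N (int (i + j + 1))) * s (i + j) * z ^ j))\<^sup>2) \<le> \<sigma>\<^sup>2"
    proof (rule hankel_fejer_multiplier[OF N])
      show "\<sigma> \<ge> 0" using \<rho> pos by (simp add: \<sigma>_def)
      fix w :: complex assume "norm w = 1"
      then show "(\<Sum>i<N. (norm (\<Sum>j<N. s (i + j) * (w * z) ^ j))\<^sup>2) \<le> \<sigma>\<^sup>2"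
        using hyp[of "w * z"] False z pos by (simp add: \<sigma>2 norm_mult pos_le_divide_eq mult.commute)
    qed
    also have "(\<Sum>i<N. (norm (\<Sum>j<N. of_real (tent N (int (i + j + 1))) * s (i + j) * z ^ j))\<^sup>2) =
        (\<Sum>i<N. (norm (G (Suc i) z))\<^sup>2)"
      by (simp add: G_def aSuc add.commute)
    finally show ?thesis
      unfolding defect using pos by (simp add: \<sigma>2 pos_le_divide_eq mult.commute)
  qed
  have "Re (\<Sum>j<2 * N. c j * cnj (a j)) \<le>
      (4 * \<rho>) * (LINT z|circle_measure. sqrt ((norm (\<Sum>j<2 * N. c j * z ^ j))\<^sup>2 + 1))" for c
  proof -
    define f where "f = (\<Sum>j<2 * N. monom (c j) j)"
    have f: "poly f z = (\<Sum>j<2 * N. c j * z ^ j)" for z by (simp add: f_def poly_sum poly_monom)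
    have "Re (LINT z|circle_measure. poly f z * cnj (poly (Gp 0) z)) \<le>
       4 * \<rho> * (LINT z|circle_measure. sqrt ((norm (poly f z))\<^sup>2 + 1))"
    proof (rule H1_BMO_pairing_bound[OF \<rho> _ bmo])
      show "poly (Gp 0) 0 = 0" using G_step[of 0 0] by (simp add: G a0)
      show "Re (poly q z) = (norm (poly (Gp 0) z))\<^sup>2" if "norm z = 1" for z
        using defect[of z] that by simp
    qed
    also have "(LINT z|circle_measure. poly f z * cnj (poly (Gp 0) z)) =
        (LINT z|circle_measure. (\<Sum>i<N. cnj (a i) * (poly f z * cnj (z ^ i))))"
      by (intro Bochner_Integration.integral_cong refl) (simp add: G G_def sum_distrib_left mult_ac)
    also have "\<dots> = (\<Sum>i<N. cnj (a i) * (LINT z|circle_measure. poly f z * cnj (z ^ i)))"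
      by (subst Bochner_Integration.integral_sum) (auto intro!: integrable_circle_continuous continuous_intros)
    also have "\<dots> = (\<Sum>i<N. c i * cnj (a i))"
      unfolding f integral_circle_sum_powers_mult_cnj_power by (intro sum.cong) auto
    also have "\<dots> = (\<Sum>i<2*N. c i * cnj (a i))"
      by (intro sum.mono_neutral_left) (auto simp: a_big)
    finally show ?thesis by (simp add: f)
  qed
  then obtain u where u: "continuous_on (sphere 0 1) u" "\<And>z. z \<in> sphere 0 1 \<Longrightarrow> norm (u z) \<le> 5 * \<rho>"
    "\<And>j. j < 2 * N \<Longrightarrow> (LINT z|circle_measure. u z * cnj (z ^ j)) = a j"
    using bounded_symbol_by_duality[where K="4 * \<rho>" and K'="5 * \<rho>" and M="2 * N" and a=a] \<rho> by auto
  have uj: "fourier u (int j) = a j" if "j < 2 * N" for j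
  proof -
    have "fourier u (int j) = (LINT z|circle_measure. u z * cnj (z ^ j))"
      unfolding fourier_def using power_mult_cnj_power_on_circle[of _ 0 j]
      by (intro Bochner_Integration.integral_cong) (auto simp: space_circle_measure simp del: complex_cnj_power)
    then show ?thesis using u(3) that by simp
  qed
  \<comment> \<open>The tents of width \<open>2 * N\<close> centred at \<open>0\<close> and \<open>2 * N\<close> add up to \<open>1\<close> on the indices between.\<close>
  define v where "v z = z powi (- int (2 * N)) * u z" for z
  have vk: "fourier v k = fourier u (k + int (2 * N))" for k
    unfolding v_def[abs_def] fourier_shift by simp
  have cv: "continuous_on (sphere 0 1) v" unfolding v_def[abs_def] by (intro continuous_intros u)
  have N2: "2 * N \<ge> 1" using N by simp
  define \<psi> where "\<psi> z = fejer_mean (2 * N) (fourier u) z + z powi (int (2 * N)) * fejer_mean (2 * N) (fourier v) z" for z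
  have "trig \<psi>" unfolding \<psi>_def[abs_def] by (intro trig_add trig_shift trig_fejer_mean)
  moreover have "norm (\<psi> z) \<le> 10 * \<rho>" if z: "norm z = 1" for z
  proof -
    have "norm (\<psi> z) \<le> norm (fejer_mean (2 * N) (fourier u) z) + norm (fejer_mean (2 * N) (fourier v) z)"
      unfolding \<psi>_def by (rule order_trans[OF norm_triangle_ineq]) (simp add: norm_mult norm_power_int z)
    also have "\<dots> \<le> 5 * \<rho> + 5 * \<rho>"
      by (intro add_mono norm_fejer_mean_le N2 z u cv)
        (auto simp: v_def norm_mult norm_power_int intro!: u)
    finally show ?thesis by simp
  qed
  moreover have "fourier \<psi> (int j) = a j" if j: "j < 2 * N" for j
  proof -
    have "fourier \<psi> (int j) = fourier (fejer_mean (2 * N) (fourier u)) (int j) + fourier (fejer_mean (2 * N) (fourier v)) (int j - int (2 * N))"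
      unfolding \<psi>_def[abs_def]
      by (subst fourier_add) (auto intro!: trig_continuous trig_shift trig_fejer_mean simp: fourier_shift)
    also have "\<dots> = (of_real (tent (2 * N) (int j) + tent (2 * N) (int j - int (2 * N)))) * a j"
      by (simp only: fourier_fejer_mean[OF N2] vk) (simp add: uj[OF j] distrib_right)
    also have "tent (2 * N) (int j) + tent (2 * N) (int j - int (2 * N)) = 1"
      using j N by (simp add: tent_def max_def field_simps)
    finally show ?thesis by simp
  qed
  ultimately show ?thesis by (intro exI[of _ \<psi>]) (auto simp: aSuc simp del: of_nat_Suc)
qed

text \<open>
  The first bound allows one to pass to test vectors of infinite length, for which
  \<open>hankel_bounded_symbol\<close> is formulated; the second one survives the limit \<open>x \<rightarrow> 1\<close>.
\<close>

lemma kernel_normalization_bounds: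
  fixes x :: real
  assumes "N \<ge> 1" "0 \<le> x" "x < 1"
  shows "1 - x\<^sup>2 \<le> (1 - x\<^sup>2) / (1 - (x ^ N)\<^sup>2)" and "1 / real N \<le> (1 - x\<^sup>2) / (1 - (x ^ N)\<^sup>2)"
proof -
  have x: "0 \<le> x\<^sup>2" "x\<^sup>2 < 1" using assms by (auto simp: power_less_one_iff abs_square_less_1)
  have e: "(x ^ N)\<^sup>2 = (x\<^sup>2) ^ N" by (simp add: power_mult[symmetric] mult.commute)
  have p: "(x\<^sup>2) ^ N < 1" using x assms by (simp add: power_less_one_iff)
  have p0: "0 \<le> (x\<^sup>2) ^ N" by simp
  show "1 - x\<^sup>2 \<le> (1 - x\<^sup>2) / (1 - (x ^ N)\<^sup>2)"
    unfolding e using x p p0 by (simp add: pos_le_divide_eq mult_left_le)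
  have "1 - (x\<^sup>2) ^ N = (1 - x\<^sup>2) * (\<Sum>i<N. (x\<^sup>2) ^ i)" by (rule one_diff_power_eq)
  also have "\<dots> \<le> (1 - x\<^sup>2) * (\<Sum>i<N. 1)"
    using x assms by (intro mult_left_mono sum_mono power_le_one) auto
  finally show "1 / real N \<le> (1 - x\<^sup>2) / (1 - (x ^ N)\<^sup>2)"
    unfolding e using p assms by (simp add: field_simps)
qed

text \<open>
  The three pieces of \<open>t\<close> contribute \<open>\<rho>\<close>, \<open>10 * \<rho>\<close> and \<open>10 * \<rho>\<close>. Reversing the order of the rows turns
  the piece with positive indices into a Hankel matrix, and reversing the order of the columns does so
  for the piece with negative indices. This is why two families of test vectors occur: the second one
  consists of the reversed vectors of the first.
\<close>

lemma toeplitz_bounded_symbol_pos: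
  fixes t :: "int \<Rightarrow> complex"
  assumes N: "N \<ge> 1" and \<rho>: "\<rho> > 0"
    and A: "\<And>x. norm x < 1 \<Longrightarrow> (1 - (norm x)\<^sup>2) / (1 - (norm x ^ N)\<^sup>2) *
       (\<Sum>i<N. (norm (\<Sum>j<N. t (int i - int j) * x ^ j))\<^sup>2) \<le> \<rho>\<^sup>2"
    and B: "\<And>x. norm x < 1 \<Longrightarrow> (1 - (norm x)\<^sup>2) / (1 - (norm x ^ N)\<^sup>2) *
       (\<Sum>i<N. (norm (\<Sum>j<N. t (int i - int j) * x ^ (N - 1 - j)))\<^sup>2) \<le> \<rho>\<^sup>2"
  shows "\<exists>\<psi>. trig \<psi> \<and> (\<forall>z. norm z = 1 \<longrightarrow> norm (\<psi> z) \<le> 21 * \<rho>) \<and>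
    (\<forall>k. \<bar>k\<bar> < int N \<longrightarrow> fourier \<psi> k = t k)"
proof -
  define T where "T x = (\<Sum>i<N. (norm (\<Sum>j<N. t (int i - int j) * x ^ j))\<^sup>2)" for x
  define T' where "T' x = (\<Sum>i<N. (norm (\<Sum>j<N. t (int i - int j) * x ^ (N - 1 - j)))\<^sup>2)" for x
  have T_nonneg: "T x \<ge> 0" "T' x \<ge> 0" for x by (auto simp: T_def T'_def intro!: sum_nonneg)
  have T_small: "(1 - (norm x)\<^sup>2) * T x \<le> \<rho>\<^sup>2" "(1 - (norm x)\<^sup>2) * T' x \<le> \<rho>\<^sup>2" if "norm x < 1" for x
    using A[OF that] B[OF that] mult_right_mono[OF kernel_normalization_bounds(1)[OF N norm_ge_zero that] T_nonneg(1)[of x]]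
      mult_right_mono[OF kernel_normalization_bounds(1)[OF N norm_ge_zero that] T_nonneg(2)[of x]]
    unfolding T_def T'_def by linarith+
  have T_disc: "T x \<le> real N * \<rho>\<^sup>2" if "norm x < 1" for x
  proof -
    have "1 / real N * T x \<le> \<rho>\<^sup>2"
      using A[OF that] mult_right_mono[OF kernel_normalization_bounds(2)[OF N norm_ge_zero that] T_nonneg(1)[of x]]
      unfolding T_def by linarith
    then show ?thesis using N by (simp add: field_simps)
  qed
  \<comment> \<open>Let \<open>x\<close> tend to the circle along a radius.\<close>
  have T_circle: "T x \<le> real N * \<rho>\<^sup>2" if x: "norm x = 1" for x
  proof -
    have "((\<lambda>r. T (of_real r * x)) \<longlongrightarrow> T (of_real 1 * x)) (at_left 1)"
      unfolding T_def by (intro tendsto_intros)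
    moreover have "eventually (\<lambda>r. r \<in> {0<..<1}) (at_left (1::real))"
      by (rule eventually_at_left_real) simp
    then have "eventually (\<lambda>r. T (of_real r * x) \<le> real N * \<rho>\<^sup>2) (at_left (1::real))"
      by eventually_elim (auto simp: norm_mult x intro!: T_disc)
    ultimately show ?thesis by (intro tendsto_upperbound[of _ "T x" "at_left (1::real)"]) auto
  qed
  have low: "norm (fejer_mean N t z) \<le> \<rho>" if z: "norm z = 1" for z
  proof -
    have z0: "z \<noteq> 0" using z by auto
    define y where "y i = (\<Sum>j<N. t (int i - int j) * (cnj z) ^ j)" for i
    have "fejer_mean N t z = (\<Sum>i<N. z ^ i * y i) / of_nat N"
      unfolding fejer_mean_def y_def sum_divide_distrib sum_distrib_left
      by (intro sum.cong refl) (simp add: power_mult_cnj_power_on_circle[OF z, symmetric])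
    also have "norm \<dots> \<le> (\<Sum>i<N. \<bar>1\<bar> * \<bar>norm (y i)\<bar>) / real N"
      by (simp add: norm_divide) (intro divide_right_mono order_trans[OF norm_sum], auto simp: norm_mult norm_power z)
    also have "\<dots> \<le> (L2_set (\<lambda>i. 1) {..<N} * L2_set (\<lambda>i. norm (y i)) {..<N}) / real N"
      by (intro divide_right_mono L2_set_mult_ineq) auto
    also have "\<dots> \<le> (L2_set (\<lambda>i. 1) {..<N} * (sqrt (real N) * \<rho>)) / real N"
    proof (intro divide_right_mono mult_left_mono)
      show "L2_set (\<lambda>i. norm (y i)) {..<N} \<le> sqrt (real N) * \<rho>"
        unfolding L2_set_def using T_circle[of "cnj z"] z \<rho>
        by (intro real_le_lsqrt) (auto simp: T_def y_def power_mult_distrib intro!: sum_nonneg)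
    qed auto
    also have "L2_set (\<lambda>i. 1::real) {..<N} * (sqrt (real N) * \<rho>) / real N = \<rho>"
      using N by (simp add: L2_set_def mult.assoc[symmetric])
    finally show ?thesis .
  qed
  \<comment> \<open>The piece with positive indices: its coefficient at \<open>k\<close> is that of \<open>\<psi>1\<close> at \<open>N - k\<close>.\<close>
  obtain \<psi>1 where p1: "trig \<psi>1" "\<And>z. norm z = 1 \<Longrightarrow> norm (\<psi>1 z) \<le> 10 * \<rho>"
    "\<And>n. n < 2 * N - 1 \<Longrightarrow> fourier \<psi>1 (int (Suc n)) = of_real (tent N (int (Suc n))) * t (int N - 1 - int n)"
  proof -
    have "(1 - (norm x)\<^sup>2) * (\<Sum>i<N. (norm (\<Sum>j<N. t (int N - 1 - int (i + j)) * x ^ j))\<^sup>2) \<le> \<rho>\<^sup>2" if "norm x < 1" for x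
    proof -
      have "(\<Sum>i<N. (norm (\<Sum>j<N. t (int N - 1 - int (i + j)) * x ^ j))\<^sup>2) = T x"
        unfolding T_def
        by (subst sum.nat_diff_reindex[symmetric])
          (intro sum.cong refl arg_cong[where f="\<lambda>x. (norm x)\<^sup>2"], auto simp: algebra_simps of_nat_diff)
      then show ?thesis using T_small(1)[OF that] by simp
    qed
    from hankel_bounded_symbol[OF N \<rho>, of "\<lambda>n. t (int N - 1 - int n)", OF this]
    show ?thesis using that by blast
  qed
  \<comment> \<open>The piece with negative indices: its coefficient at \<open>k\<close> is that of \<open>\<psi>2\<close> at \<open>k + N\<close>.\<close>
  obtain \<psi>2 where p2: "trig \<psi>2" "\<And>z. norm z = 1 \<Longrightarrow> norm (\<psi>2 z) \<le> 10 * \<rho>"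
    "\<And>n. n < 2 * N - 1 \<Longrightarrow> fourier \<psi>2 (int (Suc n)) = of_real (tent N (int (Suc n))) * t (int n + 1 - int N)"
  proof -
    have "(1 - (norm x)\<^sup>2) * (\<Sum>i<N. (norm (\<Sum>j<N. t (int (i + j) + 1 - int N) * x ^ j))\<^sup>2) \<le> \<rho>\<^sup>2" if "norm x < 1" for x
    proof -
      have "(\<Sum>j<N. t (int (i + j) + 1 - int N) * x ^ j) = (\<Sum>j<N. t (int i - int j) * x ^ (N - 1 - j))" for i
        by (subst sum.nat_diff_reindex[symmetric]) (intro sum.cong refl, auto simp: algebra_simps of_nat_diff)
      then show ?thesis using T_small(2)[OF that] by (simp add: T'_def)
    qed
    from hankel_bounded_symbol[OF N \<rho>, of "\<lambda>n. t (int n + 1 - int N)", OF this]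
    show ?thesis using that by blast
  qed
  define \<psi> where "\<psi> z = fejer_mean N t z + (z powi (int N) * \<psi>1 (inverse z) + z powi (- int N) * \<psi>2 z)" for z
  have "trig \<psi>"
    unfolding \<psi>_def[abs_def] by (intro trig_add trig_shift trig_reflect trig_fejer_mean p1 p2)
  moreover have "norm (\<psi> z) \<le> 21 * \<rho>" if z: "norm z = 1" for z
  proof -
    have "norm (\<psi> z) \<le> norm (fejer_mean N t z) + (norm (\<psi>1 (inverse z)) + norm (\<psi>2 z))"
      unfolding \<psi>_def
      by (rule order_trans[OF norm_triangle_ineq] add_left_mono order_trans[OF norm_triangle_ineq])+
        (simp add: norm_mult norm_power_int norm_power z)
    also have "\<dots> \<le> \<rho> + (10 * \<rho> + 10 * \<rho>)"
      by (intro add_mono low p1 p2 z) (simp add: norm_inverse z)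
    finally show ?thesis by simp
  qed
  moreover have "fourier \<psi> k = t k" if k: "\<bar>k\<bar> < int N" for k
  proof -
    have "fourier \<psi> k = fourier (fejer_mean N t) k + (fourier \<psi>1 (int N - k) + fourier \<psi>2 (k + int N))"
    proof -
      have T: "trig (fejer_mean N t)" "trig (\<lambda>z. z powi int N * \<psi>1 (inverse z))" "trig (\<lambda>z. z powi - int N * \<psi>2 z)"
        by (intro trig_fejer_mean trig_shift trig_reflect p1 p2)+
      show ?thesis
        unfolding \<psi>_def[abs_def] fourier_add[OF trig_continuous[OF T(1)] trig_continuous[OF trig_add[OF T(2,3)]]]
          fourier_add[OF trig_continuous[OF T(2)] trig_continuous[OF T(3)]] fourier_shift
          fourier_trig_reflect[OF p1(1)] by simp
    qed
    also have "fourier \<psi>1 (int N - k) = of_real (tent N (int N - k)) * t k"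
    proof -
      define m where "m = nat (int N - k - 1)"
      have "int (Suc m) = int N - k" "int N - 1 - int m = k" "m < 2 * N - 1" using k by (auto simp: m_def)
      with p1(3)[of m] show ?thesis by (simp only:)
    qed
    also have "fourier \<psi>2 (k + int N) = of_real (tent N (k + int N)) * t k"
    proof -
      define m where "m = nat (k + int N - 1)"
      have "int (Suc m) = k + int N" "int m + 1 - int N = k" "m < 2 * N - 1" using k by (auto simp: m_def)
      with p2(3)[of m] show ?thesis by (simp only:)
    qed
    also have "fourier (fejer_mean N t) k = of_real (tent N k) * t k"
      by (rule fourier_fejer_mean[OF N])
    also have "of_real (tent N k) * t k + (of_real (tent N (int N - k)) * t k + of_real (tent N (k + int N)) * t k) =
       of_real (tent N k + tent N (int N - k) + tent N (k + int N)) * t k"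
      by (simp add: algebra_simps)
    also have "tent N k + tent N (int N - k) + tent N (k + int N) = 1"
      using k N by (cases "k \<ge> 0") (auto simp: tent_def max_def field_simps)
    finally show ?thesis by simp
  qed
  ultimately show ?thesis by blast
qed

section \<open>Boundary values of Hardy functions\<close>

lemma measurable_L2: "f \<in> L2 \<Longrightarrow> f \<in> borel_measurable circle_measure"
  by (simp add: L2_def)

lemma integrable_norm_sq_L2: "f \<in> L2 \<Longrightarrow> integrable circle_measure (\<lambda>z. (norm (f z))\<^sup>2)"
  by (simp add: L2_def)

lemma L2_continuous: "continuous_on (sphere 0 1) f \<Longrightarrow> f \<in> L2"
  unfolding L2_def
  by (auto intro!: borel_measurable_circle_continuous integrable_circle_continuous continuous_intros)

lemma integrable_mult_L2:
  assumes "f \<in> L2" "g \<in> L2"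
  shows "integrable circle_measure (\<lambda>z. f z * g z)"
proof (rule Bochner_Integration.integrable_bound)
  show "integrable circle_measure (\<lambda>z. (norm (f z))\<^sup>2 + (norm (g z))\<^sup>2)"
    using assms by (intro Bochner_Integration.integrable_add integrable_norm_sq_L2)
  show "(\<lambda>z. f z * g z) \<in> borel_measurable circle_measure"
    using assms by (intro borel_measurable_times measurable_L2)
  show "AE z in circle_measure. norm (f z * g z) \<le> norm ((norm (f z))\<^sup>2 + (norm (g z))\<^sup>2)"
  proof (rule AE_I2)
    fix z
    have "2 * (norm (f z) * norm (g z)) \<le> (norm (f z))\<^sup>2 + (norm (g z))\<^sup>2"
      using sum_squares_bound[of "norm (f z)" "norm (g z)"] by (simp add: mult.assoc)
    moreover have "0 \<le> norm (f z) * norm (g z)" by simp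
    ultimately have "norm (f z) * norm (g z) \<le> (norm (f z))\<^sup>2 + (norm (g z))\<^sup>2" by linarith
    then show "norm (f z * g z) \<le> norm ((norm (f z))\<^sup>2 + (norm (g z))\<^sup>2)" by (simp add: norm_mult)
  qed
qed

lemma L2_mult_continuous:
  assumes f: "f \<in> L2" and g: "continuous_on (sphere 0 1) g"
  shows "(\<lambda>z. f z * g z) \<in> L2"
proof -
  have "bounded (g ` sphere 0 1)"
    by (intro compact_imp_bounded compact_continuous_image g) auto
  then obtain B where B: "\<And>z. z \<in> sphere 0 1 \<Longrightarrow> norm (g z) \<le> B"
    unfolding bounded_iff by blast
  have m: "(\<lambda>z. f z * g z) \<in> borel_measurable circle_measure"
    by (intro borel_measurable_times measurable_L2 f borel_measurable_circle_continuous g)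
  moreover have "integrable circle_measure (\<lambda>z. (norm (f z * g z))\<^sup>2)"
  proof (rule Bochner_Integration.integrable_bound)
    show "integrable circle_measure (\<lambda>z. (norm (f z))\<^sup>2 * B\<^sup>2)"
      using integrable_norm_sq_L2[OF f] by simp
    show "(\<lambda>z. (norm (f z * g z))\<^sup>2) \<in> borel_measurable circle_measure"
      by (intro borel_measurable_power measurable_compose[OF m borel_measurable_norm])
    show "AE z in circle_measure. norm ((norm (f z * g z))\<^sup>2) \<le> norm ((norm (f z))\<^sup>2 * B\<^sup>2)"
      using B by (intro AE_I2)
        (auto simp: space_circle_measure norm_mult power_mult_distrib intro!: mult_left_mono power_mono)
  qed
  ultimately show ?thesis by (simp add: L2_def)
qed

lemma L2_diff:
  assumes "f \<in> L2" "g \<in> L2"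
  shows "(\<lambda>z. f z - g z) \<in> L2"
proof -
  have m: "(\<lambda>z. f z - g z) \<in> borel_measurable circle_measure"
    using assms by (intro borel_measurable_diff measurable_L2)
  moreover have "integrable circle_measure (\<lambda>z. (norm (f z - g z))\<^sup>2)"
  proof (rule Bochner_Integration.integrable_bound)
    show "integrable circle_measure (\<lambda>z. 2 * ((norm (f z))\<^sup>2 + (norm (g z))\<^sup>2))"
      using assms by (intro integrable_mult_right Bochner_Integration.integrable_add integrable_norm_sq_L2)
    show "(\<lambda>z. (norm (f z - g z))\<^sup>2) \<in> borel_measurable circle_measure"
      by (intro borel_measurable_power measurable_compose[OF m borel_measurable_norm])
    show "AE z in circle_measure. norm ((norm (f z - g z))\<^sup>2) \<le> norm (2 * ((norm (f z))\<^sup>2 + (norm (g z))\<^sup>2))"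
    proof (rule AE_I2)
      fix z
      have "(norm (f z - g z))\<^sup>2 \<le> (norm (f z) + norm (g z))\<^sup>2"
        by (intro power_mono norm_triangle_ineq4) auto
      also have "\<dots> \<le> 2 * ((norm (f z))\<^sup>2 + (norm (g z))\<^sup>2)"
        using sum_squares_bound[of "norm (f z)" "norm (g z)"] by (simp add: power2_sum)
      finally show "norm ((norm (f z - g z))\<^sup>2) \<le> norm (2 * ((norm (f z))\<^sup>2 + (norm (g z))\<^sup>2))" by simp
    qed
  qed
  ultimately show ?thesis by (simp add: L2_def)
qed

lemma integrable_L2: "f \<in> L2 \<Longrightarrow> integrable circle_measure f"
  using integrable_mult_L2[of f "\<lambda>_. 1"] by (simp add: L2_continuous)

lemma L2_norm_sq: "(L2_norm f)\<^sup>2 = (LINT z|circle_measure. (norm (f z))\<^sup>2)"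
  by (simp add: L2_norm_def)

text \<open>
  Boundedness in \<open>L2\<close> gives uniform integrability: \<open>y \<le> min y M + y\<^sup>2 / M\<close> for \<open>y \<ge> 0\<close> and \<open>M > 0\<close>. The
  first summand is handled by dominated convergence, the integral of the second one is at most a
  constant divided by \<open>M\<close>.
\<close>

lemma L2_bounded_AE_imp_L1_tendsto:
  assumes X: "\<And>n. X n \<in> L2" and x: "x \<in> L2" and B: "\<And>n. (LINT z|circle_measure. (norm (X n z))\<^sup>2) \<le> B"
    and conv: "AE z in circle_measure. (\<lambda>n. X n z) \<longlonglongrightarrow> x z"
  shows "(\<lambda>n. LINT z|circle_measure. norm (X n z - x z)) \<longlonglongrightarrow> 0"
proof -
  define Y where "Y n z = norm (X n z - x z)" for n z
  define B' where "B' = 2 * (B + (LINT z|circle_measure. (norm (x z))\<^sup>2))"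
  have D: "(\<lambda>z. X n z - x z) \<in> L2" for n by (intro L2_diff X x)
  have Ym: "Y n \<in> borel_measurable circle_measure" for n
    unfolding Y_def[abs_def] by (rule measurable_compose[OF measurable_L2[OF D] borel_measurable_norm])
  have Yi: "integrable circle_measure (Y n)" for n
    unfolding Y_def[abs_def] using integrable_L2[OF D] by (intro integrable_norm)
  have Y2i: "integrable circle_measure (\<lambda>z. (Y n z)\<^sup>2)" for n
    unfolding Y_def using integrable_norm_sq_L2[OF D] .
  have Y2: "(LINT z|circle_measure. (Y n z)\<^sup>2) \<le> B'" for n
  proof -
    have "(LINT z|circle_measure. (Y n z)\<^sup>2) \<le> (LINT z|circle_measure. 2 * ((norm (X n z))\<^sup>2 + (norm (x z))\<^sup>2))"
    proof (intro integral_mono Y2i integrable_mult_right Bochner_Integration.integrable_add integrable_norm_sq_L2 X x)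
      fix z
      have "(Y n z)\<^sup>2 \<le> (norm (X n z) + norm (x z))\<^sup>2"
        unfolding Y_def by (intro power_mono norm_triangle_ineq4) auto
      also have "\<dots> \<le> 2 * ((norm (X n z))\<^sup>2 + (norm (x z))\<^sup>2)"
        using sum_squares_bound[of "norm (X n z)" "norm (x z)"] by (simp add: power2_sum)
      finally show "(Y n z)\<^sup>2 \<le> 2 * ((norm (X n z))\<^sup>2 + (norm (x z))\<^sup>2)" .
    qed
    also have "\<dots> \<le> B'"
      using B[of n] X[of n] x by (simp add: B'_def integrable_norm_sq_L2)
    finally show ?thesis .
  qed
  have "0 \<le> B'" 
    by (rule order_trans[OF Bochner_Integration.integral_nonneg Y2[of 0]]) simp
  have trunc: "(\<lambda>n. LINT z|circle_measure. min (Y n z) M) \<longlonglongrightarrow> 0" if "M > 0" for M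
  proof -
    have "(\<lambda>n. LINT z|circle_measure. min (Y n z) M) \<longlonglongrightarrow> (LINT z|circle_measure. (0::real))"
    proof (rule integral_dominated_convergence[where w="\<lambda>_. M"])
      show "AE z in circle_measure. (\<lambda>n. min (Y n z) M) \<longlonglongrightarrow> 0"
        using conv
      proof eventually_elim
        case (elim z)
        then have "(\<lambda>n. Y n z) \<longlonglongrightarrow> 0" unfolding Y_def
          by (intro tendsto_norm_zero) (simp add: LIM_zero_iff)
        from tendsto_min[OF this tendsto_const[of M]] show ?case using that by (simp add: min_def)
      qed
      show "AE z in circle_measure. norm (min (Y n z) M) \<le> M" for n
        using that by (auto simp: Y_def)
    qed (use Ym in auto)
    then show ?thesis by simp
  qed
  have "(\<lambda>n. LINT z|circle_measure. Y n z) \<longlonglongrightarrow> 0"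
  proof (rule LIMSEQ_I)
    fix e :: real assume e: "e > 0"
    \<comment> \<open>Chosen so that \<open>B' / M < e / 2\<close>.\<close>
    define M where "M = 2 * (B' + 1) / e"
    have M: "M > 0" "B' / M < e / 2" using e \<open>0 \<le> B'\<close> by (auto simp: M_def field_simps)
    obtain n0 where n0: "\<And>n. n \<ge> n0 \<Longrightarrow> \<bar>LINT z|circle_measure. min (Y n z) M\<bar> < e / 2"
      using LIMSEQ_D[OF trunc[OF M(1)], of "e / 2"] e by auto
    have "norm ((LINT z|circle_measure. Y n z) - 0) < e" if "n \<ge> n0" for n
    proof -
      have mi: "integrable circle_measure (\<lambda>z. min (Y n z) M)"
        by (intro integrable_min Yi) simp
      have "(LINT z|circle_measure. Y n z) \<le> (LINT z|circle_measure. min (Y n z) M + (Y n z)\<^sup>2 / M)"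
      proof (intro integral_mono Yi Bochner_Integration.integrable_add mi)
        show "integrable circle_measure (\<lambda>z. (Y n z)\<^sup>2 / M)" using Y2i by simp
        fix z
        have "Y n z \<ge> 0" by (simp add: Y_def)
        show "Y n z \<le> min (Y n z) M + (Y n z)\<^sup>2 / M"
        proof (cases "Y n z \<le> M")
          case False
          then have "Y n z * M \<le> (Y n z)\<^sup>2" using M \<open>Y n z \<ge> 0\<close> by (simp add: power2_eq_square mult_left_mono)
          then have "Y n z \<le> (Y n z)\<^sup>2 / M" using M by (simp add: pos_le_divide_eq)
          then show ?thesis using M False by (simp add: min_def)
        qed (use M in auto)
      qed
      also have "\<dots> = (LINT z|circle_measure. min (Y n z) M) + (LINT z|circle_measure. (Y n z)\<^sup>2) / M"
        using mi Y2i by simp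
      also have "\<dots> \<le> (LINT z|circle_measure. min (Y n z) M) + B' / M"
        using Y2 M by (simp add: divide_right_mono)
      also have "\<dots> < e" using n0[OF that] M(2) by linarith
      finally show ?thesis using Bochner_Integration.integral_nonneg[of circle_measure "Y n"] by (simp add: Y_def)
    qed
    then show "\<exists>no. \<forall>n\<ge>no. norm ((LINT z|circle_measure. Y n z) - 0) < e" by blast
  qed
  then show ?thesis by (simp add: Y_def)
qed

definition hardy_extension :: "(complex \<Rightarrow> complex) \<Rightarrow> (complex \<Rightarrow> complex) \<Rightarrow> bool" where
  "hardy_extension F f \<longleftrightarrow> F holomorphic_on ball 0 1 \<and>
    (\<exists>B. \<forall>r\<in>{0..<1::real}. (LINT z|circle_measure. (norm (F (of_real r * z)))\<^sup>2) \<le> B) \<and>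
    has_boundary_values F f"

lemma H2_iff: "f \<in> H2 \<longleftrightarrow> f \<in> L2 \<and> (\<exists>F. hardy_extension F f)"
  by (auto simp: H2_def hardy_extension_def)

text \<open>
  The formula holds for the dilates of \<open>F\<close>, which are continuous up to the circle, and it passes to the
  limit since these converge to \<open>f\<close> in \<open>L1\<close>. With the Szego kernel it recovers \<open>F\<close> from \<open>f\<close>; with \<open>w = 0\<close>
  and \<open>K 0 = 0\<close> it shows that \<open>f\<close> is orthogonal to the conjugate of \<open>K\<close>.
\<close>

lemma H2_Cauchy_formula:
  assumes f: "f \<in> L2" and F: "hardy_extension F f"
    and K: "continuous_on (cball 0 1) K" "K holomorphic_on ball 0 1" and w: "norm w < 1"
  shows "(LINT z|circle_measure. f z * (K z * (z / (z - w)))) = F w * K w"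
proof -
  define r where "r n = 1 - inverse (of_nat (Suc n) + 1 :: real)" for n
  have r: "0 \<le> r n" "r n < 1" for n by (auto simp: r_def field_simps)
  have r_lim: "r \<longlonglongrightarrow> 1"
  proof -
    have "(\<lambda>n. 1 - inverse (real (Suc (Suc n)))) \<longlonglongrightarrow> 1 - 0"
      using LIMSEQ_inverse_real_of_nat
      by (intro tendsto_diff tendsto_const) (rule LIMSEQ_Suc)
    then show ?thesis by (simp add: r_def[abs_def] add.commute)
  qed
  have r_left: "filterlim r (at_left 1) sequentially"
    unfolding filterlim_at using r r_lim by (auto simp: eventually_sequentially order_less_imp_not_eq)
  have hol: "F holomorphic_on ball 0 1" using F by (simp add: hardy_extension_def)
  have Fr: "continuous_on (cball 0 1) (\<lambda>z. F (of_real (r n) * z))" "(\<lambda>z. F (of_real (r n) * z)) holomorphic_on ball 0 1" for n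
  proof -
    have in_ball: "of_real (r n) * z \<in> ball 0 1" if "norm z \<le> 1" for z :: complex
    proof -
      have "norm (of_real (r n) * z) \<le> r n * 1"
        unfolding norm_mult using r[of n] that by (intro mult_mono) auto
      then show ?thesis using r(2)[of n] by simp
    qed
    show "continuous_on (cball 0 1) (\<lambda>z. F (of_real (r n) * z))"
      by (rule continuous_on_compose2[OF holomorphic_on_imp_continuous_on[OF hol]])
        (use in_ball in \<open>auto intro!: continuous_intros simp del: mem_ball_0 simp: subset_iff\<close>)
    show "(\<lambda>z. F (of_real (r n) * z)) holomorphic_on ball 0 1"
      using holomorphic_on_compose_gen[of "\<lambda>z. of_real (r n) * z" "ball 0 1" F "ball 0 1"] hol in_ball
      by (auto simp: o_def image_subset_iff intro!: holomorphic_intros)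
  qed
  define k where "k z = K z * (z / (z - w))" for z
  have ck: "continuous_on (sphere 0 1) k"
    unfolding k_def[abs_def] using w by (intro continuous_intros continuous_on_subset[OF K(1)]) auto
  have "bounded (k ` sphere 0 1)"
    by (intro compact_imp_bounded compact_continuous_image ck) auto
  then obtain C where C: "\<And>z. z \<in> sphere 0 1 \<Longrightarrow> norm (k z) \<le> C"
    unfolding bounded_iff by blast
  have cF: "continuous_on (sphere 0 1) (\<lambda>z. F (of_real (r n) * z))" for n
    by (rule continuous_on_subset[OF Fr(1)]) auto
  obtain B where B: "\<And>r. r \<in> {0..<1::real} \<Longrightarrow> (LINT z|circle_measure. (norm (F (of_real r * z)))\<^sup>2) \<le> B"
    using F unfolding hardy_extension_def by blast
  have L1: "(\<lambda>n. LINT z|circle_measure. norm (F (of_real (r n) * z) - f z)) \<longlonglongrightarrow> 0"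
  proof (rule L2_bounded_AE_imp_L1_tendsto[OF L2_continuous[OF cF] f])
    show "(LINT z|circle_measure. (norm (F (of_real (r n) * z)))\<^sup>2) \<le> B" for n
      using B r by auto
    have "AE z in circle_measure. ((\<lambda>r::real. F (of_real r * z)) \<longlongrightarrow> f z) (at_left 1)"
      using F by (simp add: hardy_extension_def has_boundary_values_def)
    then show "AE z in circle_measure. (\<lambda>n. F (complex_of_real (r n) * z)) \<longlonglongrightarrow> f z"
      by eventually_elim (rule filterlim_compose[OF _ r_left])
  qed
  have "(\<lambda>n. (LINT z|circle_measure. F (of_real (r n) * z) * k z) - (LINT z|circle_measure. f z * k z)) \<longlonglongrightarrow> 0"
  proof (rule Lim_null_comparison)
    show "(\<lambda>n. C * (LINT z|circle_measure. norm (F (of_real (r n) * z) - f z))) \<longlonglongrightarrow> 0"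
      using tendsto_mult_left[OF L1, of C] by simp
    have "norm ((LINT z|circle_measure. F (of_real (r n) * z) * k z) - (LINT z|circle_measure. f z * k z))
       \<le> C * (LINT z|circle_measure. norm (F (of_real (r n) * z) - f z))" for n
    proof -
      have D: "(\<lambda>z. F (of_real (r n) * z) - f z) \<in> L2" by (intro L2_diff L2_continuous cF f)
      have "(LINT z|circle_measure. F (of_real (r n) * z) * k z) - (LINT z|circle_measure. f z * k z) =
         (LINT z|circle_measure. (F (of_real (r n) * z) - f z) * k z)"
        unfolding left_diff_distrib
        by (intro Bochner_Integration.integral_diff[symmetric] integrable_mult_L2 L2_continuous cF f ck)
      also have "norm \<dots> \<le> (LINT z|circle_measure. norm ((F (of_real (r n) * z) - f z) * k z))"
        by (rule integral_norm_bound)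
      also have "\<dots> \<le> (LINT z|circle_measure. C * norm (F (of_real (r n) * z) - f z))"
        using C
        by (intro integral_mono integrable_norm integrable_mult_right integrable_mult_L2 D L2_continuous ck integrable_L2)
          (auto simp: norm_mult space_circle_measure mult.commute[of C] intro!: mult_left_mono)
      finally show ?thesis by simp
    qed
    then show "\<forall>\<^sub>F n in sequentially. norm ((LINT z|circle_measure. F (of_real (r n) * z) * k z) - (LINT z|circle_measure. f z * k z))
       \<le> C * (LINT z|circle_measure. norm (F (of_real (r n) * z) - f z))" by (intro always_eventually allI)
  qed
  then have 1: "(\<lambda>n. (LINT z|circle_measure. F (of_real (r n) * z) * k z)) \<longlonglongrightarrow> (LINT z|circle_measure. f z * k z)"
    by (simp add: LIM_zero_iff)
  have "(LINT z|circle_measure. F (of_real (r n) * z) * k z) = F (of_real (r n) * w) * K w" for n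
    using integral_circle_Cauchy[of "\<lambda>z. F (of_real (r n) * z) * K z" w] Fr[of n] K w
    by (simp add: k_def mult.assoc continuous_on_mult holomorphic_on_mult)
  with 1 have 1: "(\<lambda>n. F (of_real (r n) * w) * K w) \<longlonglongrightarrow> (LINT z|circle_measure. f z * k z)" by simp
  have "isCont F w"
    using holomorphic_on_imp_continuous_on[OF hol] w by (simp add: continuous_on_eq_continuous_at)
  moreover have "(\<lambda>n. of_real (r n) * w) \<longlonglongrightarrow> of_real 1 * w"
    by (intro tendsto_intros r_lim)
  ultimately have "(\<lambda>n. F (of_real (r n) * w)) \<longlonglongrightarrow> F w"
    by (intro isCont_tendsto_compose[of _ F]) auto
  then have "(\<lambda>n. F (of_real (r n) * w) * K w) \<longlonglongrightarrow> F w * K w" by (intro tendsto_intros)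
  with 1 show ?thesis unfolding k_def by (rule LIMSEQ_unique)
qed

lemma hardy_extension_disc_algebra:
  assumes c: "continuous_on (cball 0 1) F" and h: "F holomorphic_on ball 0 1"
  shows "hardy_extension F F"
  unfolding hardy_extension_def
proof (intro conjI h)
  have in_cball: "of_real r * z \<in> cball 0 1" if "norm z = 1" "0 \<le> r" "r \<le> 1" for r and z :: complex
    using that by (simp add: norm_mult)
  have "bounded (F ` cball 0 1)"
    by (intro compact_imp_bounded compact_continuous_image c) auto
  then obtain C where C: "\<And>z. z \<in> cball 0 1 \<Longrightarrow> norm (F z) \<le> C"
    unfolding bounded_iff by blast
  have "(LINT z|circle_measure. (norm (F (of_real r * z)))\<^sup>2) \<le> C\<^sup>2" if r: "r \<in> {0..<1::real}" for r
  proof -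
    have "(LINT z|circle_measure. (norm (F (of_real r * z)))\<^sup>2) \<le> (LINT z|circle_measure. C\<^sup>2)"
    proof (intro integral_mono integrable_circle_continuous continuous_intros)
      show "continuous_on (sphere 0 1) (\<lambda>z. F (of_real r * z))"
        by (rule continuous_on_compose2[OF c]) (use r in_cball in \<open>auto intro!: continuous_intros\<close>)
    qed (use C r in_cball in \<open>auto simp: space_circle_measure intro!: power_mono\<close>)
    then show ?thesis by (simp add: circle.prob_space)
  qed
  then show "\<exists>B. \<forall>r\<in>{0..<1}. (LINT z|circle_measure. (norm (F (of_real r * z)))\<^sup>2) \<le> B" by blast
  show "has_boundary_values F F"
    unfolding has_boundary_values_def
  proof (rule AE_I2)
    fix z assume "z \<in> space circle_measure"
    then have z: "norm z = 1" by (simp add: space_circle_measure)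
    have "continuous_on {0..1} (\<lambda>r::real. F (of_real r * z))"
      by (rule continuous_on_compose2[OF c]) (use z in_cball in \<open>auto intro!: continuous_intros\<close>)
    then have "((\<lambda>r::real. F (of_real r * z)) \<longlongrightarrow> F (of_real 1 * z)) (at 1 within {0..1})"
      unfolding continuous_on_def by (rule bspec) simp
    then show "((\<lambda>r::real. F (of_real r * z)) \<longlongrightarrow> F z) (at_left 1)"
      by (simp add: at_within_Icc_at_left)
  qed
qed

lemma H2_disc_algebra:
  "continuous_on (cball 0 1) F \<Longrightarrow> F holomorphic_on ball 0 1 \<Longrightarrow> F \<in> H2"
  unfolding H2_iff
  by (auto intro!: L2_continuous hardy_extension_disc_algebra intro: continuous_on_subset[of "cball 0 1"])

section \<open>Blaschke factors and an orthonormal system\<close>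

lemma one_minus_cnj_mult_nz: "norm w < 1 \<Longrightarrow> norm z \<le> 1 \<Longrightarrow> 1 - cnj w * z \<noteq> 0"
proof
  assume *: "norm w < 1" "norm z \<le> 1" "1 - cnj w * z = 0"
  have "norm w * norm z < 1"
  proof (cases "norm z = 0")
    case False
    then have "norm w * norm z < 1 * norm z" using * by (intro mult_strict_right_mono) auto
    with * show ?thesis by simp
  qed auto
  moreover have "norm (cnj w * z) = 1" using * by (metis eq_iff_diff_eq_0 norm_one)
  ultimately show False by (simp add: norm_mult)
qed

text \<open>
  This identity carries the rest of the section: on the diagonal it computes \<open>1 - \<bar>b\<bar>\<^sup>2\<close>, and off the
  diagonal it sums the kernel of the model space.
\<close>

lemma blaschke_kernel:
  assumes "norm \<alpha> < 1" "norm w \<le> 1" "norm z \<le> 1"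
  shows "1 - cnj (blaschke \<alpha> w) * blaschke \<alpha> z =
    (1 - of_real ((norm \<alpha>)\<^sup>2)) * (1 - cnj w * z) / (cnj (1 - cnj \<alpha> * w) * (1 - cnj \<alpha> * z))"
proof -
  have nz: "1 - cnj \<alpha> * w \<noteq> 0" "1 - cnj \<alpha> * z \<noteq> 0"
    using assms by (intro one_minus_cnj_mult_nz; simp)+
  then have "cnj (1 - cnj \<alpha> * w) \<noteq> 0" by (simp only: complex_cnj_zero_iff not_False_eq_True)
  then have nz': "1 - \<alpha> * cnj w \<noteq> 0" by simp
  show ?thesis using nz(2) nz'
    unfolding blaschke_def complex_norm_square by (simp add: divide_simps) (simp add: algebra_simps)
qed

lemma one_minus_norm_blaschke_sq:
  assumes "norm \<alpha> < 1" "norm w \<le> 1"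
  shows "1 - (norm (blaschke \<alpha> w))\<^sup>2 = (1 - (norm \<alpha>)\<^sup>2) * (1 - (norm w)\<^sup>2) / (norm (1 - cnj \<alpha> * w))\<^sup>2"
proof -
  have "complex_of_real (1 - (norm (blaschke \<alpha> w))\<^sup>2) =
     of_real ((1 - (norm \<alpha>)\<^sup>2) * (1 - (norm w)\<^sup>2) / (norm (1 - cnj \<alpha> * w))\<^sup>2)"
    using blaschke_kernel[OF assms(1,2,2)]
    unfolding of_real_diff of_real_mult of_real_divide complex_norm_square by (simp add: mult.commute)
  then show ?thesis by (simp only: of_real_eq_iff)
qed

lemma norm_blaschke_circle:
  assumes "norm \<alpha> < 1" "norm z = 1"
  shows "norm (blaschke \<alpha> z) = 1"
  using one_minus_norm_blaschke_sq[of \<alpha> z] assms norm_ge_zero[of "blaschke \<alpha> z"]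
  by (auto simp: power2_eq_1_iff simp del: norm_ge_zero)

lemma norm_blaschke_less:
  assumes "norm \<alpha> < 1" "norm z < 1"
  shows "norm (blaschke \<alpha> z) < 1"
proof -
  have "1 - (norm (blaschke \<alpha> z))\<^sup>2 > 0"
    unfolding one_minus_norm_blaschke_sq[OF assms(1) less_imp_le[OF assms(2)]]
    using assms one_minus_cnj_mult_nz[of \<alpha> z] by (simp add: power_less_one_iff abs_square_less_1)
  then show ?thesis by (simp add: abs_square_less_1)
qed

lemma blaschke_involution:
  assumes "norm \<alpha> < 1" "norm z \<le> 1"
  shows "blaschke \<alpha> (blaschke \<alpha> z) = z"
proof -
  have nz: "1 - cnj \<alpha> * z \<noteq> 0" "1 - cnj \<alpha> * \<alpha> \<noteq> 0"
    using assms by (intro one_minus_cnj_mult_nz; simp)+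
  have "1 - cnj \<alpha> * blaschke \<alpha> z = (1 - cnj \<alpha> * \<alpha>) / (1 - cnj \<alpha> * z)"
    "\<alpha> - blaschke \<alpha> z = z * (1 - cnj \<alpha> * \<alpha>) / (1 - cnj \<alpha> * z)"
    using nz(1) by (simp_all add: blaschke_def divide_simps) (simp_all add: algebra_simps)
  then show ?thesis using nz by (simp add: blaschke_def[of \<alpha> "blaschke \<alpha> z"])
qed

text \<open>
  The Takenaka-Malmquist basis for a Blaschke product with the single zero \<open>\<alpha>\<close>, repeated \<open>N\<close> times.
\<close>

definition tm_basis :: "complex \<Rightarrow> nat \<Rightarrow> complex \<Rightarrow> complex" where
  "tm_basis \<alpha> j z = of_real (sqrt (1 - (norm \<alpha>)\<^sup>2)) / (1 - cnj \<alpha> * z) * blaschke \<alpha> z ^ j"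

lemma continuous_on_blaschke:
  "norm \<alpha> < 1 \<Longrightarrow> continuous_on (cball 0 1) (blaschke \<alpha>)"
  unfolding blaschke_def[abs_def]
  by (intro continuous_intros ballI one_minus_cnj_mult_nz) auto

lemma holomorphic_on_blaschke:
  "norm \<alpha> < 1 \<Longrightarrow> blaschke \<alpha> holomorphic_on ball 0 1"
  unfolding blaschke_def[abs_def]
  by (intro holomorphic_intros one_minus_cnj_mult_nz) auto

lemma continuous_on_tm_basis:
  "norm \<alpha> < 1 \<Longrightarrow> continuous_on (cball 0 1) (tm_basis \<alpha> j)"
  unfolding tm_basis_def[abs_def]
  by (intro continuous_intros ballI one_minus_cnj_mult_nz continuous_on_blaschke) auto

lemma holomorphic_on_tm_basis:
  "norm \<alpha> < 1 \<Longrightarrow> tm_basis \<alpha> j holomorphic_on ball 0 1"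
  unfolding tm_basis_def[abs_def]
  by (intro holomorphic_intros one_minus_cnj_mult_nz holomorphic_on_blaschke) auto

lemma sqrt_one_minus_norm_sq:
  "norm \<alpha> < 1 \<Longrightarrow> complex_of_real (sqrt (1 - (norm \<alpha>)\<^sup>2)) * of_real (sqrt (1 - (norm \<alpha>)\<^sup>2)) = 1 - of_real ((norm \<alpha>)\<^sup>2)"
  by (simp add: of_real_mult[symmetric] abs_square_less_1 less_imp_le del: of_real_mult of_real_power)

lemma tm_basis_kernel:
  assumes "norm \<alpha> < 1" "norm w < 1" "norm z \<le> 1"
  shows "(\<Sum>j<N. cnj (tm_basis \<alpha> j w) * tm_basis \<alpha> j z) =
    (1 - cnj (blaschke \<alpha> w ^ N) * blaschke \<alpha> z ^ N) / (1 - cnj w * z)"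
proof -
  let ?x = "cnj (blaschke \<alpha> w) * blaschke \<alpha> z"
  let ?c = "(1 - of_real ((norm \<alpha>)\<^sup>2)) / (cnj (1 - cnj \<alpha> * w) * (1 - cnj \<alpha> * z)) :: complex"
  have nz: "1 - cnj w * z \<noteq> 0" using assms by (intro one_minus_cnj_mult_nz) auto
  have "(\<Sum>j<N. cnj (tm_basis \<alpha> j w) * tm_basis \<alpha> j z) = ?c * (\<Sum>j<N. ?x ^ j)"
    unfolding sum_distrib_left tm_basis_def sqrt_one_minus_norm_sq[OF assms(1), symmetric]
    by (intro sum.cong refl) (simp add: power_mult_distrib)
  also have "\<dots> = (1 - ?x) / (1 - cnj w * z) * (\<Sum>j<N. ?x ^ j)"
    using nz assms by (subst blaschke_kernel) auto
  also have "\<dots> = (1 - ?x ^ N) / (1 - cnj w * z)"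
    by (simp add: one_diff_power_eq)
  finally show ?thesis by (simp add: power_mult_distrib)
qed

text \<open>
  The difference quotient has the same coordinates as the kernel up to order, sign and conjugation:
  this reflects the conjugation of the model space, which interchanges the two functions.
\<close>

lemma tm_basis_diff_quot:
  assumes "norm \<alpha> < 1" "norm w < 1" "norm z \<le> 1" "z \<noteq> w"
  shows "(\<Sum>j<N. tm_basis \<alpha> (N - 1 - j) w * tm_basis \<alpha> j z) =
    - ((blaschke \<alpha> z ^ N - blaschke \<alpha> w ^ N) / (z - w))"
proof -
  let ?c = "(1 - of_real ((norm \<alpha>)\<^sup>2)) / ((1 - cnj \<alpha> * w) * (1 - cnj \<alpha> * z)) :: complex"
  have nz: "1 - cnj \<alpha> * w \<noteq> 0" "1 - cnj \<alpha> * z \<noteq> 0"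
    using assms by (intro one_minus_cnj_mult_nz; simp)+
  have zw: "z - w \<noteq> 0" using assms by simp
  have "blaschke \<alpha> z - blaschke \<alpha> w = - ?c * (z - w)"
    using nz unfolding blaschke_def complex_norm_square by (simp add: divide_simps) (simp add: algebra_simps)
  then have c: "?c = - ((blaschke \<alpha> z - blaschke \<alpha> w) / (z - w))" using zw by (simp add: field_simps)
  have "(\<Sum>j<N. tm_basis \<alpha> (N - 1 - j) w * tm_basis \<alpha> j z) =
      ?c * (\<Sum>j<N. blaschke \<alpha> w ^ (N - Suc j) * blaschke \<alpha> z ^ j)"
    unfolding sum_distrib_left tm_basis_def sqrt_one_minus_norm_sq[OF assms(1), symmetric]
    by (intro sum.cong refl) simp
  also have "\<dots> = - ((blaschke \<alpha> z - blaschke \<alpha> w) * (\<Sum>j<N. blaschke \<alpha> w ^ (N - Suc j) * blaschke \<alpha> z ^ j) / (z - w))"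
    unfolding c by simp
  also have "(blaschke \<alpha> z - blaschke \<alpha> w) * (\<Sum>j<N. blaschke \<alpha> w ^ (N - Suc j) * blaschke \<alpha> z ^ j) =
      blaschke \<alpha> z ^ N - blaschke \<alpha> w ^ N"
    by (rule power_diff_sumr2[symmetric])
  finally show ?thesis .
qed

text \<open>
  On the circle this is the Poisson kernel at \<open>\<alpha>\<close>, the density of the image of arc length under
  \<open>blaschke \<alpha>\<close>.
\<close>

definition poisson :: "complex \<Rightarrow> complex \<Rightarrow> complex" where
  "poisson \<alpha> z = of_real ((norm (tm_basis \<alpha> 0 z))\<^sup>2)"

lemma continuous_on_poisson: "norm \<alpha> < 1 \<Longrightarrow> continuous_on (sphere 0 1) (poisson \<alpha>)"
  unfolding poisson_def[abs_def]
  by (intro continuous_intros continuous_on_subset[OF continuous_on_tm_basis]) auto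

lemma continuous_on_blaschke_power_int: "norm \<alpha> < 1 \<Longrightarrow> continuous_on (sphere 0 1) (\<lambda>z. blaschke \<alpha> z powi k)"
  by (rule continuous_on_compose2[OF continuous_on_circle_power_int])
    (auto intro: continuous_on_subset[OF continuous_on_blaschke] norm_blaschke_circle)

lemma tm_basis_mult_cnj:
  assumes "norm \<alpha> < 1" "norm z = 1"
  shows "tm_basis \<alpha> i z * cnj (tm_basis \<alpha> j z) = poisson \<alpha> z * blaschke \<alpha> z powi (int i - int j)"
proof -
  have *: "tm_basis \<alpha> n z = tm_basis \<alpha> 0 z * blaschke \<alpha> z ^ n" for n by (simp add: tm_basis_def)
  have "tm_basis \<alpha> i z * cnj (tm_basis \<alpha> j z) = (tm_basis \<alpha> 0 z * cnj (tm_basis \<alpha> 0 z)) *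
      (blaschke \<alpha> z ^ i * cnj (blaschke \<alpha> z ^ j))"
    unfolding *[of i] *[of j] by (simp add: mult_ac)
  then show ?thesis
    unfolding power_mult_cnj_power_on_circle[OF norm_blaschke_circle[OF assms]] poisson_def complex_norm_square .
qed

lemma cnj_one_minus_cnj_mult_on_circle:
  assumes "norm z = 1"
  shows "cnj (1 - cnj \<alpha> * z) = (z - \<alpha>) / z"
proof -
  have "z \<noteq> 0" using assms by auto
  then show ?thesis by (simp add: cnj_eq_inverse_on_circle[OF assms] field_simps)
qed

lemma integral_poisson_blaschke_power_int:
  assumes \<alpha>: "norm \<alpha> < 1"
  shows "(LINT z|circle_measure. poisson \<alpha> z * blaschke \<alpha> z powi k) = (if k = 0 then 1 else 0)"
proof -
  have nat: "(LINT z|circle_measure. poisson \<alpha> z * blaschke \<alpha> z ^ n) = (if n = 0 then 1 else 0)" for n :: nat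
  proof -
    define F where "F z = (1 - of_real ((norm \<alpha>)\<^sup>2)) / (1 - cnj \<alpha> * z) * blaschke \<alpha> z ^ n" for z
    have "(LINT z|circle_measure. poisson \<alpha> z * blaschke \<alpha> z ^ n) = (LINT z|circle_measure. F z * (z / (z - \<alpha>)))"
    proof (intro Bochner_Integration.integral_cong refl)
      fix z assume "z \<in> space circle_measure"
      then have z: "norm z = 1" by (simp add: space_circle_measure)
      have "poisson \<alpha> z = of_real (sqrt (1 - (norm \<alpha>)\<^sup>2)) * of_real (sqrt (1 - (norm \<alpha>)\<^sup>2)) /
          ((1 - cnj \<alpha> * z) * cnj (1 - cnj \<alpha> * z))"
        unfolding poisson_def complex_norm_square tm_basis_def by simp
      then show "poisson \<alpha> z * blaschke \<alpha> z ^ n = F z * (z / (z - \<alpha>))"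
        unfolding sqrt_one_minus_norm_sq[OF \<alpha>] cnj_one_minus_cnj_mult_on_circle[OF z] F_def by simp
    qed
    also have "\<dots> = F \<alpha>"
      by (rule integral_circle_Cauchy[OF _ _ \<alpha>]; unfold F_def[abs_def])
        (intro continuous_intros holomorphic_intros continuous_on_blaschke holomorphic_on_blaschke \<alpha> ballI
           one_minus_cnj_mult_nz; simp)+
    also have "\<dots> = (if n = 0 then 1 else 0)"
      using one_minus_cnj_mult_nz[OF \<alpha> less_imp_le[OF \<alpha>]]
      unfolding F_def complex_norm_square by (simp add: blaschke_def mult.commute)
    finally show ?thesis .
  qed
  show ?thesis
  proof (cases "k \<ge> 0")
    case True
    then show ?thesis using nat[of "nat k"] by (auto simp: power_int_def)
  next
    case False
    have "(LINT z|circle_measure. poisson \<alpha> z * blaschke \<alpha> z powi k) =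
        (LINT z|circle_measure. cnj (poisson \<alpha> z * blaschke \<alpha> z ^ nat (-k)))"
      using False by (intro Bochner_Integration.integral_cong)
        (auto simp: space_circle_measure power_int_def cnj_eq_inverse_on_circle[OF norm_blaschke_circle[OF \<alpha>]] poisson_def)
    also have "\<dots> = cnj (if nat (-k) = 0 then 1 else 0)"
      by (simp only: Bochner_Integration.integral_cnj nat)
    finally show ?thesis using False by auto
  qed
qed

text \<open>
  Change of variables under \<open>blaschke \<alpha>\<close>. For trigonometric polynomials it reduces to monomials, that
  is, to the fact that powers of \<open>blaschke \<alpha>\<close> are orthonormal with respect to the Poisson kernel.
\<close>

lemma integral_trig_compose_blaschke:
  assumes \<alpha>: "norm \<alpha> < 1"
  shows "trig \<psi> \<Longrightarrow> (LINT z|circle_measure. \<psi> (blaschke \<alpha> z) * (poisson \<alpha> z * blaschke \<alpha> z powi (- k))) = fourier \<psi> k"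
proof (induction rule: trig.induct)
  case (trig_monom c j)
  have "(LINT z|circle_measure. c * blaschke \<alpha> z powi j * (poisson \<alpha> z * blaschke \<alpha> z powi (- k))) =
     (LINT z|circle_measure. c * (poisson \<alpha> z * blaschke \<alpha> z powi (j - k)))"
  proof (intro Bochner_Integration.integral_cong refl)
    fix z assume "z \<in> space circle_measure"
    then have "blaschke \<alpha> z \<noteq> 0" using norm_blaschke_circle[OF \<alpha>, of z] by (auto simp: space_circle_measure)
    then show "c * blaschke \<alpha> z powi j * (poisson \<alpha> z * blaschke \<alpha> z powi (- k)) = c * (poisson \<alpha> z * blaschke \<alpha> z powi (j - k))"
      using power_int_add[of "blaschke \<alpha> z" j "-k"] by simp
  qed
  then show ?case by (auto simp: fourier_monom integral_poisson_blaschke_power_int[OF \<alpha>])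
next
  case (trig_add f g)
  have c: "continuous_on (sphere 0 1) (\<lambda>z. h (blaschke \<alpha> z) * (poisson \<alpha> z * blaschke \<alpha> z powi (- k)))" if "trig h" for h
    by (intro continuous_intros continuous_on_poisson continuous_on_blaschke_power_int \<alpha> continuous_on_compose2[OF trig_continuous[OF that]])
      (use norm_blaschke_circle[OF \<alpha>] in \<open>force intro: continuous_on_subset[OF continuous_on_blaschke[OF \<alpha>]]\<close>)+
  from trig_add show ?case
    unfolding distrib_right
    by (simp add: Bochner_Integration.integral_add[OF integrable_circle_continuous[OF c] integrable_circle_continuous[OF c]]
        fourier_add trig_continuous)
next
  case (trig_cong f g)
  have "(LINT z|circle_measure. g (blaschke \<alpha> z) * (poisson \<alpha> z * blaschke \<alpha> z powi (- k))) =
     (LINT z|circle_measure. f (blaschke \<alpha> z) * (poisson \<alpha> z * blaschke \<alpha> z powi (- k)))"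
    by (intro Bochner_Integration.integral_cong) (auto simp: space_circle_measure trig_cong norm_blaschke_circle[OF \<alpha>])
  with trig_cong show ?case using fourier_cong[of g f k] by simp
qed

section \<open>The model space of a power of a Blaschke factor\<close>

lemma continuous_on_tm_basis_circle:
  "norm \<alpha> < 1 \<Longrightarrow> continuous_on (sphere 0 1) (tm_basis \<alpha> j)"
  by (rule continuous_on_subset[OF continuous_on_tm_basis]) auto

lemma measurable_cnj: "cnj \<in> borel_measurable borel"
  by (intro borel_measurable_continuous_onI continuous_intros)

lemma L2_inner_cong_AE:
  assumes "f \<in> L2" "f' \<in> L2" "g \<in> L2" "g' \<in> L2"
    and "AE z in circle_measure. f z = f' z" "AE z in circle_measure. g z = g' z"
  shows "L2_inner f g = L2_inner f' g'"
  unfolding L2_inner_def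
proof (rule integral_cong_AE)
  show "AE z in circle_measure. f z * cnj (g z) = f' z * cnj (g' z)"
    using assms(5,6) by eventually_elim simp
qed (use assms in \<open>auto intro!: borel_measurable_times measurable_compose[OF _ measurable_cnj] dest: measurable_L2\<close>)

lemma L2_cnj: "f \<in> L2 \<Longrightarrow> (\<lambda>z. cnj (f z)) \<in> L2"
  by (auto simp: L2_def intro: measurable_compose[OF _ measurable_cnj])

lemma L2_cong_AE:
  assumes "f \<in> L2" "g \<in> borel_measurable circle_measure" "AE z in circle_measure. g z = f z"
  shows "g \<in> L2"
proof -
  have "integrable circle_measure (\<lambda>z. (norm (g z))\<^sup>2) \<longleftrightarrow> integrable circle_measure (\<lambda>z. (norm (f z))\<^sup>2)"
    using assms measurable_L2[OF assms(1)] by (intro integrable_cong_AE) auto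
  then show ?thesis using assms by (simp add: L2_def)
qed

lemma L2_inner_sum_left:
  assumes "\<And>j. j \<in> A \<Longrightarrow> f j \<in> L2" "g \<in> L2"
  shows "L2_inner (\<lambda>z. \<Sum>j\<in>A. c j * f j z) g = (\<Sum>j\<in>A. c j * L2_inner (f j) g)"
proof -
  have "L2_inner (\<lambda>z. \<Sum>j\<in>A. c j * f j z) g = (LINT z|circle_measure. (\<Sum>j\<in>A. c j * (f j z * cnj (g z))))"
    unfolding L2_inner_def sum_distrib_right by (simp add: mult.assoc)
  also have "\<dots> = (\<Sum>j\<in>A. c j * L2_inner (f j) g)"
    unfolding L2_inner_def
    by (subst Bochner_Integration.integral_sum) (auto intro!: integrable_mult_right integrable_mult_L2 L2_cnj assms)
  finally show ?thesis .
qed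

lemma L2_inner_commute: "L2_inner g f = cnj (L2_inner f g)"
  unfolding L2_inner_def by (simp add: Bochner_Integration.integral_cnj[symmetric] mult.commute del: Bochner_Integration.integral_cnj)

lemma L2_inner_diff_left:
  assumes "f \<in> L2" "f' \<in> L2" "g \<in> L2"
  shows "L2_inner (\<lambda>z. f z - f' z) g = L2_inner f g - L2_inner f' g"
  unfolding L2_inner_def left_diff_distrib
  by (intro Bochner_Integration.integral_diff integrable_mult_L2 L2_cnj assms)

lemma L2_inner_tm_basis:
  assumes "norm \<alpha> < 1"
  shows "L2_inner (tm_basis \<alpha> i) (tm_basis \<alpha> j) = (if i = j then 1 else 0)"
proof -
  have "L2_inner (tm_basis \<alpha> i) (tm_basis \<alpha> j) = (LINT z|circle_measure. poisson \<alpha> z * blaschke \<alpha> z powi (int i - int j))"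
    unfolding L2_inner_def
    by (intro Bochner_Integration.integral_cong) (auto simp: space_circle_measure tm_basis_mult_cnj[OF assms])
  then show ?thesis by (simp add: integral_poisson_blaschke_power_int[OF assms])
qed

text \<open>
  For \<open>j < N\<close>, on the circle, \<open>blaschke \<alpha> z ^ N * cnj (tm_basis \<alpha> j z)\<close> agrees with a function that is
  holomorphic in the disc and vanishes at \<open>0\<close>; this gives orthogonality to all multiples of
  \<open>blaschke \<alpha> ^ N\<close>.
\<close>

lemma tm_basis_sum_in_model_space:
  assumes \<alpha>: "norm \<alpha> < 1"
  shows "(\<lambda>z. \<Sum>j<N. c j * tm_basis \<alpha> j z) \<in> model_space (\<lambda>z. blaschke \<alpha> z ^ N)"
  unfolding model_space_def
proof (intro CollectI conjI ballI)
  show "(\<lambda>z. \<Sum>j<N. c j * tm_basis \<alpha> j z) \<in> H2"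
    by (intro H2_disc_algebra continuous_intros holomorphic_intros continuous_on_tm_basis holomorphic_on_tm_basis \<alpha>)
  fix h assume h: "h \<in> H2"
  then have hL2: "h \<in> L2" by (simp add: H2_iff)
  obtain H where H: "hardy_extension H h" using h by (auto simp: H2_iff)
  have cb: "continuous_on (sphere 0 1) (blaschke \<alpha>)"
    by (rule continuous_on_subset[OF continuous_on_blaschke[OF \<alpha>]]) auto
  have Th: "(\<lambda>z. blaschke \<alpha> z ^ N * h z) \<in> L2"
    using L2_mult_continuous[OF hL2, of "\<lambda>z. blaschke \<alpha> z ^ N"] cb by (simp add: continuous_on_power mult.commute)
  have orth: "L2_inner (tm_basis \<alpha> j) (\<lambda>z. blaschke \<alpha> z ^ N * h z) = 0" if j: "j < N" for j
  proof -
    define K where "K z = - (of_real (sqrt (1 - (norm \<alpha>)\<^sup>2)) * z / (1 - cnj \<alpha> * z) * blaschke \<alpha> z ^ (N - Suc j))" for z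
    have "L2_inner (\<lambda>z. blaschke \<alpha> z ^ N * h z) (tm_basis \<alpha> j) = (LINT z|circle_measure. h z * (K z * (z / (z - 0))))"
      unfolding L2_inner_def
    proof (intro Bochner_Integration.integral_cong refl)
      fix z assume "z \<in> space circle_measure"
      then have z: "norm z = 1" by (simp add: space_circle_measure)
      then have z0: "z \<noteq> 0" by auto
      have za: "z - \<alpha> \<noteq> 0" using \<alpha> z by auto
      have b: "blaschke \<alpha> z ^ Suc j * cnj (blaschke \<alpha> z ^ j) = blaschke \<alpha> z"
        using power_mult_cnj_power_on_circle[OF norm_blaschke_circle[OF \<alpha> z], of "Suc j" j] by simp
      \<comment> \<open>One factor \<open>blaschke \<alpha> z\<close> cancels the pole at \<open>\<alpha>\<close> of the conjugate of \<open>tm_basis \<alpha> 0\<close>.\<close>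
      have "blaschke \<alpha> z ^ N = blaschke \<alpha> z ^ (N - Suc j) * blaschke \<alpha> z ^ Suc j"
        unfolding power_add[symmetric] using j by simp
      then have "blaschke \<alpha> z ^ N * cnj (tm_basis \<alpha> j z) = blaschke \<alpha> z ^ (N - Suc j) *
         (blaschke \<alpha> z ^ Suc j * cnj (blaschke \<alpha> z ^ j)) * (of_real (sqrt (1 - (norm \<alpha>)\<^sup>2)) / cnj (1 - cnj \<alpha> * z))"
        by (simp only: tm_basis_def complex_cnj_mult complex_cnj_divide complex_cnj_complex_of_real mult_ac)
      also have "\<dots> = blaschke \<alpha> z ^ (N - Suc j) * (of_real (sqrt (1 - (norm \<alpha>)\<^sup>2)) * (blaschke \<alpha> z * z / (z - \<alpha>)))"
        unfolding b cnj_one_minus_cnj_mult_on_circle[OF z] by simp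
      also have "blaschke \<alpha> z * z / (z - \<alpha>) = - (z / (1 - cnj \<alpha> * z))"
      proof -
        have "(\<alpha> - z) / (z - \<alpha>) = -1" using za by (simp add: divide_eq_eq)
        moreover have "blaschke \<alpha> z * z / (z - \<alpha>) = ((\<alpha> - z) / (z - \<alpha>)) * (z / (1 - cnj \<alpha> * z))"
          by (simp add: blaschke_def)
        ultimately show ?thesis by simp
      qed
      finally have "blaschke \<alpha> z ^ N * cnj (tm_basis \<alpha> j z) = K z"
        by (simp add: K_def)
      then have "h z * (blaschke \<alpha> z ^ N * cnj (tm_basis \<alpha> j z)) = h z * K z" by simp
      then show "blaschke \<alpha> z ^ N * h z * cnj (tm_basis \<alpha> j z) = h z * (K z * (z / (z - 0)))"
        using z0 by (simp add: mult_ac)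
    qed
    also have "\<dots> = H 0 * K 0"
    proof (rule H2_Cauchy_formula[OF hL2 H])
      show "continuous_on (cball 0 1) K" "K holomorphic_on ball 0 1"
        unfolding K_def[abs_def]
        by (intro continuous_intros holomorphic_intros continuous_on_blaschke holomorphic_on_blaschke \<alpha> ballI
            one_minus_cnj_mult_nz; simp)+
    qed simp
    also have "\<dots> = 0" by (simp add: K_def)
    finally show ?thesis by (subst L2_inner_commute) simp
  qed
  show "L2_inner (\<lambda>z. \<Sum>j<N. c j * tm_basis \<alpha> j z) (\<lambda>z. blaschke \<alpha> z ^ N * h z) = 0"
    by (subst L2_inner_sum_left) (auto intro!: L2_continuous continuous_on_tm_basis_circle \<alpha> Th simp: orth)
qed

lemma model_space_L2: "f \<in> model_space \<Theta> \<Longrightarrow> f \<in> L2"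
  by (simp add: model_space_def H2_iff)

text \<open>
  The Szego kernel at \<open>w\<close> is the kernel of the model space plus a multiple of \<open>\<Theta>\<close> times itself. The
  second summand is orthogonal to \<open>g\<close>, so the holomorphic extension of \<open>g\<close> equals the expansion at
  every point \<open>w\<close> of the disc. Comparing radial limits gives equality almost everywhere on the circle.
\<close>

lemma model_space_expansion:
  assumes \<alpha>: "norm \<alpha> < 1" and g: "g \<in> model_space (\<lambda>z. blaschke \<alpha> z ^ N)"
  shows "AE z in circle_measure. g z = (\<Sum>j<N. L2_inner g (tm_basis \<alpha> j) * tm_basis \<alpha> j z)"
proof -
  have gL2: "g \<in> L2" by (rule model_space_L2[OF g])
  obtain G where G: "hardy_extension G g" using g by (auto simp: model_space_def H2_iff)
  define P where "P z = (\<Sum>j<N. L2_inner g (tm_basis \<alpha> j) * tm_basis \<alpha> j z)" for z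
  have GP: "G w = P w" if w: "norm w < 1" for w
  proof -
    define k where "k z = 1 / (1 - cnj w * z)" for z
    have k: "continuous_on (cball 0 1) k" "k holomorphic_on ball 0 1"
      unfolding k_def[abs_def]
      by (intro continuous_intros holomorphic_intros ballI one_minus_cnj_mult_nz w; simp)+
    have kH: "k \<in> H2" by (rule H2_disc_algebra[OF k])
    have kL: "k \<in> L2" using kH by (simp add: H2_iff)
    have TkL: "(\<lambda>z. blaschke \<alpha> z ^ N * k z) \<in> L2"
      using k \<alpha> by (intro L2_continuous continuous_intros continuous_on_subset[OF k(1)]
          continuous_on_subset[OF continuous_on_blaschke[OF \<alpha>]]) auto
    have "G w * 1 = (LINT z|circle_measure. g z * (1 * (z / (z - w))))"
      by (rule H2_Cauchy_formula[OF gL2 G _ _ w, symmetric]) auto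
    also have "\<dots> = (LINT z|circle_measure. (\<Sum>j<N. tm_basis \<alpha> j w * (g z * cnj (tm_basis \<alpha> j z))) +
        blaschke \<alpha> w ^ N * (g z * cnj (blaschke \<alpha> z ^ N * k z)))"
    proof (intro Bochner_Integration.integral_cong refl)
      fix z assume "z \<in> space circle_measure"
      then have z: "norm z = 1" by (simp add: space_circle_measure)
      have nz: "1 - cnj w * z \<noteq> 0" using one_minus_cnj_mult_nz[OF w, of z] z by simp
      have "z / (z - w) = cnj (k z)"
        unfolding k_def complex_cnj_divide cnj_one_minus_cnj_mult_on_circle[OF z] by simp
      moreover have "k z = (\<Sum>j<N. cnj (tm_basis \<alpha> j w) * tm_basis \<alpha> j z) + cnj (blaschke \<alpha> w ^ N) * (blaschke \<alpha> z ^ N * k z)"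
        unfolding tm_basis_kernel[OF \<alpha> w eq_refl[OF z]] k_def using nz by (simp add: field_simps)
      ultimately have "z / (z - w) = cnj ((\<Sum>j<N. cnj (tm_basis \<alpha> j w) * tm_basis \<alpha> j z) + cnj (blaschke \<alpha> w ^ N) * (blaschke \<alpha> z ^ N * k z))"
        by simp
      also have "\<dots> = (\<Sum>j<N. tm_basis \<alpha> j w * cnj (tm_basis \<alpha> j z)) + blaschke \<alpha> w ^ N * cnj (blaschke \<alpha> z ^ N * k z)"
        by (simp only: complex_cnj_add complex_cnj_mult cnj_sum complex_cnj_cnj)
      finally show "g z * (1 * (z / (z - w))) = (\<Sum>j<N. tm_basis \<alpha> j w * (g z * cnj (tm_basis \<alpha> j z))) +
        blaschke \<alpha> w ^ N * (g z * cnj (blaschke \<alpha> z ^ N * k z))"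
        by (simp only: mult_1 distrib_left sum_distrib_left mult_ac)
    qed
    also have "\<dots> = (\<Sum>j<N. tm_basis \<alpha> j w * L2_inner g (tm_basis \<alpha> j)) + blaschke \<alpha> w ^ N * L2_inner g (\<lambda>z. blaschke \<alpha> z ^ N * k z)"
    proof -
      have i1: "integrable circle_measure (\<lambda>z. tm_basis \<alpha> j w * (g z * cnj (tm_basis \<alpha> j z)))" for j
        by (intro integrable_mult_right integrable_mult_L2 gL2 L2_cnj L2_continuous continuous_on_tm_basis_circle \<alpha>)
      have i2: "integrable circle_measure (\<lambda>z. blaschke \<alpha> w ^ N * (g z * cnj (blaschke \<alpha> z ^ N * k z)))"
        by (intro integrable_mult_right integrable_mult_L2 gL2 L2_cnj TkL)
      show ?thesis
        unfolding L2_inner_def Bochner_Integration.integral_add[OF Bochner_Integration.integrable_sum[OF i1] i2]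
          Bochner_Integration.integral_sum[OF i1] integral_mult_right_zero ..
    qed
    also have "L2_inner g (\<lambda>z. blaschke \<alpha> z ^ N * k z) = 0"
      using g kH by (auto simp: model_space_def)
    finally show ?thesis by (simp add: P_def mult.commute)
  qed
  have "has_boundary_values G g" using G by (simp add: hardy_extension_def)
  moreover have "has_boundary_values P P"
  proof -
    have "continuous_on (cball 0 1) P" "P holomorphic_on ball 0 1"
      unfolding P_def[abs_def]
      by (intro continuous_intros holomorphic_intros continuous_on_tm_basis holomorphic_on_tm_basis \<alpha>)+
    from hardy_extension_disc_algebra[OF this] show ?thesis by (simp add: hardy_extension_def)
  qed
  ultimately have "AE z in circle_measure. ((\<lambda>r::real. G (of_real r * z)) \<longlongrightarrow> g z) (at_left 1) \<and>
      ((\<lambda>r::real. P (of_real r * z)) \<longlongrightarrow> P z) (at_left 1) \<and> norm z = 1"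
    unfolding has_boundary_values_def using AE_space[of circle_measure]
    by eventually_elim (simp add: space_circle_measure)
  then show ?thesis
  proof eventually_elim
    case (elim z)
    have "eventually (\<lambda>r. r \<in> {0<..<1}) (at_left (1::real))"
      by (rule eventually_at_left_real) simp
    then have "eventually (\<lambda>r. G (of_real r * z) = P (of_real r * z)) (at_left (1::real))"
      by eventually_elim (use elim in \<open>auto intro!: GP simp: norm_mult\<close>)
    with elim have "((\<lambda>r::real. P (of_real r * z)) \<longlongrightarrow> g z) (at_left 1)"
      by (auto intro: Lim_transform_eventually)
    with elim have "g z = P z" using tendsto_unique[of "at_left (1::real)"] by auto
    then show ?case by (simp add: P_def)
  qed
qed

text \<open>
  The projection is defined by choice. Its defining property determines the inner products with the
  basis and hence, by \<open>model_space_expansion\<close>, its class.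
\<close>

lemma model_proj_expansion:
  fixes N :: nat
  assumes \<alpha>: "norm \<alpha> < 1" and u: "u \<in> L2"
  defines "\<Theta> \<equiv> \<lambda>z. blaschke \<alpha> z ^ N"
  shows "model_proj \<Theta> u \<in> L2"
    and "AE z in circle_measure. model_proj \<Theta> u z = (\<Sum>j<N. L2_inner u (tm_basis \<alpha> j) * tm_basis \<alpha> j z)"
proof -
  have eL: "tm_basis \<alpha> j \<in> L2" for j by (intro L2_continuous continuous_on_tm_basis_circle \<alpha>)
  have sL: "(\<lambda>z. \<Sum>j<N. c j * tm_basis \<alpha> j z) \<in> L2" for c
    by (intro L2_continuous continuous_intros continuous_on_tm_basis_circle \<alpha>)
  let ?v = "\<lambda>z. \<Sum>j<N. L2_inner u (tm_basis \<alpha> j) * tm_basis \<alpha> j z"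
  define is_proj where "is_proj v \<longleftrightarrow> v \<in> model_space \<Theta> \<and> (\<forall>g\<in>model_space \<Theta>. L2_inner (\<lambda>z. u z - v z) g = 0)" for v
  have "is_proj ?v"
    unfolding is_proj_def
  proof (intro conjI ballI)
    show "?v \<in> model_space \<Theta>" unfolding \<Theta>_def by (rule tm_basis_sum_in_model_space[OF \<alpha>])
    fix g assume g: "g \<in> model_space \<Theta>"
    have dL: "(\<lambda>z. u z - ?v z) \<in> L2" by (intro L2_diff u sL)
    have d0: "L2_inner (\<lambda>z. u z - ?v z) (tm_basis \<alpha> i) = 0" if "i < N" for i
      using that by (simp add: L2_inner_diff_left[OF u sL eL] L2_inner_sum_left[OF eL eL] L2_inner_tm_basis[OF \<alpha>]
          if_distrib cong: if_cong)
    have "L2_inner (\<lambda>z. u z - ?v z) g = L2_inner (\<lambda>z. u z - ?v z) (\<lambda>z. \<Sum>j<N. L2_inner g (tm_basis \<alpha> j) * tm_basis \<alpha> j z)"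
      using model_space_expansion[OF \<alpha>] g
      by (intro L2_inner_cong_AE dL sL) (auto simp: \<Theta>_def intro: model_space_L2)
    also have "\<dots> = cnj (\<Sum>j<N. L2_inner g (tm_basis \<alpha> j) * L2_inner (tm_basis \<alpha> j) (\<lambda>z. u z - ?v z))"
      by (subst L2_inner_commute) (simp add: L2_inner_sum_left[OF eL dL])
    also have "\<dots> = 0"
      by (subst L2_inner_commute[of "tm_basis \<alpha> _"]) (simp add: d0)
    finally show "L2_inner (\<lambda>z. u z - ?v z) g = 0" .
  qed
  then have "is_proj (SOME v. is_proj v)" by (rule someI[of is_proj])
  then have P: "model_proj \<Theta> u \<in> model_space \<Theta> \<and> (\<forall>g\<in>model_space \<Theta>. L2_inner (\<lambda>z. u z - model_proj \<Theta> u z) g = 0)"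
    unfolding model_proj_def is_proj_def .
  then show L: "model_proj \<Theta> u \<in> L2" by (blast intro: model_space_L2)
  have "L2_inner (model_proj \<Theta> u) (tm_basis \<alpha> j) = L2_inner u (tm_basis \<alpha> j)" if "j < N" for j
  proof -
    have "(\<lambda>z. \<Sum>i<N. (if i = j then 1 else 0) * tm_basis \<alpha> i z) \<in> model_space \<Theta>"
      unfolding \<Theta>_def by (rule tm_basis_sum_in_model_space[OF \<alpha>])
    moreover have "(\<lambda>z. \<Sum>i<N. (if i = j then 1 else 0) * tm_basis \<alpha> i z) = tm_basis \<alpha> j"
      using that by (simp add: fun_eq_iff if_distrib[of "\<lambda>x. x * _"] cong: if_cong)
    ultimately have "L2_inner (\<lambda>z. u z - model_proj \<Theta> u z) (tm_basis \<alpha> j) = 0" using P by simp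
    then show ?thesis by (simp add: L2_inner_diff_left[OF u L eL])
  qed
  then show "AE z in circle_measure. model_proj \<Theta> u z = (\<Sum>j<N. L2_inner u (tm_basis \<alpha> j) * tm_basis \<alpha> j z)"
    using model_space_expansion[OF \<alpha>, of "model_proj \<Theta> u" N] P by (simp add: \<Theta>_def)
qed

section \<open>Toeplitz matrices of truncated Toeplitz operators\<close>

text \<open>
  The Fourier coefficient of \<open>\<phi>\<close> after the change of variables \<open>blaschke \<alpha>\<close>, expressed on the original
  circle.
\<close>

definition tto_coeff :: "complex \<Rightarrow> (complex \<Rightarrow> complex) \<Rightarrow> int \<Rightarrow> complex" where
  "tto_coeff \<alpha> \<phi> k = (LINT z|circle_measure. \<phi> z * (poisson \<alpha> z * blaschke \<alpha> z powi (- k)))"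

lemma tto_expansion:
  fixes N :: nat and c :: "nat \<Rightarrow> complex"
  assumes \<alpha>: "norm \<alpha> < 1" and \<phi>: "\<phi> \<in> L2" and f: "f \<in> borel_measurable circle_measure"
    and fc: "AE z in circle_measure. f z = (\<Sum>j<N. c j * tm_basis \<alpha> j z)"
  defines "\<Theta> \<equiv> \<lambda>z. blaschke \<alpha> z ^ N" and "d \<equiv> \<lambda>i. \<Sum>j<N. tto_coeff \<alpha> \<phi> (int i - int j) * c j"
  shows "tto \<Theta> \<phi> f \<in> L2"
    and "AE z in circle_measure. tto \<Theta> \<phi> f z = (\<Sum>i<N. d i * tm_basis \<alpha> i z)"
proof -
  let ?f = "\<lambda>z. \<Sum>j<N. c j * tm_basis \<alpha> j z"
  have cf: "continuous_on (sphere 0 1) ?f"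
    by (intro continuous_intros continuous_on_tm_basis_circle \<alpha>)
  have eL: "tm_basis \<alpha> j \<in> L2" for j by (intro L2_continuous continuous_on_tm_basis_circle \<alpha>)
  have uL': "(\<lambda>z. \<phi> z * ?f z) \<in> L2" by (intro L2_mult_continuous \<phi> cf)
  have ae: "AE z in circle_measure. \<phi> z * f z = \<phi> z * ?f z" using fc by eventually_elim simp
  have uL: "(\<lambda>z. \<phi> z * f z) \<in> L2"
    by (rule L2_cong_AE[OF uL' _ ae]) (intro borel_measurable_times measurable_L2 \<phi> f)
  have "L2_inner (\<lambda>z. \<phi> z * f z) (tm_basis \<alpha> i) = d i" for i
  proof -
    have "L2_inner (\<lambda>z. \<phi> z * f z) (tm_basis \<alpha> i) = L2_inner (\<lambda>z. \<phi> z * ?f z) (tm_basis \<alpha> i)"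
      by (intro L2_inner_cong_AE uL uL' eL ae) simp
    also have "\<dots> = (LINT z|circle_measure. (\<Sum>j<N. (\<phi> z * (poisson \<alpha> z * blaschke \<alpha> z powi (- (int i - int j)))) * c j))"
      unfolding L2_inner_def
    proof (intro Bochner_Integration.integral_cong refl)
      fix z assume "z \<in> space circle_measure"
      then have z: "norm z = 1" by (simp add: space_circle_measure)
      have "\<phi> z * ?f z * cnj (tm_basis \<alpha> i z) = (\<Sum>j<N. \<phi> z * (tm_basis \<alpha> j z * cnj (tm_basis \<alpha> i z)) * c j)"
        by (simp add: sum_distrib_left sum_distrib_right mult_ac)
      then show "\<phi> z * ?f z * cnj (tm_basis \<alpha> i z) =
          (\<Sum>j<N. (\<phi> z * (poisson \<alpha> z * blaschke \<alpha> z powi (- (int i - int j)))) * c j)"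
        unfolding tm_basis_mult_cnj[OF \<alpha> z] by simp
    qed
    also have "\<dots> = d i"
    proof -
      have i: "integrable circle_measure (\<lambda>z. (\<phi> z * (poisson \<alpha> z * blaschke \<alpha> z powi (- (int i - int j)))) * c j)" for j
        by (intro integrable_mult_left integrable_mult_L2 \<phi> L2_continuous continuous_on_mult continuous_on_poisson
            continuous_on_blaschke_power_int \<alpha>)
      show ?thesis unfolding Bochner_Integration.integral_sum[OF i] integral_mult_left_zero d_def tto_coeff_def ..
    qed
    finally show ?thesis .
  qed
  then show "tto \<Theta> \<phi> f \<in> L2" "AE z in circle_measure. tto \<Theta> \<phi> f z = (\<Sum>i<N. d i * tm_basis \<alpha> i z)"
    using model_proj_expansion[OF \<alpha> uL, of N] unfolding \<Theta>_def tto_def by simp_all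
qed

lemma L2_norm_sq_tm_basis_sum:
  assumes \<alpha>: "norm \<alpha> < 1"
  shows "(LINT z|circle_measure. (norm (\<Sum>j<N. d j * tm_basis \<alpha> j z))\<^sup>2) = (\<Sum>j<N. (norm (d j))\<^sup>2)"
proof -
  let ?g = "\<lambda>z. \<Sum>j<N. d j * tm_basis \<alpha> j z"
  have eL: "tm_basis \<alpha> j \<in> L2" for j by (intro L2_continuous continuous_on_tm_basis_circle \<alpha>)
  have gL: "?g \<in> L2" by (intro L2_continuous continuous_intros continuous_on_tm_basis_circle \<alpha>)
  have ge: "L2_inner ?g (tm_basis \<alpha> i) = d i" if "i < N" for i
    using that by (simp add: L2_inner_sum_left[OF eL eL] L2_inner_tm_basis[OF \<alpha>] if_distrib cong: if_cong)
  have "complex_of_real (LINT z|circle_measure. (norm (?g z))\<^sup>2) = L2_inner ?g ?g"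
    unfolding L2_inner_def complex_norm_square[symmetric] integral_complex_of_real ..
  also have "\<dots> = (\<Sum>j<N. d j * cnj (L2_inner ?g (tm_basis \<alpha> j)))"
    unfolding L2_inner_sum_left[OF eL gL] by (subst L2_inner_commute) simp
  also have "\<dots> = (\<Sum>j<N. d j * cnj (d j))" by (intro sum.cong refl) (simp add: ge)
  also have "\<dots> = complex_of_real (\<Sum>j<N. (norm (d j))\<^sup>2)"
    unfolding of_real_sum complex_norm_square ..
  finally show ?thesis by (simp only: of_real_eq_iff)
qed

lemma L2_norm_tto:
  fixes N :: nat and c :: "nat \<Rightarrow> complex"
  assumes \<alpha>: "norm \<alpha> < 1" and \<phi>: "\<phi> \<in> L2"
    and fc: "\<And>z. norm z = 1 \<Longrightarrow> f z = (\<Sum>j<N. c j * tm_basis \<alpha> j z)"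
  shows "(L2_norm (tto (\<lambda>z. blaschke \<alpha> z ^ N) \<phi> f))\<^sup>2 =
    (\<Sum>i<N. (norm (\<Sum>j<N. tto_coeff \<alpha> \<phi> (int i - int j) * c j))\<^sup>2)"
proof -
  have cf: "continuous_on (sphere 0 1) (\<lambda>z. \<Sum>j<N. c j * tm_basis \<alpha> j z)"
    by (intro continuous_intros continuous_on_tm_basis_circle \<alpha>)
  then have "continuous_on (sphere 0 1) f"
    using continuous_on_cong[of "sphere 0 1" "sphere 0 1" f] fc by auto
  then have fm: "f \<in> borel_measurable circle_measure" by (rule borel_measurable_circle_continuous)
  have ae: "AE z in circle_measure. f z = (\<Sum>j<N. c j * tm_basis \<alpha> j z)"
    by (rule AE_I2) (simp add: fc space_circle_measure)
  note T = tto_expansion[OF \<alpha> \<phi> fm ae]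
  have "(L2_norm (tto (\<lambda>z. blaschke \<alpha> z ^ N) \<phi> f))\<^sup>2 =
     (LINT z|circle_measure. (norm (\<Sum>i<N. (\<Sum>j<N. tto_coeff \<alpha> \<phi> (int i - int j) * c j) * tm_basis \<alpha> i z))\<^sup>2)"
    unfolding L2_norm_sq
  proof (rule integral_cong_AE)
    show "(\<lambda>z. (norm (tto (\<lambda>z. blaschke \<alpha> z ^ N) \<phi> f z))\<^sup>2) \<in> borel_measurable circle_measure"
      by (intro borel_measurable_power measurable_compose[OF measurable_L2[OF T(1)] borel_measurable_norm])
    show "(\<lambda>z. (norm (\<Sum>i<N. (\<Sum>j<N. tto_coeff \<alpha> \<phi> (int i - int j) * c j) * tm_basis \<alpha> i z))\<^sup>2) \<in> borel_measurable circle_measure"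
      by (intro borel_measurable_circle_continuous continuous_intros continuous_on_tm_basis_circle \<alpha>)
    show "AE z in circle_measure. (norm (tto (\<lambda>z. blaschke \<alpha> z ^ N) \<phi> f z))\<^sup>2 =
        (norm (\<Sum>i<N. (\<Sum>j<N. tto_coeff \<alpha> \<phi> (int i - int j) * c j) * tm_basis \<alpha> i z))\<^sup>2"
      using T(2) by eventually_elim simp
  qed
  then show ?thesis by (simp only: L2_norm_sq_tm_basis_sum[OF \<alpha>])
qed

lemma is_symbol_of_trig:
  assumes \<alpha>: "norm \<alpha> < 1" and \<phi>: "\<phi> \<in> L2" and \<psi>: "trig \<psi>"
    and coeff: "\<And>k. \<bar>k\<bar> < int N \<Longrightarrow> fourier \<psi> k = tto_coeff \<alpha> \<phi> k"
  defines "\<Theta> \<equiv> \<lambda>z. blaschke \<alpha> z ^ N"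
  shows "is_symbol \<Theta> (\<lambda>z. \<psi> (blaschke \<alpha> z)) (tto \<Theta> \<phi>)"
proof -
  have c: "continuous_on (sphere 0 1) (\<lambda>z. \<psi> (blaschke \<alpha> z))"
    by (rule continuous_on_compose2[OF trig_continuous[OF \<psi>]])
      (auto intro: continuous_on_subset[OF continuous_on_blaschke[OF \<alpha>]] simp: norm_blaschke_circle[OF \<alpha>])
  have L: "(\<lambda>z. \<psi> (blaschke \<alpha> z)) \<in> L2" by (rule L2_continuous[OF c])
  have t: "tto_coeff \<alpha> (\<lambda>z. \<psi> (blaschke \<alpha> z)) k = tto_coeff \<alpha> \<phi> k" if "\<bar>k\<bar> < int N" for k
    using integral_trig_compose_blaschke[OF \<alpha> \<psi>, of k] coeff[OF that] by (simp add: tto_coeff_def)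
  show ?thesis
    unfolding is_symbol_def
  proof (intro conjI L ballI)
    fix f assume "f \<in> model_space \<Theta> \<inter> Hinf"
    then have f: "f \<in> model_space \<Theta>" by simp
    have fm: "f \<in> borel_measurable circle_measure" by (rule measurable_L2[OF model_space_L2[OF f]])
    note ae = model_space_expansion[OF \<alpha> f[unfolded \<Theta>_def]]
    have eq: "(\<Sum>j<N. tto_coeff \<alpha> (\<lambda>z. \<psi> (blaschke \<alpha> z)) (int i - int j) * c j) =
        (\<Sum>j<N. tto_coeff \<alpha> \<phi> (int i - int j) * c j)" if "i < N" for i and c :: "nat \<Rightarrow> complex"
      using that by (intro sum.cong refl) (simp add: t)
    show "AE z in circle_measure. tto \<Theta> \<phi> f z = tto \<Theta> (\<lambda>z. \<psi> (blaschke \<alpha> z)) f z"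
      using tto_expansion(2)[OF \<alpha> \<phi> fm ae] tto_expansion(2)[OF \<alpha> L fm ae]
      unfolding \<Theta>_def by eventually_elim (simp add: eq)
  qed
qed

lemma sqrt_kernel_factor:
  assumes \<alpha>: "norm \<alpha> < 1" and w: "norm w < 1"
  shows "(norm (of_real (sqrt ((1 - (norm w)\<^sup>2) / (1 - (norm (blaschke \<alpha> w ^ N))\<^sup>2))) * (tm_basis \<alpha> 0 w)))\<^sup>2 =
    (1 - (norm (blaschke \<alpha> w))\<^sup>2) / (1 - (norm (blaschke \<alpha> w) ^ N)\<^sup>2)"
proof -
  have "(norm (blaschke \<alpha> w ^ N))\<^sup>2 \<le> 1"
    using norm_blaschke_less[OF assms] by (simp add: norm_power power_le_one)
  moreover have "(norm w)\<^sup>2 < 1" "(norm \<alpha>)\<^sup>2 < 1" using assms by (auto simp: abs_square_less_1)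
  ultimately have nn: "(1 - (norm w)\<^sup>2) / (1 - (norm (blaschke \<alpha> w ^ N))\<^sup>2) \<ge> 0" "1 - (norm \<alpha>)\<^sup>2 \<ge> 0" by auto
  have "(norm (of_real (sqrt ((1 - (norm w)\<^sup>2) / (1 - (norm (blaschke \<alpha> w ^ N))\<^sup>2))) * (tm_basis \<alpha> 0 w)))\<^sup>2 =
     ((1 - (norm w)\<^sup>2) / (1 - (norm (blaschke \<alpha> w ^ N))\<^sup>2)) * ((1 - (norm \<alpha>)\<^sup>2) / (norm (1 - cnj \<alpha> * w))\<^sup>2)"
    using nn unfolding tm_basis_def norm_mult norm_divide power_mult_distrib power_divide norm_of_real power2_abs
    by (simp add: real_sqrt_pow2)
  also have "\<dots> = ((1 - (norm \<alpha>)\<^sup>2) * (1 - (norm w)\<^sup>2) / (norm (1 - cnj \<alpha> * w))\<^sup>2) / (1 - (norm (blaschke \<alpha> w ^ N))\<^sup>2)"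
    by (simp add: mult_ac)
  finally show ?thesis
    unfolding one_minus_norm_blaschke_sq[OF \<alpha> less_imp_le[OF w]] norm_power .
qed

lemma tm_basis_eq: "tm_basis \<alpha> j z = tm_basis \<alpha> 0 z * blaschke \<alpha> z ^ j"
  by (simp add: tm_basis_def)

lemma L2_norm_tto_test_functions:
  fixes N :: nat
  assumes \<alpha>: "norm \<alpha> < 1" and \<phi>: "\<phi> \<in> L2" and x: "norm x < 1"
  defines "\<Theta> \<equiv> \<lambda>z. blaschke \<alpha> z ^ N" and "t \<equiv> tto_coeff \<alpha> \<phi>"
  shows "(L2_norm (tto \<Theta> \<phi> (norm_kernel \<Theta> (blaschke \<alpha> (cnj x)))))\<^sup>2 =
      (1 - (norm x)\<^sup>2) / (1 - (norm x ^ N)\<^sup>2) * (\<Sum>i<N. (norm (\<Sum>j<N. t (int i - int j) * x ^ j))\<^sup>2)"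
    and "(L2_norm (tto \<Theta> \<phi> (norm_diff_quot \<Theta> (blaschke \<alpha> x))))\<^sup>2 =
      (1 - (norm x)\<^sup>2) / (1 - (norm x ^ N)\<^sup>2) * (\<Sum>i<N. (norm (\<Sum>j<N. t (int i - int j) * x ^ (N - 1 - j)))\<^sup>2)"
proof -
  define s where "s w = complex_of_real (sqrt ((1 - (norm w)\<^sup>2) / (1 - (norm (blaschke \<alpha> w ^ N))\<^sup>2)))" for w
  have pull: "(\<Sum>i<N. (norm (\<Sum>j<N. t (int i - int j) * (r * y j)))\<^sup>2) =
      (norm r)\<^sup>2 * (\<Sum>i<N. (norm (\<Sum>j<N. t (int i - int j) * y j))\<^sup>2)" for r y
  proof -
    have e: "(\<Sum>j<N. t (int i - int j) * (r * y j)) = r * (\<Sum>j<N. t (int i - int j) * y j)" for i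
      by (simp add: sum_distrib_left mult_ac)
    show ?thesis unfolding e norm_mult power_mult_distrib by (rule sum_distrib_left[symmetric])
  qed
  have *: "norm (blaschke \<alpha> y) < 1" "blaschke \<alpha> (blaschke \<alpha> y) = y"
    "(norm (s (blaschke \<alpha> y) * tm_basis \<alpha> 0 (blaschke \<alpha> y)))\<^sup>2 = (1 - (norm y)\<^sup>2) / (1 - (norm y ^ N)\<^sup>2)"
    if "norm y < 1" for y
    using norm_blaschke_less[OF \<alpha> that] blaschke_involution[OF \<alpha> less_imp_le[OF that]]
      sqrt_kernel_factor[OF \<alpha> norm_blaschke_less[OF \<alpha> that], of N]
    by (simp_all add: s_def)
  define w where "w = blaschke \<alpha> (cnj x)"
  have w: "norm w < 1" "blaschke \<alpha> w = cnj x" "(norm (s w * tm_basis \<alpha> 0 w))\<^sup>2 = (1 - (norm x)\<^sup>2) / (1 - (norm x ^ N)\<^sup>2)"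
    using *[of "cnj x"] x by (simp_all add: w_def)
  have k: "norm_kernel \<Theta> w z = (\<Sum>j<N. ((s w * cnj (tm_basis \<alpha> 0 w)) * x ^ j) * tm_basis \<alpha> j z)" if z: "norm z = 1" for z
  proof -
    have "norm_kernel \<Theta> w z = s w * (\<Sum>j<N. cnj (tm_basis \<alpha> j w) * tm_basis \<alpha> j z)"
      unfolding tm_basis_kernel[OF \<alpha> w(1) eq_refl[OF z]] by (simp add: norm_kernel_def \<Theta>_def s_def)
    also have "\<dots> = (\<Sum>j<N. ((s w * cnj (tm_basis \<alpha> 0 w)) * x ^ j) * tm_basis \<alpha> j z)"
      unfolding sum_distrib_left
      by (intro sum.cong refl, subst tm_basis_eq[of \<alpha> _ w]) (simp add: w(2))
    finally show ?thesis .
  qed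
  show "(L2_norm (tto \<Theta> \<phi> (norm_kernel \<Theta> (blaschke \<alpha> (cnj x)))))\<^sup>2 =
      (1 - (norm x)\<^sup>2) / (1 - (norm x ^ N)\<^sup>2) * (\<Sum>i<N. (norm (\<Sum>j<N. t (int i - int j) * x ^ j))\<^sup>2)"
  proof -
    have "(L2_norm (tto \<Theta> \<phi> (norm_kernel \<Theta> w)))\<^sup>2 = (\<Sum>i<N. (norm (\<Sum>j<N. t (int i - int j) * ((s w * cnj (tm_basis \<alpha> 0 w)) * x ^ j)))\<^sup>2)"
      unfolding \<Theta>_def t_def by (rule L2_norm_tto[OF \<alpha> \<phi> k[unfolded \<Theta>_def]])
    also have "\<dots> = (norm (s w * tm_basis \<alpha> 0 w))\<^sup>2 * (\<Sum>i<N. (norm (\<Sum>j<N. t (int i - int j) * x ^ j))\<^sup>2)"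
      unfolding pull by (simp add: norm_mult)
    finally show ?thesis unfolding w(3) by (simp only: w_def)
  qed
  define v where "v = blaschke \<alpha> x"
  have v: "norm v < 1" "blaschke \<alpha> v = x" "(norm (s v * tm_basis \<alpha> 0 v))\<^sup>2 = (1 - (norm x)\<^sup>2) / (1 - (norm x ^ N)\<^sup>2)"
    using *[of x] x by (simp_all add: v_def)
  have d: "norm_diff_quot \<Theta> v z = (\<Sum>j<N. (- (s v * tm_basis \<alpha> 0 v) * x ^ (N - 1 - j)) * tm_basis \<alpha> j z)" if z: "norm z = 1" for z
  proof -
    have "z \<noteq> v" using z v by auto
    from tm_basis_diff_quot[OF \<alpha> v(1) eq_refl[OF z] this, of N]
    have "norm_diff_quot \<Theta> v z = - s v * (\<Sum>j<N. tm_basis \<alpha> (N - 1 - j) v * tm_basis \<alpha> j z)"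
      by (simp add: norm_diff_quot_def \<Theta>_def s_def)
    also have "\<dots> = (\<Sum>j<N. (- (s v * tm_basis \<alpha> 0 v) * x ^ (N - 1 - j)) * tm_basis \<alpha> j z)"
      unfolding sum_distrib_left
      by (intro sum.cong refl, subst tm_basis_eq[of \<alpha> _ v]) (simp add: v(2))
    finally show ?thesis .
  qed
  show "(L2_norm (tto \<Theta> \<phi> (norm_diff_quot \<Theta> (blaschke \<alpha> x))))\<^sup>2 =
      (1 - (norm x)\<^sup>2) / (1 - (norm x ^ N)\<^sup>2) * (\<Sum>i<N. (norm (\<Sum>j<N. t (int i - int j) * x ^ (N - 1 - j)))\<^sup>2)"
  proof -
    have "(L2_norm (tto \<Theta> \<phi> (norm_diff_quot \<Theta> v)))\<^sup>2 = (\<Sum>i<N. (norm (\<Sum>j<N. t (int i - int j) * ((- (s v * tm_basis \<alpha> 0 v)) * x ^ (N - 1 - j))))\<^sup>2)"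
      unfolding \<Theta>_def t_def by (rule L2_norm_tto[OF \<alpha> \<phi> d[unfolded \<Theta>_def]])
    also have "\<dots> = (norm (s v * tm_basis \<alpha> 0 v))\<^sup>2 * (\<Sum>i<N. (norm (\<Sum>j<N. t (int i - int j) * x ^ (N - 1 - j)))\<^sup>2)"
      unfolding pull by (simp add: norm_mult)
    finally show ?thesis unfolding v(3) by (simp only: v_def)
  qed
qed

text \<open>
  This is used when \<open>rho\<close> is infinite and any bounded symbol will do.
\<close>

lemma trig_with_coeffs:
  assumes N: "N \<ge> 1"
  obtains \<psi> where "trig \<psi>" "\<And>k. \<bar>k\<bar> < int N \<Longrightarrow> fourier \<psi> k = t k"
proof
  show "trig (fejer_mean N (\<lambda>k. t k / of_real (tent N k)))" by (rule trig_fejer_mean)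
  fix k :: int assume "\<bar>k\<bar> < int N"
  then have "tent N k \<noteq> 0" using N by (auto simp: tent_def max_def field_simps)
  then show "fourier (fejer_mean N (\<lambda>k. t k / of_real (tent N k))) k = t k"
    by (simp add: fourier_fejer_mean[OF N])
qed

text \<open>
  The case \<open>\<rho> = 0\<close>: the coefficients are then bounded by \<open>21 * \<rho>'\<close> for every \<open>\<rho>' > 0\<close>, so they vanish.
\<close>

lemma toeplitz_bounded_symbol:
  fixes t :: "int \<Rightarrow> complex"
  assumes N: "N \<ge> 1" and \<rho>: "\<rho> \<ge> 0"
    and A: "\<And>x. norm x < 1 \<Longrightarrow> (1 - (norm x)\<^sup>2) / (1 - (norm x ^ N)\<^sup>2) *
       (\<Sum>i<N. (norm (\<Sum>j<N. t (int i - int j) * x ^ j))\<^sup>2) \<le> \<rho>\<^sup>2"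
    and B: "\<And>x. norm x < 1 \<Longrightarrow> (1 - (norm x)\<^sup>2) / (1 - (norm x ^ N)\<^sup>2) *
       (\<Sum>i<N. (norm (\<Sum>j<N. t (int i - int j) * x ^ (N - 1 - j)))\<^sup>2) \<le> \<rho>\<^sup>2"
  shows "\<exists>\<psi>. trig \<psi> \<and> (\<forall>z. norm z = 1 \<longrightarrow> norm (\<psi> z) \<le> 21 * \<rho>) \<and>
    (\<forall>k. \<bar>k\<bar> < int N \<longrightarrow> fourier \<psi> k = t k)"
proof (cases "\<rho> > 0")
  case True
  then show ?thesis using toeplitz_bounded_symbol_pos[OF N True A B] by blast
next
  case False
  then have \<rho>0: "\<rho> = 0" using \<rho> by simp
  have "t k = 0" if k: "\<bar>k\<bar> < int N" for k
  proof -
    have "norm (t k) \<le> 0 + e" if "e > 0" for e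
    proof -
      have e: "e / 21 > 0" using that by simp
      have le: "\<rho>\<^sup>2 \<le> (e / 21)\<^sup>2" by (simp add: \<rho>0)
      obtain \<psi> where \<psi>: "trig \<psi>" "\<And>z. norm z = 1 \<Longrightarrow> norm (\<psi> z) \<le> 21 * (e / 21)" "fourier \<psi> k = t k"
        using toeplitz_bounded_symbol_pos[OF N e order_trans[OF A le] order_trans[OF B le]] k by blast
      have "norm (t k) \<le> (LINT z|circle_measure. norm (\<psi> z * z powi (- k)))"
        unfolding \<psi>(3)[symmetric] fourier_def by (rule integral_norm_bound)
      also have "\<dots> \<le> (LINT z|circle_measure. e)"
        using \<psi>(2) by (intro integral_mono integrable_circle_continuous continuous_intros trig_continuous \<psi>(1))
          (auto simp: space_circle_measure norm_mult norm_power_int)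
      finally show ?thesis by (simp add: circle.prob_space)
    qed
    then have "norm (t k) \<le> 0" by (rule field_le_epsilon)
    then show ?thesis by simp
  qed
  moreover have "fourier (\<lambda>_. 0) k = 0" for k by (simp add: fourier_def)
  ultimately show ?thesis using \<rho>0 trig_0 by (intro exI[of _ "\<lambda>_. 0"]) auto
qed

theorem corollary6p4:
  "\<exists>C::real. C > 0 \<and>
     (\<forall>N::nat. N \<ge> 1 \<longrightarrow> (\<forall>\<alpha>\<in>ball (0::complex) 1. \<forall>\<Theta>. \<Theta> = (\<lambda>z. blaschke \<alpha> z ^ N) \<longrightarrow>
        (\<forall>\<phi>\<in>L2. \<exists>\<phi>\<^sub>0\<in>Linf. is_symbol \<Theta> \<phi>\<^sub>0 (tto \<Theta> \<phi>) \<and>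
           Linf_norm \<phi>\<^sub>0 \<le> ennreal C * rho \<Theta> (tto \<Theta> \<phi>))))"
proof (intro exI[of _ 21] conjI allI impI ballI)
  fix N :: nat and \<alpha> :: complex and \<Theta> and \<phi>
  assume N: "N \<ge> 1" and "\<alpha> \<in> ball 0 1" and \<Theta>: "\<Theta> = (\<lambda>z. blaschke \<alpha> z ^ N)" and \<phi>: "\<phi> \<in> L2"
  then have \<alpha>: "norm \<alpha> < 1" by simp
  define t where "t = tto_coeff \<alpha> \<phi>"
  let ?\<rho> = "rho \<Theta> (tto \<Theta> \<phi>)"
  have main: "\<exists>\<phi>\<^sub>0\<in>Linf. is_symbol \<Theta> \<phi>\<^sub>0 (tto \<Theta> \<phi>) \<and> Linf_norm \<phi>\<^sub>0 \<le> ennreal B"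
    if \<psi>: "trig \<psi>" "\<And>z. norm z = 1 \<Longrightarrow> norm (\<psi> z) \<le> B" "\<And>k. \<bar>k\<bar> < int N \<Longrightarrow> fourier \<psi> k = t k" for \<psi> B
  proof (intro bexI[of _ "\<lambda>z. \<psi> (blaschke \<alpha> z)"] conjI)
    show s: "is_symbol \<Theta> (\<lambda>z. \<psi> (blaschke \<alpha> z)) (tto \<Theta> \<phi>)"
      unfolding \<Theta> by (rule is_symbol_of_trig[OF \<alpha> \<phi> \<psi>(1)]) (simp add: \<psi>(3) t_def)
    have m: "(\<lambda>z. \<psi> (blaschke \<alpha> z)) \<in> borel_measurable circle_measure"
      using s by (auto simp: is_symbol_def intro: measurable_L2)
    show le: "Linf_norm (\<lambda>z. \<psi> (blaschke \<alpha> z)) \<le> ennreal B"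
      unfolding Linf_norm_def
    proof (rule esssup_I)
      show "(\<lambda>z. ennreal (norm (\<psi> (blaschke \<alpha> z)))) \<in> borel_measurable circle_measure"
        by (intro measurable_compose[OF measurable_compose[OF m borel_measurable_norm] measurable_ennreal])
      show "AE z in circle_measure. ennreal (norm (\<psi> (blaschke \<alpha> z))) \<le> ennreal B"
        by (rule AE_I2) (auto simp: space_circle_measure intro!: ennreal_leI \<psi>(2) norm_blaschke_circle[OF \<alpha>])
    qed
    show "(\<lambda>z. \<psi> (blaschke \<alpha> z)) \<in> Linf"
      unfolding Linf_def using m le_less_trans[OF le ennreal_less_top] by simp
  qed
  show "\<exists>\<phi>\<^sub>0\<in>Linf. is_symbol \<Theta> \<phi>\<^sub>0 (tto \<Theta> \<phi>) \<and> Linf_norm \<phi>\<^sub>0 \<le> ennreal 21 * ?\<rho>"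
  proof (cases "?\<rho> = \<infinity>")
    case True
    obtain \<psi> where \<psi>: "trig \<psi>" "\<And>k. \<bar>k\<bar> < int N \<Longrightarrow> fourier \<psi> k = t k"
      using trig_with_coeffs[OF N] by blast
    have "bounded (\<psi> ` sphere 0 1)"
      by (intro compact_imp_bounded compact_continuous_image trig_continuous \<psi>) auto
    then obtain B where "\<And>z. z \<in> sphere 0 1 \<Longrightarrow> norm (\<psi> z) \<le> B"
      unfolding bounded_iff by blast
    with main[of \<psi> B] \<psi> show ?thesis by (auto simp: True ennreal_mult_top)
  next
    case False
    define r where "r = enn2real ?\<rho>"
    have r: "ennreal r = ?\<rho>" "r \<ge> 0" using False by (simp_all add: r_def less_top)
    have L2_norm_nonneg: "L2_norm g \<ge> 0" for g by (simp add: L2_norm_def)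
    have test: "(L2_norm (tto \<Theta> \<phi> (norm_kernel \<Theta> w)))\<^sup>2 \<le> r\<^sup>2 \<and> (L2_norm (tto \<Theta> \<phi> (norm_diff_quot \<Theta> w)))\<^sup>2 \<le> r\<^sup>2"
      if "norm w < 1" for w
    proof -
      have "ennreal (L2_norm (tto \<Theta> \<phi> (norm_kernel \<Theta> w))) \<le> rho_r \<Theta> (tto \<Theta> \<phi>)"
        unfolding rho_r_def using that by (intro SUP_upper) simp
      also have "\<dots> \<le> ennreal r" unfolding r(1) rho_def by simp
      finally have 1: "L2_norm (tto \<Theta> \<phi> (norm_kernel \<Theta> w)) \<le> r" using r(2) by simp
      have "ennreal (L2_norm (tto \<Theta> \<phi> (norm_diff_quot \<Theta> w))) \<le> rho_d \<Theta> (tto \<Theta> \<phi>)"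
        unfolding rho_d_def using that by (intro SUP_upper) simp
      also have "\<dots> \<le> ennreal r" unfolding r(1) rho_def by simp
      finally have "L2_norm (tto \<Theta> \<phi> (norm_diff_quot \<Theta> w)) \<le> r" using r(2) by simp
      with 1 show ?thesis by (auto intro!: power_mono L2_norm_nonneg)
    qed
    have "\<exists>\<psi>. trig \<psi> \<and> (\<forall>z. norm z = 1 \<longrightarrow> norm (\<psi> z) \<le> 21 * r) \<and>
        (\<forall>k. \<bar>k\<bar> < int N \<longrightarrow> fourier \<psi> k = t k)"
    proof (rule toeplitz_bounded_symbol[OF N r(2)])
      fix x :: complex assume x: "norm x < 1"
      show "(1 - (norm x)\<^sup>2) / (1 - (norm x ^ N)\<^sup>2) *
         (\<Sum>i<N. (norm (\<Sum>j<N. t (int i - int j) * x ^ j))\<^sup>2) \<le> r\<^sup>2"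
        using test[of "blaschke \<alpha> (cnj x)"] norm_blaschke_less[OF \<alpha>, of "cnj x"] x
        unfolding \<Theta> L2_norm_tto_test_functions(1)[OF \<alpha> \<phi> x] t_def by simp
      show "(1 - (norm x)\<^sup>2) / (1 - (norm x ^ N)\<^sup>2) *
         (\<Sum>i<N. (norm (\<Sum>j<N. t (int i - int j) * x ^ (N - 1 - j)))\<^sup>2) \<le> r\<^sup>2"
        using test[of "blaschke \<alpha> x"] norm_blaschke_less[OF \<alpha> x]
        unfolding \<Theta> L2_norm_tto_test_functions(2)[OF \<alpha> \<phi> x] t_def by simp
    qed
    then obtain \<psi> where "trig \<psi>" "\<And>z. norm z = 1 \<Longrightarrow> norm (\<psi> z) \<le> 21 * r"
        "\<And>k. \<bar>k\<bar> < int N \<Longrightarrow> fourier \<psi> k = t k" by blast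
    from main[OF this] show ?thesis using r by (simp add: ennreal_mult)
  qed
qed simp

end
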